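(* Let $n \ge 2$ and let $\mu,\nu,\delta \in (0,\infty]$. Then there is a constant $C = C(\mu,\nu,\delta,n)$ such that $$\| v\cdot\mathbf{n} \|_{L^\infty(\mathbf{R}^{n-1})} \le C \left( \| v \|_{vbmo^{\mu,\nu}_\delta(\mathbf{R}^n_+)} + \|\operatorname{div} v \|_{L^n_{\mathrm{ul}}(\Gamma_\delta)} \right)$$ for all vector fields $v \in vbmo^{\mu,\nu}_\delta(\mathbf{R}^n_+)$ with $\operatorname{div} v \in L^n_{\mathrm{ul}}(\Gamma_\delta)$. Here $\Omega=\mathbf{R}^n_+$, $\Gamma = \partial \mathbf{R}^n_+$ is identified with $\mathbf{R}^{n-1}$, and $v\cdot \mathbf{n}$ is the normal trace of $v$ on $\Gamma$.
   Context: $\mathbf{R}^n_+ = \{(x_1,\dots,x_n) : x_n>0\}$. For a domain $\Omega\subset\mathbf{R}^n$ with boundary $\Gamma=\partial\Omega$: $d_\Omega(x)=\inf_{y\in\Gamma}|x-y|$; $\Gamma_\delta=\{x\in\Omega : d_\Omega(x)<\delta\}$ for $0<\delta<\infty$, and $\Gamma_\infty=\Omega$; $\mathbf{n}$ is the exterior unit normal on $\Gamma$; $B_r(x)$ is the closed ball of radius $r$ centered at $x$; $f_B=\frac1{|B|}\int_B f\,dy$. (For $\Omega=\mathbf{R}^n_+$ one has $d_\Omega(x)=x_n$ and $\nabla d_\Omega\cdot v=v_n$.) For $f\in L^1_{\mathrm{loc}}(\Omega)$ and $\mu,\nu\in(0,\infty]$: $$[f]_{BMO^\mu}=\sup\Big\{\tfrac1{|B_r(x)|}\int_{B_r(x)}|f-f_{B_r(x)}|\,dy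 : B_r(x)\subset\Omega,\ r<\mu\Big\},$$ $$[f]_{b^\nu}=\sup\Big\{r^{-n}\int_{\Omega\cap B_r(x)}|f|\,dy : x\in\Gamma,\ 0<r<\nu\Big\}.$$ For a fixed $r_0>0$ (different choices give equivalent norms), an open set $D\subset\mathbf{R}^n$ and $1\le p<\infty$, $L^p_{\mathrm{ul}}(D)$ is the space of $f\in L^p_{\mathrm{loc}}(D)$ with $\|f\|_{L^p_{\mathrm{ul}}(D)}=\sup_{x\in\mathbf{R}^n}\|f\|_{L^p(B_{r_0}(x)\cap D)}<\infty$. For a vector field $v=(v_1,\dots,v_n)$ the seminorm $[v]_{BMO^\mu}$ and the norm $\|v\|_{L^1_{\mathrm{ul}}(\Gamma_\delta)}$ are taken componentwise. The space $vbmo^{\mu,\nu}_\delta(\Omega)$ consists of all vector fields $v\in L^1_{\mathrm{loc}}(\Omega)^n$ with finite norm $$\|v\|_{vbmo^{\mu,\nu}_\delta}=[v]_{BMO^\mu}+\|v\|_{L^1_{\mathrm{ul}}(\Gamma_\delta)}+[\nabla d_\Omega\cdot v]_{b^\nu}.$$ Normal trace: $v\cdot\mathbf{n}$ on $\Gamma$ is understood in the weak sense through integration by parts, i.e. $\int_\Gamma (v\cdot\mathbf{n})\varphi\,d\mathcal{H}^{n-1}=\int_\Omega(\operatorname{div}v)\varphi\,dx+\int_\Omega v\cdot\nabla\varphi\,dx$ for all $\varphi\in C^1_c(\mathbf{R}^n)$ vanishing on $\Omega\setminus\Gamma_{\delta'}$ for some $\delta'<\delta$, where $\operatorname{div} v$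 is the distributional divergence. *)

theory Defs
  imports "HOL-Analysis.Analysis" "HOL-Probability.Essential_Supremum"
begin

text \<open>
  Functions and vector fields are total functions on the whole space; only their values on the
  domain at hand are used. Seminorms and norms take values in \<^typ>\<open>ennreal\<close>, and the
  parameters \<open>\<mu>\<close>, \<open>\<nu>\<close>, \<open>\<delta>\<close> in \<open>(0,\<infinity>]\<close> are positive elements of \<^typ>\<open>ereal\<close>.
\<close>

definition grad :: "('a::euclidean_space \<Rightarrow> real) \<Rightarrow> 'a \<Rightarrow> 'a" where
  "grad f x = (\<Sum>i\<in>Basis. frechet_derivative f (at x) i *\<^sub>R i)"

primrec Ck :: "nat \<Rightarrow> ('a::euclidean_space \<Rightarrow> real) \<Rightarrow> bool" where
  "Ck 0 f \<longleftrightarrow> continuous_on UNIV f"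
| "Ck (Suc k) f \<longleftrightarrow> (\<forall>x. f differentiable (at x)) \<and>
     (\<forall>i\<in>Basis. Ck k (\<lambda>x. frechet_derivative f (at x) i))"

definition supp :: "('a::topological_space \<Rightarrow> real) \<Rightarrow> 'a set" where
  "supp f = closure {x. f x \<noteq> 0}"

definition C1c :: "('a::euclidean_space \<Rightarrow> real) set" where
  "C1c = {\<phi>. Ck 1 \<phi> \<and> compact (supp \<phi>)}"

definition test_functions :: "'a::euclidean_space set \<Rightarrow> ('a \<Rightarrow> real) set" where
  "test_functions D = {\<phi>. (\<forall>k. Ck k \<phi>) \<and> compact (supp \<phi>) \<and> supp \<phi> \<subseteq> D}"

text \<open>Powers with exponent \<open>a > 0\<close> of a possibly infinite quantity.\<close>

definition enn_powr :: "ennreal \<Rightarrow> real \<Rightarrow> ennreal" where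
  "enn_powr x a = (if x = \<infinity> then \<infinity> else ennreal (enn2real x powr a))"

definition Lp_norm :: "real \<Rightarrow> 'a::euclidean_space set \<Rightarrow> ('a \<Rightarrow> real) \<Rightarrow> ennreal" where
  "Lp_norm p D f = enn_powr (\<integral>\<^sup>+x\<in>D. ennreal (\<bar>f x\<bar> powr p) \<partial>lebesgue) (1 / p)"

definition Lp_loc :: "real \<Rightarrow> 'a::euclidean_space set \<Rightarrow> ('a \<Rightarrow> real) set" where
  "Lp_loc p D = {f. set_borel_measurable lebesgue D f \<and>
     (\<forall>K. compact K \<and> K \<subseteq> D \<longrightarrow> Lp_norm p K f < \<infinity>)}"

definition Lp_ul_norm :: "real \<Rightarrow> real \<Rightarrow> 'a::euclidean_space set \<Rightarrow> ('a \<Rightarrow> real) \<Rightarrow> ennreal" where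
  "Lp_ul_norm r\<^sub>0 p D f = (SUP x. Lp_norm p (cball x r\<^sub>0 \<inter> D) f)"

definition Lp_ul :: "real \<Rightarrow> real \<Rightarrow> 'a::euclidean_space set \<Rightarrow> ('a \<Rightarrow> real) set" where
  "Lp_ul r\<^sub>0 p D = {f \<in> Lp_loc p D. Lp_ul_norm r\<^sub>0 p D f < \<infinity>}"

definition bdist :: "'a::euclidean_space set \<Rightarrow> 'a \<Rightarrow> real" where
  "bdist \<Omega> x = infdist x (frontier \<Omega>)"

definition bnbhd :: "'a::euclidean_space set \<Rightarrow> ereal \<Rightarrow> 'a set" where
  "bnbhd \<Omega> \<delta> = {x \<in> \<Omega>. ereal (bdist \<Omega> x) < \<delta>}"

definition avg :: "'a::euclidean_space set \<Rightarrow> ('a \<Rightarrow> real) \<Rightarrow> real" where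
  "avg B f = (LINT y:B|lebesgue. f y) / measure lebesgue B"

definition BMO_seminorm :: "'a::euclidean_space set \<Rightarrow> ereal \<Rightarrow> ('a \<Rightarrow> real) \<Rightarrow> ennreal" where
  "BMO_seminorm \<Omega> \<mu> f =
     (SUP (x, r) \<in> {(x, r). 0 < r \<and> ereal r < \<mu> \<and> cball x r \<subseteq> \<Omega>}.
        (\<integral>\<^sup>+y\<in>cball x r. ennreal \<bar>f y - avg (cball x r) f\<bar> \<partial>lebesgue)
          / emeasure lebesgue (cball x r))"

definition b_seminorm :: "'a::euclidean_space set \<Rightarrow> ereal \<Rightarrow> ('a \<Rightarrow> real) \<Rightarrow> ennreal" where
  "b_seminorm \<Omega> \<nu> f =
     (SUP (x, r) \<in> {(x, r). x \<in> frontier \<Omega> \<and> 0 < r \<and> ereal r < \<nu>}.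
        (\<integral>\<^sup>+y\<in>\<Omega> \<inter> cball x r. ennreal \<bar>f y\<bar> \<partial>lebesgue) / ennreal (r ^ DIM('a)))"

text \<open>For vector fields, the componentwise seminorms are summed over the components.\<close>

definition vbmo_norm ::
  "real \<Rightarrow> 'a::euclidean_space set \<Rightarrow> ereal \<Rightarrow> ereal \<Rightarrow> ereal \<Rightarrow> ('a \<Rightarrow> 'a) \<Rightarrow> ennreal" where
  "vbmo_norm r\<^sub>0 \<Omega> \<mu> \<nu> \<delta> v =
     (\<Sum>i\<in>Basis. BMO_seminorm \<Omega> \<mu> (\<lambda>x. v x \<bullet> i))
     + (\<Sum>i\<in>Basis. Lp_ul_norm r\<^sub>0 1 (bnbhd \<Omega> \<delta>) (\<lambda>x. v x \<bullet> i))
     + b_seminorm \<Omega> \<nu> (\<lambda>x. grad (bdist \<Omega>) x \<bullet> v x)"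

definition vbmo ::
  "real \<Rightarrow> 'a::euclidean_space set \<Rightarrow> ereal \<Rightarrow> ereal \<Rightarrow> ereal \<Rightarrow> ('a \<Rightarrow> 'a) set" where
  "vbmo r\<^sub>0 \<Omega> \<mu> \<nu> \<delta> = {v. (\<forall>i\<in>Basis. (\<lambda>x. v x \<bullet> i) \<in> Lp_loc 1 \<Omega>) \<and> vbmo_norm r\<^sub>0 \<Omega> \<mu> \<nu> \<delta> v < \<infinity>}"

text \<open>The distribution \<open>div v\<close> on the open set \<open>D\<close> is given by the function \<open>g\<close>.\<close>

definition has_distr_div ::
  "'a::euclidean_space set \<Rightarrow> ('a \<Rightarrow> 'a) \<Rightarrow> ('a \<Rightarrow> real) \<Rightarrow> bool" where
  "has_distr_div D v g \<longleftrightarrow> g \<in> Lp_loc 1 D \<and>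
     (\<forall>\<phi>\<in>test_functions D. (LINT x:D|lebesgue. g x * \<phi> x) = - (LINT x:D|lebesgue. v x \<bullet> grad \<phi> x))"

text \<open>
  \<open>\<real>\<^sup>n\<close> with \<open>n \<ge> 2\<close> is \<open>\<real>\<^sup>n\<^sup>-\<^sup>1 \<times> \<real>\<close>, so that \<open>n = CARD('m) + 1\<close> and the last coordinate is
  \<^const>\<open>snd\<close>. The boundary point \<open>(y, 0)\<close> of the half space is identified with \<open>y\<close>, which turns the
  surface measure into Lebesgue measure.
\<close>

definition halfspace :: "((real ^ 'm) \<times> real) set" where
  "halfspace = {x. snd x > 0}"

text \<open>
  \<open>w\<close> is the weak normal trace of \<open>v\<close> on the boundary of the half space, where \<open>g\<close> is the
  divergence of \<open>v\<close> near the boundary. As \<open>\<phi>\<close> vanishes off \<^term>\<open>bnbhd halfspace \<delta>\<close>, it is enough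
  to integrate \<open>g * \<phi>\<close> over that set.
\<close>

definition is_normal_trace ::
  "ereal \<Rightarrow> ((real ^ 'm) \<times> real \<Rightarrow> (real ^ 'm) \<times> real) \<Rightarrow> ((real ^ 'm) \<times> real \<Rightarrow> real)
    \<Rightarrow> (real ^ 'm \<Rightarrow> real) \<Rightarrow> bool" where
  "is_normal_trace \<delta> v g w \<longleftrightarrow> w \<in> Lp_loc 1 UNIV \<and>
     (\<forall>\<phi>\<in>C1c. \<forall>\<delta>'::real. 0 < \<delta>' \<longrightarrow> ereal \<delta>' < \<delta> \<longrightarrow>
        (\<forall>x \<in> halfspace - bnbhd halfspace (ereal \<delta>'). \<phi> x = 0) \<longrightarrow>
        (LINT y|lebesgue. w y * \<phi> (y, 0)) =
          (LINT x:bnbhd halfspace \<delta>|lebesgue. g x * \<phi> x)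
          + (LINT x:halfspace|lebesgue. v x \<bullet> grad \<phi> x))"

definition Linf_norm :: "('a::euclidean_space \<Rightarrow> real) \<Rightarrow> ennreal" where
  "Linf_norm w = esssup lebesgue (\<lambda>y. ennreal \<bar>w y\<bar>)"

end

theory Submission
  imports Defs
begin

text \<open>
  Let \<open>T \<Phi> = \<integral> g \<Phi> + \<integral> v \<bullet> \<nabla>\<Phi>\<close>. Multiplying \<open>\<Phi>\<close> by a cutoff in the last coordinate that equals
  \<open>1\<close> up to height \<open>s / 2\<close> and vanishes above height \<open>s\<close> does not change \<open>T \<Phi>\<close>, since the removed part
  is a test function for the distributional divergence. As \<open>s \<rightarrow> 0\<close>, the terms containing \<open>g\<close> and
  \<open>\<nabla>\<Phi>\<close> tend to \<open>0\<close>, because \<open>v\<close> and \<open>g\<close> are integrable up to the boundary. What remains is at most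
  a multiple of the integral of \<open>\<bar>v\<^sub>n\<bar> \<bar>\<Phi>\<bar> / s\<close> over the strip of height \<open>s\<close>; replacing \<open>\<Phi>\<close> by its boundary
  averages at scale \<open>s\<close> and exchanging the integrals bounds this by the seminorm \<open>b\<^sup>\<nu>\<close> of \<open>v\<^sub>n\<close> times the
  \<open>L\<^sup>1\<close> norm of the boundary values of \<open>\<Phi>\<close>. So \<open>T\<close> factors through the boundary values, and as a
  functional bounded in \<open>L\<^sup>1\<close> it is represented by a function \<open>w\<close> with the same bound almost
  everywhere; \<open>w\<close> comes from minimizing \<open>\<integral> u\<^sup>2 q / 2 - T u\<close> for a weight \<open>q\<close> growing fast at infinity.
\<close>

section \<open>Functions of class \<open>C\<^sup>k\<close>\<close>

text \<open>The seminorm \<open>b_seminorm\<close> sees the normal component only through its mass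
  on balls centred at the boundary, never pointwise. This forces the averaging: freezing
  \<open>\<Phi>\<close> on a ball of radius comparable to \<open>s\<close> costs an error of order
  \<open>s\<close>, which cancels the slope \<open>1 / s\<close> of the cutoff and leaves the
  integral of an integrable function over a vanishing strip. The main term scales like
  \<open>1 / s\<close> (slope) times \<open>1 / s ^ (n - 1)\<close> (average) times
  \<open>s ^ n\<close> (seminorm), so it does not depend on \<open>s\<close>. Two further obstacles
  shape the proof. The distributional divergence is tested with smooth functions, while the cutoffs
  are only of class \<open>C^1\<close>; mollification extends the identity. And an
  \<open>L^1\<close> bound on \<open>T\<close> is no \<open>L^2\<close> bound on a space of infinite
  measure; a weight \<open>q\<close> with \<open>1 / q\<close> integrable repairs this through the
  inequality of \<open>c * \<bar>u\<bar>\<close> with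
  \<open>q * u ^ 2 / 2 + c ^ 2 / (2 * q)\<close>. The minimizer comes without a supremum bound. That
  bound is obtained by testing, and so holds for every trace, not only for the constructed
  one.\<close>

lemma has_derivative_grad:
  fixes f :: "'a::euclidean_space \<Rightarrow> real"
  assumes "f differentiable (at x)"
  shows "(f has_derivative (\<lambda>u. grad f x \<bullet> u)) (at x)"
proof -
  interpret L: linear "frechet_derivative f (at x)"
    by (rule linear_frechet_derivative[OF assms])
  have "grad f x \<bullet> u = frechet_derivative f (at x) u" for u
  proof -
    have "frechet_derivative f (at x) u = frechet_derivative f (at x) (\<Sum>i\<in>Basis. (u \<bullet> i) *\<^sub>R i)"
      by (simp add: euclidean_representation)
    also have "\<dots> = (\<Sum>i\<in>Basis. (u \<bullet> i) * frechet_derivative f (at x) i)"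
      by (simp add: L.sum L.scaleR)
    also have "\<dots> = grad f x \<bullet> u"
      by (simp add: grad_def inner_sum_left inner_commute[of u] mult.commute)
    finally show ?thesis by simp
  qed
  then show ?thesis
    using assms by (simp add: frechet_derivative_works)
qed

lemma grad_eq:
  fixes f :: "'a::euclidean_space \<Rightarrow> real"
  assumes "(f has_derivative (\<lambda>u. a \<bullet> u)) (at x)"
  shows "grad f x = a"
  using frechet_derivative_at[OF assms, symmetric]
  by (simp add: grad_def euclidean_representation)

lemma grad_inner_Basis:
  "i \<in> Basis \<Longrightarrow> grad f x \<bullet> i = frechet_derivative f (at x) i"
  by (simp add: grad_def inner_sum_left inner_Basis if_distrib cong: if_cong)

text \<open>Naming the gradient as an explicit field \<open>G\<close> gives the form in which
  closure properties of \<open>Ck\<close> can be proved by induction on \<open>k\<close> with the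
  function generalized.\<close>

lemma Ck_SucI:
  assumes "\<And>x. (f has_derivative (\<lambda>u. G x \<bullet> u)) (at x)"
    and "\<And>i. i \<in> Basis \<Longrightarrow> Ck k (\<lambda>x. G x \<bullet> i)"
  shows "Ck (Suc k) f"
  using assms frechet_derivative_at[OF assms(1), symmetric]
  by (auto simp: differentiable_def)

lemma Ck_Suc_iff:
  "Ck (Suc k) f \<longleftrightarrow> (\<forall>x. f differentiable (at x)) \<and> (\<forall>i\<in>Basis. Ck k (\<lambda>x. grad f x \<bullet> i))"
  by (simp add: grad_inner_Basis)

lemma Ck_continuous: "Ck k f \<Longrightarrow> continuous_on UNIV f"
  by (cases k) (auto intro: continuous_at_imp_continuous_on differentiable_imp_continuous_within)

lemma Ck_SucD: "Ck (Suc k) f \<Longrightarrow> Ck k f"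
proof (induction k arbitrary: f)
  case 0
  then show ?case using Ck_continuous[of "Suc 0" f] by simp
next
  case (Suc k)
  then show ?case by (metis Ck.simps(2))
qed

lemma Ck_const: "Ck k (\<lambda>x. c)"
proof (induction k arbitrary: c)
  case (Suc k)
  have "((\<lambda>x::'a. c) has_derivative (\<lambda>u. 0 \<bullet> u)) (at x)" for x
    by simp
  then show ?case by (rule Ck_SucI) (simp add: Suc)
qed simp

lemma Ck_inner: "Ck k (\<lambda>x. x \<bullet> a)"
proof (cases k)
  case (Suc j)
  have "((\<lambda>x. x \<bullet> a) has_derivative (\<lambda>u. a \<bullet> u)) (at x)" for x
    by (auto intro!: derivative_eq_intros simp: inner_commute)
  then show ?thesis unfolding Suc by (rule Ck_SucI) (simp add: Ck_const)
qed (auto intro!: continuous_intros)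

lemma Ck_add: "Ck k f \<Longrightarrow> Ck k g \<Longrightarrow> Ck k (\<lambda>x. f x + g x)"
proof (induction k arbitrary: f g)
  case (Suc k)
  have "((\<lambda>x. f x + g x) has_derivative (\<lambda>u. (grad f x + grad g x) \<bullet> u)) (at x)" for x
    using has_derivative_add[OF has_derivative_grad[of f x] has_derivative_grad[of g x]] Suc.prems
    by (simp add: inner_add_left)
  then show ?case
    by (rule Ck_SucI) (use Suc in \<open>auto simp: inner_add_left Ck_Suc_iff simp del: Ck.simps\<close>)
qed (auto intro!: continuous_intros)

lemma Ck_mult: "Ck k f \<Longrightarrow> Ck k g \<Longrightarrow> Ck k (\<lambda>x. f x * g x)"
proof (induction k arbitrary: f g)
  case (Suc k)
  have "((\<lambda>x. f x * g x) has_derivative (\<lambda>u. (f x *\<^sub>R grad g x + g x *\<^sub>R grad f x) \<bullet> u)) (at x)" for x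
    using has_derivative_mult[OF has_derivative_grad[of f x] has_derivative_grad[of g x]] Suc.prems
    by (simp add: inner_add_left algebra_simps)
  moreover have "Ck k f" "Ck k g" "\<And>i. i \<in> Basis \<Longrightarrow> Ck k (\<lambda>x. grad f x \<bullet> i)"
      "\<And>i. i \<in> Basis \<Longrightarrow> Ck k (\<lambda>x. grad g x \<bullet> i)"
    using Suc.prems Ck_SucD[of k] by (auto simp: Ck_Suc_iff simp del: Ck.simps)
  ultimately show ?case
    by (intro Ck_SucI[of _ "\<lambda>x. f x *\<^sub>R grad g x + g x *\<^sub>R grad f x"])
      (auto simp: inner_add_left intro!: Ck_add Suc.IH)
qed (auto intro!: continuous_intros)

lemma supp_subset: "closed K \<Longrightarrow> (\<And>x. x \<notin> K \<Longrightarrow> f x = 0) \<Longrightarrow> supp f \<subseteq> K"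
  unfolding supp_def by (rule closure_minimal) auto

lemma compact_supp:
  fixes f :: "'a::heine_borel \<Rightarrow> real"
  assumes "compact K" and "\<And>x. x \<notin> K \<Longrightarrow> f x = 0"
  shows "compact (supp f)"
proof -
  have "compact (K \<inter> supp f)"
    using assms(1) by (rule compact_Int_closed) (simp add: supp_def)
  moreover have "supp f \<subseteq> K"
    using assms by (intro supp_subset compact_imp_closed)
  ultimately show ?thesis by (simp add: Int_absorb1)
qed

lemma not_supp: "x \<notin> supp f \<Longrightarrow> f x = 0"
  using closure_subset[of "{x. f x \<noteq> 0}"] by (auto simp: supp_def)

lemma Ck_1_iff: "Ck 1 f \<longleftrightarrow> (\<forall>x. f differentiable (at x)) \<and> continuous_on UNIV (grad f)"
  for f :: "'a::euclidean_space \<Rightarrow> real"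
proof -
  have "continuous_on UNIV (grad f) \<longleftrightarrow> (\<forall>i\<in>Basis. continuous_on UNIV (\<lambda>x. grad f x \<bullet> i))"
    using continuous_on_componentwise by blast
  then show ?thesis by (simp add: grad_inner_Basis)
qed

lemma C1cI:
  fixes f :: "'a::euclidean_space \<Rightarrow> real"
  assumes "\<And>x. (f has_derivative (\<lambda>u. G x \<bullet> u)) (at x)" "continuous_on UNIV G"
    and "compact K" "\<And>x. x \<notin> K \<Longrightarrow> f x = 0"
  shows "f \<in> C1c"
proof -
  have "grad f = G" using grad_eq[OF assms(1)] by auto
  then have "Ck 1 f"
    unfolding Ck_1_iff using assms by (auto simp: differentiable_def)
  then show ?thesis using assms compact_supp by (auto simp: C1c_def simp del: One_nat_def)
qed

lemma
  fixes f :: "'a::euclidean_space \<Rightarrow> real"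
  assumes "f \<in> C1c"
  shows C1c_has_derivative: "(f has_derivative (\<lambda>u. grad f x \<bullet> u)) (at x)"
    and C1c_continuous_grad: "continuous_on UNIV (grad f)"
    and C1c_continuous: "continuous_on UNIV f"
    and C1c_compact: "compact (supp f)"
    and C1c_grad_not_supp: "x \<notin> supp f \<Longrightarrow> grad f x = 0"
proof -
  have C: "Ck 1 f" "compact (supp f)"
    using assms unfolding C1c_def by blast+
  then show "(f has_derivative (\<lambda>u. grad f x \<bullet> u)) (at x)"
    unfolding Ck_1_iff by (intro has_derivative_grad) blast
  show "continuous_on UNIV (grad f)"
    using C unfolding Ck_1_iff by blast
  show "continuous_on UNIV f"
    using C(1) by (rule Ck_continuous)
  show "compact (supp f)"
    by (fact C(2))
  assume x: "x \<notin> supp f"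
  have "open (- supp f)" by (simp add: supp_def open_Compl)
  moreover have "((\<lambda>x. 0) has_derivative (\<lambda>u. 0 \<bullet> u)) (at x)" by simp
  ultimately have "(f has_derivative (\<lambda>u. 0 \<bullet> u)) (at x)"
    using has_derivative_transform_within_open[of "\<lambda>x. 0" _ x UNIV "- supp f" f] x by (simp add: not_supp)
  then show "grad f x = 0" by (rule grad_eq)
qed

lemma C1c_add_scale: "f \<in> C1c \<Longrightarrow> g \<in> C1c \<Longrightarrow> (\<lambda>x. a * f x + b * g x) \<in> C1c"
  and grad_add_scale: "f \<in> C1c \<Longrightarrow> g \<in> C1c \<Longrightarrow>
    grad (\<lambda>x. a * f x + b * g x) x = a *\<^sub>R grad f x + b *\<^sub>R grad g x"
  for f g :: "'a::euclidean_space \<Rightarrow> real"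
proof -
  assume f: "f \<in> C1c" and g: "g \<in> C1c"
  have D: "((\<lambda>x. a * f x + b * g x) has_derivative (\<lambda>u. (a *\<^sub>R grad f x + b *\<^sub>R grad g x) \<bullet> u)) (at x)" for x
    by (auto intro!: derivative_eq_intros C1c_has_derivative f g simp: inner_add_left)
  then show "grad (\<lambda>x. a * f x + b * g x) x = a *\<^sub>R grad f x + b *\<^sub>R grad g x"
    by (rule grad_eq)
  show "(\<lambda>x. a * f x + b * g x) \<in> C1c"
    by (rule C1cI[OF D, where K = "supp f \<union> supp g"])
      (use f g in \<open>auto intro!: continuous_intros C1c_continuous_grad C1c_compact compact_Un simp: not_supp\<close>)
qed

lemma C1c_mult: "f \<in> C1c \<Longrightarrow> (\<And>x. (h has_derivative (\<lambda>u. H x \<bullet> u)) (at x)) \<Longrightarrow>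
    continuous_on UNIV H \<Longrightarrow> (\<lambda>x. f x * h x) \<in> C1c"
  and grad_mult: "f \<in> C1c \<Longrightarrow> (\<And>x. (h has_derivative (\<lambda>u. H x \<bullet> u)) (at x)) \<Longrightarrow>
    grad (\<lambda>x. f x * h x) x = h x *\<^sub>R grad f x + f x *\<^sub>R H x"
  for f h :: "'a::euclidean_space \<Rightarrow> real"
proof -
  assume f: "f \<in> C1c" and h: "\<And>x. (h has_derivative (\<lambda>u. H x \<bullet> u)) (at x)"
  have D: "((\<lambda>x. f x * h x) has_derivative (\<lambda>u. (h x *\<^sub>R grad f x + f x *\<^sub>R H x) \<bullet> u)) (at x)" for x
    using has_derivative_mult[OF C1c_has_derivative[OF f, of x] h[of x]]
    by (simp add: inner_add_left algebra_simps)
  then show "grad (\<lambda>x. f x * h x) x = h x *\<^sub>R grad f x + f x *\<^sub>R H x"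
    by (rule grad_eq)
  have "continuous_on UNIV h"
    using h has_derivative_continuous continuous_at_imp_continuous_on by blast
  moreover assume "continuous_on UNIV H"
  ultimately show "(\<lambda>x. f x * h x) \<in> C1c"
    by (intro C1cI[OF D, where K = "supp f"])
      (use f in \<open>auto intro!: continuous_intros C1c_continuous_grad C1c_continuous C1c_compact simp: not_supp\<close>)
qed

section \<open>Mollification\<close>

text \<open>The classical flat function \<open>exp (- 1 / t)\<close>, together with its products
  with powers of \<open>1 / t\<close>. Up to linear combinations the family is closed under
  differentiation, which is what the index \<open>k\<close> is for.\<close>

definition exp_inv :: "nat \<Rightarrow> real \<Rightarrow> real" where
  "exp_inv k t = (if 0 < t then exp (- inverse t) * inverse t ^ k else 0)"

text \<open>With \<open>u = inverse t\<close> this is the limit of \<open>u ^ k / exp u\<close> as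
  \<open>u\<close> tends to infinity.\<close>

lemma exp_inv_tendsto_0: "(exp_inv k \<longlongrightarrow> 0) (at_right 0)"
proof -
  have "((\<lambda>t::real. inverse t ^ k / exp (inverse t)) \<longlongrightarrow> 0) (at_right 0)"
    by (rule filterlim_compose[OF tendsto_power_div_exp_0 filterlim_inverse_at_top_right])
  then show ?thesis
    by (rule Lim_transform_eventually)
      (rule eventually_mono[OF eventually_at_right_less], simp add: exp_inv_def exp_minus divide_inverse)
qed

lemma exp_inv_has_field_derivative:
  "(exp_inv k has_field_derivative - real k * exp_inv (Suc k) t + exp_inv (k + 2) t) (at t)"
proof -
  consider "t > 0" | "t < 0" | "t = 0" by linarith
  then show ?thesis
  proof cases
    case 1
    have "((\<lambda>t. exp (- inverse t) * inverse t ^ k) has_field_derivative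
        - real k * exp_inv (Suc k) t + exp_inv (k + 2) t) (at t)"
      using 1 power_minus_mult[of "k - 1" "inverse t"]
      by (cases k; cases "k - 1 = 0")
        (auto intro!: derivative_eq_intros simp: exp_inv_def algebra_simps power2_eq_square)
    then show ?thesis
      by (rule has_field_derivative_transform_within_open[where S = "{0<..}"])
        (use 1 in \<open>auto simp: exp_inv_def\<close>)
  next
    case 2
    have "((\<lambda>t. 0) has_field_derivative - real k * exp_inv (Suc k) t + exp_inv (k + 2) t) (at t)"
      using 2 by (auto simp: exp_inv_def)
    then show ?thesis
      by (rule has_field_derivative_transform_within_open[where S = "{..<0}"])
        (use 2 in \<open>auto simp: exp_inv_def\<close>)
  next
    case 3
    \<comment> \<open>For \<open>h > 0\<close> the difference quotient at \<open>0\<close> is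
      \<open>exp_inv (Suc k) h\<close>, so the limit of the family at \<open>0\<close> also gives
      the derivative there.\<close>
    have "((\<lambda>h. exp_inv k h / h) \<longlongrightarrow> 0) (at_right 0)"
      by (rule Lim_transform_eventually[OF exp_inv_tendsto_0[of "Suc k"]])
        (rule eventually_mono[OF eventually_at_right_less], simp add: exp_inv_def divide_inverse)
    moreover have "((\<lambda>h. exp_inv k h / h) \<longlongrightarrow> 0) (at_left 0)"
      by (rule Lim_transform_eventually[OF tendsto_const])
        (simp add: eventually_at_filter exp_inv_def)
    ultimately show ?thesis
      using 3 by (simp add: DERIV_def exp_inv_def filterlim_split_at)
  qed
qed

text \<open>The gradient is \<open>x\<close> times a combination of the same functions with larger
  index; hence the induction on \<open>j\<close> leaves \<open>k\<close> arbitrary.\<close>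

lemma Ck_exp_inv: "Ck j (\<lambda>x::'a::euclidean_space. exp_inv k (a - x \<bullet> x))"
proof (induction j arbitrary: k)
  case 0
  have "isCont (exp_inv k) t" for t
    using exp_inv_has_field_derivative DERIV_isCont by blast
  then have "continuous_on UNIV (exp_inv k)"
    by (simp add: continuous_at_imp_continuous_on)
  then show ?case
    by (auto intro!: continuous_on_compose2[of UNIV "exp_inv k"] continuous_intros)
next
  case (Suc j)
  define E where "E x = - real k * exp_inv (Suc k) (a - x \<bullet> x) + exp_inv (k + 2) (a - x \<bullet> x)" for x :: 'a
  have D: "((\<lambda>x::'a. exp_inv k (a - x \<bullet> x)) has_derivative (\<lambda>u. ((- 2 * E x) *\<^sub>R x) \<bullet> u)) (at x)" for x
  proof -
    have "((\<lambda>x::'a. a - x \<bullet> x) has_derivative (\<lambda>u. - 2 * (x \<bullet> u))) (at x)"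
      by (auto intro!: derivative_eq_intros simp: inner_commute)
    from has_derivative_compose[OF this has_field_derivative_imp_has_derivative[OF exp_inv_has_field_derivative]]
    show ?thesis by (rule has_derivative_eq_rhs) (simp add: E_def algebra_simps)
  qed
  have "Ck j E"
    unfolding E_def by (intro Ck_add Ck_mult Ck_const Suc.IH)
  then have "Ck j (\<lambda>x. (- 2 * E x) * (x \<bullet> i))" for i
    by (intro Ck_mult Ck_const Ck_inner)
  then show ?case by (intro Ck_SucI[OF D]) simp
qed

section \<open>Continuous functions with compact support\<close>

lemma
  fixes f :: "'a::euclidean_space \<Rightarrow> 'b::euclidean_space"
  assumes f: "continuous_on UNIV f" and K: "compact K" "\<And>x. x \<notin> K \<Longrightarrow> f x = 0"
  shows bounded_compact_support: "\<exists>B. 0 \<le> B \<and> (\<forall>x. norm (f x) \<le> B)"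
    and uniformly_continuous_compact_support: "uniformly_continuous_on UNIV f"
    and integrable_compact_support: "integrable lborel f"
proof -
  have cf: "continuous_on K f" using f by (rule continuous_on_subset) simp
  have "bounded (f ` K)"
    by (intro compact_imp_bounded compact_continuous_image cf K)
  then obtain B where "\<And>x. x \<in> K \<Longrightarrow> norm (f x) \<le> B"
    by (auto simp: bounded_iff)
  then have "norm (f x) \<le> max 0 B" for x
    using K(2)[of x] by (cases "x \<in> K") (auto simp: le_max_iff_disj)
  then show "\<exists>B. 0 \<le> B \<and> (\<forall>x. norm (f x) \<le> B)"
    by (meson max.cobounded1)
  obtain R where R: "\<And>x. x \<in> K \<Longrightarrow> norm x \<le> R"
    using compact_imp_bounded[OF K(1)] by (auto simp: bounded_iff)
  \<comment> \<open>The margin \<open>1\<close> handles pairs of points at distance below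
    \<open>1\<close>: either both lie in the larger ball, or neither lies in \<open>K\<close> and
    both values are zero.\<close>
  have "uniformly_continuous_on (cball 0 (R + 1)) f"
    using f by (intro compact_uniformly_continuous continuous_on_subset[OF f]) auto
  then have U: "\<exists>d>0. \<forall>x\<in>cball 0 (R + 1). \<forall>y\<in>cball 0 (R + 1). dist y x < d \<longrightarrow> dist (f y) (f x) < e"
    if "0 < e" for e
    using that unfolding uniformly_continuous_on_def by blast
  show "uniformly_continuous_on UNIV f"
    unfolding uniformly_continuous_on_def
  proof (intro allI impI)
    fix e :: real assume e: "0 < e"
    obtain d where d: "d > 0" "\<And>x y. x\<in>cball 0 (R + 1) \<Longrightarrow> y\<in>cball 0 (R + 1) \<Longrightarrow> dist y x < d \<Longrightarrow> dist (f y) (f x) < e"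
      using U[OF e] by blast
    have "dist (f y) (f x) < e" if xy: "dist y x < min d 1" for x y
    proof (cases "x \<in> K \<or> y \<in> K")
      case True
      then have "norm x \<le> R + 1" "norm y \<le> R + 1"
        using R[of x] R[of y] xy norm_triangle_ineq3[of x y] by (auto simp: dist_norm norm_minus_commute)
      then show ?thesis using d xy by auto
    qed (use e K(2) in auto)
    then show "\<exists>d>0. \<forall>x\<in>UNIV. \<forall>y\<in>UNIV. dist y x < d \<longrightarrow> dist (f y) (f x) < e"
      using d(1) by (intro exI[of _ "min d 1"]) auto
  qed
  have "(\<lambda>x. indicator K x *\<^sub>R f x) = f"
    using K(2) by (auto simp: indicator_def)
  then show "integrable lborel f"
    using borel_integrable_compact[OF K(1) cf] by simp
qed

section \<open>Convolution with an integrable function\<close>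

definition conv :: "('a::euclidean_space \<Rightarrow> real) \<Rightarrow> ('a \<Rightarrow> real) \<Rightarrow> 'a \<Rightarrow> real" where
  "conv f h x = (LINT z|lborel. f (x - z) * h z)"

lemma lborel_integral_reflect:
  fixes F :: "'a::euclidean_space \<Rightarrow> real"
  assumes [measurable]: "F \<in> borel_measurable borel"
  shows "(LINT z|lborel. F (x - z)) = (LINT z|lborel. F z)"
proof -
  have "lborel = distr lborel borel (\<lambda>z. x + (- 1) *\<^sub>R z)"
    using lborel_affine[of "-1" x] by (simp add: density_1)
  then have "(LINT z|lborel. F z) = (LINT z|distr lborel borel (\<lambda>z. x + (- 1) *\<^sub>R z). F z)"
    by simp
  also have "\<dots> = (LINT z|lborel. F (x + (- 1) *\<^sub>R z))"
    by (rule integral_distr) auto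
  finally show ?thesis by simp
qed

lemma conv_commute:
  assumes [measurable]: "f \<in> borel_measurable borel" "h \<in> borel_measurable borel"
  shows "conv f h x = conv h f x"
  using lborel_integral_reflect[of "\<lambda>z. h (x - z) * f z" x] by (simp add: conv_def mult.commute)

lemma conv_integrable:
  fixes f :: "'a::euclidean_space \<Rightarrow> real"
  assumes "continuous_on UNIV f" "compact (supp f)" and h: "integrable lborel h"
  shows "integrable lborel (\<lambda>z. f (x - z) * h z)"
proof -
  obtain B where B: "0 \<le> B" "\<And>x. norm (f x) \<le> B"
    using bounded_compact_support[OF assms(1,2)] not_supp by blast
  have [measurable]: "f \<in> borel_measurable borel" "h \<in> borel_measurable borel"
    using assms borel_measurable_continuous_onI by auto
  show ?thesis
  proof (rule Bochner_Integration.integrable_bound)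
    show "integrable lborel (\<lambda>z. B * h z)" using h by simp
    show "AE z in lborel. norm (f (x - z) * h z) \<le> norm (B * h z)"
      using B by (auto simp: abs_mult intro!: mult_mono)
  qed simp
qed

text \<open>The gradient is uniformly continuous, so the mean value inequality on the segment from
  \<open>x\<close> to \<open>y\<close> gives a linearization error that does not depend on the base
  point. This is what differentiation under the integral sign needs.\<close>

lemma C1c_uniform_derivative:
  fixes f :: "'a::euclidean_space \<Rightarrow> real"
  assumes f: "f \<in> C1c" and e: "0 < e"
  shows "\<exists>d>0. \<forall>x y. norm (y - x) < d \<longrightarrow> \<bar>f y - f x - grad f x \<bullet> (y - x)\<bar> \<le> e * norm (y - x)"
proof -
  have "uniformly_continuous_on UNIV (grad f)"
    by (rule uniformly_continuous_compact_support[OF C1c_continuous_grad[OF f] C1c_compact[OF f]])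
      (simp add: C1c_grad_not_supp f)
  then obtain d where d: "d > 0" "\<And>x y. dist y x < d \<Longrightarrow> dist (grad f y) (grad f x) < e"
    unfolding uniformly_continuous_on_def using e by blast
  have "\<bar>f y - f x - grad f x \<bullet> (y - x)\<bar> \<le> e * norm (y - x)" if xy: "norm (y - x) < d" for x y
  proof -
    have "norm (f y - f x - grad f x \<bullet> (y - x)) \<le> norm (y - x) * e"
    proof (rule differentiable_bound_linearization[where S = "ball x d" and f' = "\<lambda>x u. grad f x \<bullet> u"])
      show "x + t *\<^sub>R (y - x) \<in> ball x d" if "t \<in> {0..1}" for t
      proof -
        have "norm (t *\<^sub>R (y - x)) \<le> 1 * norm (y - x)"
          unfolding norm_scaleR using that by (intro mult_right_mono) auto
        then show ?thesis using xy by (simp add: dist_norm)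
      qed
      show "(f has_derivative (\<lambda>u. grad f z \<bullet> u)) (at z within ball x d)" for z
        by (rule has_derivative_at_withinI) (rule C1c_has_derivative[OF f])
      show "onorm ((\<lambda>u. grad f z \<bullet> u) - (\<lambda>u. grad f x \<bullet> u)) \<le> e" if "z \<in> ball x d" for z
      proof (rule onorm_le)
        fix u
        have "\<bar>(grad f z - grad f x) \<bullet> u\<bar> \<le> norm (grad f z - grad f x) * norm u"
          by (rule Cauchy_Schwarz_ineq2)
        also have "\<dots> \<le> e * norm u"
          using less_imp_le[OF d(2)[of z x]] that
          by (intro mult_right_mono norm_ge_zero) (simp add: dist_commute flip: dist_norm)
        finally show "norm (((\<lambda>u. grad f z \<bullet> u) - (\<lambda>u. grad f x \<bullet> u)) u) \<le> e * norm u"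
          by (simp add: inner_diff_left)
      qed
    qed (use d(1) in simp)
    then show ?thesis by (simp add: mult.commute)
  qed
  then show ?thesis using d(1) by blast
qed

text \<open>The linearization error of \<open>f\<close> at \<open>x - z\<close> is small uniformly
  in \<open>z\<close>, so it may be integrated against \<open>\<bar>h\<bar>\<close>; only
  integrability of \<open>h\<close> enters, and no regularity.\<close>

lemma conv_has_derivative:
  fixes f :: "'a::euclidean_space \<Rightarrow> real"
  assumes f: "f \<in> C1c" and h: "integrable lborel h"
  shows "(conv f h has_derivative (\<lambda>u. (\<Sum>i\<in>Basis. conv (\<lambda>x. grad f x \<bullet> i) h x *\<^sub>R i) \<bullet> u)) (at x)"
proof -
  let ?G = "\<Sum>i\<in>Basis. conv (\<lambda>x. grad f x \<bullet> i) h x *\<^sub>R i"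
  have If: "integrable lborel (\<lambda>z. f (y - z) * h z)" for y
    by (intro conv_integrable C1c_continuous C1c_compact f h)
  have "compact (supp (\<lambda>x. grad f x \<bullet> i))" for i
    by (rule compact_supp[OF C1c_compact[OF f]]) (simp add: C1c_grad_not_supp f)
  then have Ig: "integrable lborel (\<lambda>z. (grad f (x - z) \<bullet> i) * h z)" for i
    by (intro conv_integrable[of "\<lambda>x. grad f x \<bullet> i"] h) (auto intro!: continuous_intros C1c_continuous_grad f)
  define H where "H = (LINT z|lborel. \<bar>h z\<bar>)"
  have H: "0 \<le> H" by (simp add: H_def)
  have "\<exists>d>0. \<forall>y. norm (y - x) < d \<longrightarrow> norm (conv f h y - conv f h x - ?G \<bullet> (y - x)) \<le> e * norm (y - x)"
    if e: "0 < e" for e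
  proof -
    \<comment> \<open>Integration against \<open>\<bar>h\<bar>\<close> multiplies the error by its
      \<open>L^1\<close> norm \<open>H\<close>; the added \<open>1\<close> covers
      \<open>H = 0\<close>.\<close>
    have "0 < e / (H + 1)" using e H by simp
    from C1c_uniform_derivative[OF f this] obtain d where d: "d > 0"
      "\<And>x y. norm (y - x) < d \<Longrightarrow> \<bar>f y - f x - grad f x \<bullet> (y - x)\<bar> \<le> e / (H + 1) * norm (y - x)"
      by blast
    have "norm (conv f h y - conv f h x - ?G \<bullet> (y - x)) \<le> e * norm (y - x)"
      if xy: "norm (y - x) < d" for y
    proof -
      have eq: "(grad f (x - z) \<bullet> (y - x)) * h z = (\<Sum>i\<in>Basis. (i \<bullet> (y - x)) * ((grad f (x - z) \<bullet> i) * h z))" for z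
        by (subst euclidean_inner, subst inner_commute[of "y - x"]) (simp add: sum_distrib_left mult_ac)
      have I: "integrable lborel (\<lambda>z. (i \<bullet> (y - x)) * ((grad f (x - z) \<bullet> i) * h z))" for i
        using Ig by (rule integrable_mult_right)
      have IG: "integrable lborel (\<lambda>z. (grad f (x - z) \<bullet> (y - x)) * h z)"
        unfolding eq by (intro Bochner_Integration.integrable_sum I)
      have "?G \<bullet> (y - x) = (\<Sum>i\<in>Basis. conv (\<lambda>x. grad f x \<bullet> i) h x * (i \<bullet> (y - x)))"
        by (simp add: inner_sum_left)
      also have "\<dots> = (\<Sum>i\<in>Basis. (LINT z|lborel. (i \<bullet> (y - x)) * ((grad f (x - z) \<bullet> i) * h z)))"
        by (intro sum.cong refl) (simp add: conv_def)
      also have "\<dots> = (LINT z|lborel. (grad f (x - z) \<bullet> (y - x)) * h z)"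
        unfolding eq by (rule Bochner_Integration.integral_sum[symmetric]) (rule I)
      finally have G: "?G \<bullet> (y - x) = (LINT z|lborel. (grad f (x - z) \<bullet> (y - x)) * h z)" .
      have "conv f h y - conv f h x - ?G \<bullet> (y - x) =
          (LINT z|lborel. (f (y - z) - f (x - z) - grad f (x - z) \<bullet> (y - x)) * h z)"
        unfolding conv_def[of f] G left_diff_distrib
        by (simp add: If IG Bochner_Integration.integral_diff Bochner_Integration.integrable_diff)
      also have "norm \<dots> \<le> (LINT z|lborel. (e / (H + 1) * norm (y - x)) * \<bar>h z\<bar>)"
      proof (rule Bochner_Integration.integral_norm_bound_integral)
        show "integrable lborel (\<lambda>z. (f (y - z) - f (x - z) - grad f (x - z) \<bullet> (y - x)) * h z)"
          unfolding left_diff_distrib by (intro Bochner_Integration.integrable_diff If IG)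
        show "integrable lborel (\<lambda>z. (e / (H + 1) * norm (y - x)) * \<bar>h z\<bar>)"
          using h by simp
        show "norm ((f (y - z) - f (x - z) - grad f (x - z) \<bullet> (y - x)) * h z)
            \<le> (e / (H + 1) * norm (y - x)) * \<bar>h z\<bar>" for z
          using d(2)[of "y - z" "x - z"] xy unfolding real_norm_def abs_mult
          by (intro mult_right_mono) auto
      qed
      also have "\<dots> = e * norm (y - x) * (H / (H + 1))"
        by (simp add: H_def)
      also have "\<dots> \<le> e * norm (y - x) * 1"
        using H e by (intro mult_left_mono) auto
      finally show ?thesis by simp
    qed
    then show ?thesis using d(1) by blast
  qed
  then show ?thesis
    unfolding has_derivative_at_alt by (auto intro: bounded_linear_inner_right)
qed

lemma grad_conv:
  fixes f :: "'a::euclidean_space \<Rightarrow> real"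
  assumes "f \<in> C1c" "integrable lborel h" "i \<in> Basis"
  shows "grad (conv f h) x \<bullet> i = conv (\<lambda>x. grad f x \<bullet> i) h x"
  using grad_eq[OF conv_has_derivative[OF assms(1,2)]] assms(3)
  by (simp add: inner_sum_left inner_Basis if_distrib cong: if_cong)

text \<open>Each partial derivative of the convolution is the convolution of a partial derivative of
  \<open>f\<close>, which again is smooth with compact support; hence the induction generalizes
  \<open>f\<close>.\<close>

lemma Ck_conv:
  fixes f :: "'a::euclidean_space \<Rightarrow> real"
  assumes "\<And>j. Ck j f" "compact (supp f)" and h: "integrable lborel h"
  shows "Ck k (conv f h)"
  using assms(1,2)
proof (induction k arbitrary: f)
  case 0
  then have "f \<in> C1c" by (simp add: C1c_def del: One_nat_def)
  from conv_has_derivative[OF this h] show ?case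
    by (auto intro!: continuous_at_imp_continuous_on dest: has_derivative_continuous)
next
  case (Suc k)
  then have f: "f \<in> C1c" by (simp add: C1c_def del: One_nat_def)
  show ?case
  proof (rule Ck_SucI[OF conv_has_derivative[OF f h]])
    fix i :: 'a assume i: "i \<in> Basis"
    have "Ck k (conv (\<lambda>x. grad f x \<bullet> i) h)"
    proof (rule Suc.IH)
      show "Ck j (\<lambda>x. grad f x \<bullet> i)" for j
        using Suc.prems(1)[of "Suc j"] i unfolding Ck_Suc_iff by blast
      show "compact (supp (\<lambda>x. grad f x \<bullet> i))"
        by (rule compact_supp[OF C1c_compact[OF f]]) (simp add: C1c_grad_not_supp f)
    qed
    moreover have "(\<lambda>x. (\<Sum>i\<in>Basis. conv (\<lambda>x. grad f x \<bullet> i) h x *\<^sub>R i) \<bullet> i) = conv (\<lambda>x. grad f x \<bullet> i) h"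
      using i by (simp add: inner_sum_left inner_Basis if_distrib fun_eq_iff cong: if_cong)
    ultimately show "Ck k (\<lambda>x. (\<Sum>i\<in>Basis. conv (\<lambda>x. grad f x \<bullet> i) h x *\<^sub>R i) \<bullet> i)"
      by simp
  qed
qed

section \<open>Compactly supported mollifiers\<close>

definition bump :: "real \<Rightarrow> 'a::euclidean_space \<Rightarrow> real" where
  "bump r x = exp_inv 0 (r\<^sup>2 - x \<bullet> x)"

definition mollifier :: "real \<Rightarrow> 'a::euclidean_space \<Rightarrow> real" where
  "mollifier r x = bump r x / (LINT z|lborel. bump r (z::'a))"

lemma bump_nonneg: "0 \<le> bump r x"
  by (simp add: bump_def exp_inv_def)

lemma bump_pos_iff:
  assumes "0 < r"
  shows "0 < bump r x \<longleftrightarrow> norm x < r"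
proof -
  have "(norm x)\<^sup>2 < r\<^sup>2 \<longleftrightarrow> norm x < r"
    using assms power_strict_mono[of "norm x" r 2] power2_less_imp_less[of "norm x" r] by auto
  then show ?thesis by (simp add: bump_def exp_inv_def flip: power2_norm_eq_inner)
qed

lemma bump_eq_0: "0 < r \<Longrightarrow> r \<le> norm x \<Longrightarrow> bump r x = 0"
  using bump_pos_iff[of r x] bump_nonneg[of r x] by linarith

text \<open>The squared norm is smooth at the origin, and the flatness of \<open>exp_inv 0\<close>
  at \<open>0\<close> removes any corner on the sphere of radius \<open>r\<close>.\<close>

lemma Ck_bump: "Ck k (bump r)"
  unfolding bump_def by (rule Ck_exp_inv)

lemma integrable_bump: "0 < r \<Longrightarrow> integrable lborel (bump r)"
  by (rule integrable_compact_support[OF Ck_continuous[OF Ck_bump[of 0 r]] compact_cball[of 0 r]])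
    (simp add: bump_eq_0)

text \<open>A vanishing integral would make the open ball, where the bump is positive, a null
  set.\<close>

lemma integral_bump_pos:
  assumes r: "0 < r"
  shows "0 < (LINT z|lborel. bump r (z::'a::euclidean_space))"
proof (rule ccontr)
  assume "\<not> ?thesis"
  then have "(LINT z|lborel. bump r (z::'a)) = 0"
    using Bochner_Integration.integral_nonneg[of lborel "bump r :: 'a \<Rightarrow> real"] bump_nonneg by (smt (verit))
  then have "AE z::'a in lborel. bump r z = 0"
    using integral_nonneg_eq_0_iff_AE[OF integrable_bump[OF r]] bump_nonneg by auto
  then have "AE z::'a in lborel. z \<notin> ball 0 r"
    by eventually_elim (use bump_pos_iff[OF r] in force)
  then have "ball (0::'a) r \<in> null_sets lborel"
    by (subst AE_iff_null_sets) auto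
  then have "negligible (ball (0::'a) r)"
    by (simp add: negligible_iff_null_sets null_sets_completionI)
  then show False using r open_not_negligible[of "ball (0::'a) r"] by simp
qed

lemma
  assumes r: "0 < r"
  shows mollifier_nonneg: "0 \<le> mollifier r x"
    and mollifier_eq_0: "r \<le> norm x \<Longrightarrow> mollifier r x = 0"
    and Ck_mollifier: "Ck k (mollifier r)"
    and integrable_mollifier: "integrable lborel (mollifier r :: 'a::euclidean_space \<Rightarrow> real)"
    and integral_mollifier: "(LINT z|lborel. mollifier r (z::'a)) = 1"
    and compact_supp_mollifier: "compact (supp (mollifier r :: 'a \<Rightarrow> real))"
proof -
  show "0 \<le> mollifier r x" "r \<le> norm x \<Longrightarrow> mollifier r x = 0"
    using integral_bump_pos[OF r, where 'a='a] by (auto simp: mollifier_def bump_nonneg bump_eq_0 r)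
  show "Ck k (mollifier r)"
    unfolding mollifier_def divide_inverse by (intro Ck_mult Ck_bump Ck_const)
  show "integrable lborel (mollifier r :: 'a \<Rightarrow> real)"
    unfolding mollifier_def[abs_def] by (intro integrable_divide_zero integrable_bump r)
  show "(LINT z|lborel. mollifier r (z::'a)) = 1"
    unfolding mollifier_def using integral_bump_pos[OF r, where 'a='a] by simp
  show "compact (supp (mollifier r :: 'a \<Rightarrow> real))"
    by (rule compact_supp[OF compact_cball[of 0 r]]) (simp add: mollifier_def bump_eq_0 r)
qed


lemma mollify_approx:
  fixes f :: "'a::euclidean_space \<Rightarrow> real"
  assumes f: "continuous_on UNIV f" "compact (supp f)" and e: "0 < e"
  shows "\<exists>d>0. \<forall>r x. 0 < r \<longrightarrow> r < d \<longrightarrow> \<bar>conv f (mollifier r) x - f x\<bar> \<le> e"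
proof -
  have "uniformly_continuous_on UNIV f"
    by (rule uniformly_continuous_compact_support[OF f]) (rule not_supp)
  then obtain d where d: "d > 0" "\<And>x y. dist y x < d \<Longrightarrow> dist (f y) (f x) < e"
    unfolding uniformly_continuous_on_def using e by blast
  have "\<bar>conv f (mollifier r) x - f x\<bar> \<le> e" if r: "0 < r" "r < d" for r x
  proof -
    have I: "integrable lborel (\<lambda>z. f (x - z) * mollifier r z)"
      by (rule conv_integrable[OF f integrable_mollifier[OF r(1)]])
    have J: "integrable lborel (\<lambda>z::'a. c * mollifier r z)" for c
      using integrable_mollifier[OF r(1)] by (rule integrable_mult_right)
    \<comment> \<open>As the mollifier has mass one, the difference becomes a weighted mean of
      \<open>f (x - z) - f x\<close> over \<open>norm z < r\<close>, which uniform continuity makes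
      small.\<close>
    have "f x = (LINT z|lborel. f x * mollifier r (z::'a))"
      by (simp add: integral_mollifier r(1))
    then have "conv f (mollifier r) x - f x =
        (LINT z|lborel. f (x - z) * mollifier r z) - (LINT z|lborel. f x * mollifier r (z::'a))"
      by (simp add: conv_def)
    also have "\<dots> = (LINT z|lborel. (f (x - z) - f x) * mollifier r z)"
      unfolding left_diff_distrib by (rule Bochner_Integration.integral_diff[symmetric, OF I J])
    also have "norm \<dots> \<le> (LINT z|lborel. e * mollifier r (z::'a))"
    proof (rule Bochner_Integration.integral_norm_bound_integral)
      show "integrable lborel (\<lambda>z. (f (x - z) - f x) * mollifier r z)"
        unfolding left_diff_distrib by (rule Bochner_Integration.integrable_diff[OF I J])
      show "integrable lborel (\<lambda>z::'a. e * mollifier r z)" by (rule J)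
      show "norm ((f (x - z) - f x) * mollifier r z) \<le> e * mollifier r z" for z
      proof (cases "norm z < r")
        case True
        then have "\<bar>f (x - z) - f x\<bar> \<le> e"
          using d(2)[of "x - z" x] r(2) by (simp add: dist_norm)
        then show ?thesis
          using mollifier_nonneg[OF r(1), of z] by (simp add: abs_mult mult_right_mono)
      next
        case False
        then show ?thesis using mollifier_eq_0[OF r(1), of z] by simp
      qed
    qed
    finally show ?thesis by (simp add: integral_mollifier r(1))
  qed
  then show ?thesis using d(1) by blast
qed

lemma conv_mollifier_eq_0:
  fixes f :: "'a::euclidean_space \<Rightarrow> real"
  assumes r: "0 < r" and x: "\<And>y. y \<in> supp f \<Longrightarrow> r < dist x y"
  shows "conv f (mollifier r) x = 0"
proof -
  have "f (x - z) * mollifier r z = 0" for z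
  proof (cases "x - z \<in> supp f")
    case True
    then show ?thesis using x[of "x - z"] mollifier_eq_0[OF r, of z] by (simp add: dist_norm)
  qed (simp add: not_supp)
  then have "(\<lambda>z. f (x - z) * mollifier r z) = (\<lambda>z. 0)" by blast
  then show ?thesis unfolding conv_def by (simp only:) simp
qed

text \<open>Here \<open>f\<close> is merely continuous; commuting the convolution puts all
  derivatives on the mollifier.\<close>

lemma Ck_conv_mollifier:
  fixes f :: "'a::euclidean_space \<Rightarrow> real"
  assumes f: "continuous_on UNIV f" "compact (supp f)" and r: "0 < r"
  shows "Ck k (conv f (mollifier r))"
proof -
  have I: "integrable lborel f"
    using integrable_compact_support[OF f] not_supp by blast
  have "conv f (mollifier r) = conv (mollifier r) f"
    using f(1) Ck_continuous[OF Ck_mollifier[OF r]]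
    by (intro ext conv_commute borel_measurable_continuous_onI) auto
  then show ?thesis
    using Ck_conv[OF Ck_mollifier[OF r] compact_supp_mollifier[OF r] I] by simp
qed

lemma conv_mollifier_supp:
  fixes f :: "'a::euclidean_space \<Rightarrow> real"
  assumes "compact (supp f)" "0 < r" "r \<le> R"
  shows "supp (conv f (mollifier r)) \<subseteq> {y + z |y z. y \<in> supp f \<and> z \<in> cball 0 R}" (is "_ \<subseteq> ?K")
proof (rule supp_subset)
  show "closed ?K"
    using compact_sums[OF assms(1) compact_cball[of "0::'a" R]] compact_imp_closed by simp
  fix x assume x: "x \<notin> ?K"
  show "conv f (mollifier r) x = 0"
  proof (rule conv_mollifier_eq_0[OF assms(2)], rule ccontr)
    fix y assume "y \<in> supp f" "\<not> r < dist x y"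
    then have "x = y + (x - y) \<and> y \<in> supp f \<and> x - y \<in> cball 0 R"
      using assms(3) by (simp add: dist_norm norm_minus_commute)
    then show False using x by blast
  qed
qed


text \<open>Mollification commutes with partial derivatives, so function and gradient are
  approximated at once. The point is that one compact \<open>K\<close> serves all \<open>e\<close>:
  integrability over \<open>K\<close> is then enough to pass to the limit in integrals of locally
  integrable functions.\<close>

lemma C1c_approx_test_functions:
  fixes \<phi> :: "'a::euclidean_space \<Rightarrow> real"
  assumes \<phi>: "\<phi> \<in> C1c" and D: "open D" "supp \<phi> \<subseteq> D"
  obtains K where "compact K" "K \<subseteq> D" "supp \<phi> \<subseteq> K"
    "\<And>e. 0 < e \<Longrightarrow> \<exists>\<psi>\<in>test_functions D. supp \<psi> \<subseteq> K \<and>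
      (\<forall>x. \<bar>\<psi> x - \<phi> x\<bar> \<le> e \<and> (\<forall>i\<in>Basis. \<bar>grad \<psi> x \<bullet> i - grad \<phi> x \<bullet> i\<bar> \<le> e))"
proof -
  note c = C1c_compact[OF \<phi>]
  \<comment> \<open>The compact support has a positive distance to the complement of
    \<open>D\<close>; half of it is an admissible thickening radius.\<close>
  obtain R where R: "0 < R" "{y + z |y z. y \<in> supp \<phi> \<and> z \<in> cball 0 R} \<subseteq> D"
  proof -
    have "closed (- D)" using D(1) by (rule closed_Compl)
    moreover have "supp \<phi> \<inter> - D = {}" using D(2) by blast
    ultimately have "\<exists>d>0. \<forall>x\<in>supp \<phi>. \<forall>y\<in>- D. d \<le> dist x y"
      by (rule separate_compact_closed[OF c])
    then obtain d where d: "d > 0" "\<And>x y. x \<in> supp \<phi> \<Longrightarrow> y \<in> - D \<Longrightarrow> d \<le> dist x y"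
      by blast
    have "y + z \<in> D" if "y \<in> supp \<phi>" "norm z \<le> d / 2" for y z
    proof (rule ccontr)
      assume "y + z \<notin> D"
      then have "d \<le> dist y (y + z)" using d(2)[OF that(1)] by simp
      then show False using d(1) that(2) by (simp add: dist_norm)
    qed
    then have "{y + z |y z. y \<in> supp \<phi> \<and> z \<in> cball 0 (d / 2)} \<subseteq> D"
      by auto
    then show ?thesis using d(1) that[of "d / 2"] by simp
  qed
  define K where "K = {y + z |y z. y \<in> supp \<phi> \<and> z \<in> cball 0 R}"
  show ?thesis
  proof (rule that)
    show K: "compact K" unfolding K_def by (rule compact_sums[OF c compact_cball])
    show "K \<subseteq> D" using R by (simp add: K_def)
    show "supp \<phi> \<subseteq> K"
    proof
      fix x assume "x \<in> supp \<phi>"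
      then have "x = x + 0 \<and> x \<in> supp \<phi> \<and> 0 \<in> cball 0 R" using R(1) by simp
      then show "x \<in> K" unfolding K_def by blast
    qed
    fix e :: real assume e: "0 < e"
    obtain d0 where d0: "d0 > 0" "\<And>r x. 0 < r \<Longrightarrow> r < d0 \<Longrightarrow> \<bar>conv \<phi> (mollifier r) x - \<phi> x\<bar> \<le> e"
      using mollify_approx[OF C1c_continuous[OF \<phi>] c e] by blast
    have ci: "compact (supp (\<lambda>x. grad \<phi> x \<bullet> i))" for i
      by (rule compact_supp[OF c]) (simp add: C1c_grad_not_supp \<phi>)
    have "\<exists>d>0. \<forall>r x. 0 < r \<longrightarrow> r < d \<longrightarrow> \<bar>conv (\<lambda>x. grad \<phi> x \<bullet> i) (mollifier r) x - grad \<phi> x \<bullet> i\<bar> \<le> e" for i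
      by (intro mollify_approx ci e continuous_on_inner continuous_on_const C1c_continuous_grad \<phi>)
    then have "\<forall>i. \<exists>d. 0 < d \<and> (\<forall>r x. 0 < r \<longrightarrow> r < d \<longrightarrow>
        \<bar>conv (\<lambda>x. grad \<phi> x \<bullet> i) (mollifier r) x - grad \<phi> x \<bullet> i\<bar> \<le> e)"
      by blast
    from choice[OF this] obtain d where d: "\<And>i. d i > 0" "\<And>i r x. 0 < r \<Longrightarrow> r < d i \<Longrightarrow>
        \<bar>conv (\<lambda>x. grad \<phi> x \<bullet> i) (mollifier r) x - grad \<phi> x \<bullet> i\<bar> \<le> e"
      by blast
    \<comment> \<open>Finitely many conditions restrict the mollification radius: support inside
      \<open>K\<close>, accuracy of the function, accuracy of each partial derivative. Half the
      minimum meets them all.\<close>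
    define S where "S = insert R (insert d0 (d ` Basis))"
    have S: "finite S" "S \<noteq> {}" by (simp_all add: S_def)
    have m: "0 < Min S"
      using R(1) d0(1) d(1) by (simp add: Min_gr_iff[OF S]) (simp add: S_def)
    define r where "r = Min S / 2"
    have 2: "r < t" if "t \<in> S" for t
      using m Min_le[OF S(1) that] by (simp add: r_def)
    have r: "0 < r" "r \<le> R" "r < d0" "\<And>i. i \<in> Basis \<Longrightarrow> r < d i"
    proof -
      show "0 < r" using m by (simp add: r_def)
      show "r \<le> R" using 2[of R] by (simp add: S_def)
      show "r < d0" using 2[of d0] by (simp add: S_def)
      show "r < d i" if "i \<in> Basis" for i using 2[of "d i"] that by (simp add: S_def)
    qed
    have s: "supp (conv \<phi> (mollifier r)) \<subseteq> K"
      unfolding K_def by (rule conv_mollifier_supp[OF c r(1,2)])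
    have "compact (supp (conv \<phi> (mollifier r)))"
      using compact_Int_closed[OF K, of "supp (conv \<phi> (mollifier r))"] s
      by (simp add: Int_absorb1 supp_def)
    then have "conv \<phi> (mollifier r) \<in> test_functions D"
      using Ck_conv_mollifier[OF C1c_continuous[OF \<phi>] c r(1)] s \<open>K \<subseteq> D\<close>
      by (auto simp: test_functions_def)
    moreover have "\<bar>grad (conv \<phi> (mollifier r)) x \<bullet> i - grad \<phi> x \<bullet> i\<bar> \<le> e" if "i \<in> Basis" for i x
      using d(2)[OF r(1) r(4)[OF that]] grad_conv[OF \<phi> integrable_mollifier[OF r(1)] that] by simp
    ultimately show "\<exists>\<psi>\<in>test_functions D. supp \<psi> \<subseteq> K \<and>
        (\<forall>x. \<bar>\<psi> x - \<phi> x\<bar> \<le> e \<and> (\<forall>i\<in>Basis. \<bar>grad \<psi> x \<bullet> i - grad \<phi> x \<bullet> i\<bar> \<le> e))"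
      using s d0(2)[OF r(1,3)] by blast
  qed
qed

lemma continuous_approx_C1c:
  fixes f :: "'a::euclidean_space \<Rightarrow> real"
  assumes f: "continuous_on UNIV f" "\<And>x. R < norm x \<Longrightarrow> f x = 0" and e: "0 < e"
  obtains \<psi> where "\<psi> \<in> C1c" "\<And>x. R + 1 < norm x \<Longrightarrow> \<psi> x = 0" "\<And>x. \<bar>\<psi> x - f x\<bar> \<le> e"
proof -
  have s: "supp f \<subseteq> cball 0 R" using f(2) by (intro supp_subset) auto
  have c: "compact (supp f)" using f(2) by (intro compact_supp[of "cball 0 R"]) auto
  obtain d where d: "d > 0" "\<And>r x. 0 < r \<Longrightarrow> r < d \<Longrightarrow> \<bar>conv f (mollifier r) x - f x\<bar> \<le> e"
    using mollify_approx[OF f(1) c e] by blast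
  \<comment> \<open>A radius below \<open>1\<close> keeps the support inside the ball of radius
    \<open>R + 1\<close>.\<close>
  define r where "r = min d 1 / 2"
  have r: "0 < r" "r < d" "r < 1" using d(1) by (auto simp: r_def)
  have 0: "conv f (mollifier r) x = 0" if "R + 1 < norm x" for x
  proof (rule conv_mollifier_eq_0[OF r(1)])
    fix y assume "y \<in> supp f"
    then have "norm y \<le> R" using s by auto
    then show "r < dist x y" using that r norm_triangle_ineq2[of x y] by (simp add: dist_norm)
  qed
  then have "compact (supp (conv f (mollifier r)))"
    by (intro compact_supp[of "cball 0 (R + 1)"]) auto
  then have "conv f (mollifier r) \<in> C1c"
    using Ck_conv_mollifier[OF f(1) c r(1), of 1] by (simp add: C1c_def del: One_nat_def)
  then show ?thesis using that 0 d(2)[OF r(1,2)] by blast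
qed

section \<open>The distributional divergence\<close>

lemma integrable_mult_bounded:
  fixes f h :: "'a \<Rightarrow> real"
  assumes f: "integrable M f" and h: "h \<in> borel_measurable M" and B: "\<And>x. \<bar>h x\<bar> \<le> B"
  shows "integrable M (\<lambda>x. f x * h x)"
proof (rule Bochner_Integration.integrable_bound)
  show "integrable M (\<lambda>x. B * f x)" using f by simp
  show "(\<lambda>x. f x * h x) \<in> borel_measurable M"
    using borel_measurable_integrable[OF f] h by measurable
  have "norm (f x * h x) \<le> norm (B * f x)" for x
    using B[of x] mult_right_mono[of "\<bar>h x\<bar>" "\<bar>B\<bar>" "\<bar>f x\<bar>"] by (simp add: abs_mult mult.commute)
  then show "AE x in M. norm (f x * h x) \<le> norm (B * f x)" by simp
qed

lemma Lp_loc_1_integrable: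
  fixes f :: "'a::euclidean_space \<Rightarrow> real"
  assumes f: "f \<in> Lp_loc 1 D" and K: "compact K" "K \<subseteq> D"
  shows "integrable lebesgue (\<lambda>x. indicator K x * f x)"
proof -
  have "set_borel_measurable lebesgue D f" "Lp_norm 1 K f < \<infinity>"
    using f K by (auto simp: Lp_loc_def)
  then have *: "set_borel_measurable lebesgue K f"
    using K by (auto intro: set_borel_measurable_subset simp: lmeasurable_compact fmeasurableD)
  have "(\<integral>\<^sup>+x\<in>K. ennreal (\<bar>f x\<bar> powr 1) \<partial>lebesgue) \<noteq> \<infinity>"
    using \<open>Lp_norm 1 K f < \<infinity>\<close> by (auto simp: Lp_norm_def enn_powr_def split: if_splits)
  also have "(\<integral>\<^sup>+x\<in>K. ennreal (\<bar>f x\<bar> powr 1) \<partial>lebesgue) = (\<integral>\<^sup>+x. ennreal (norm (indicator K x * f x)) \<partial>lebesgue)"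
    by (intro nn_integral_cong) (auto simp: indicator_def)
  finally show ?thesis
    using * by (simp add: integrable_iff_bounded set_borel_measurable_def less_top)
qed

lemma C1c_borel:
  fixes \<phi> :: "'a::euclidean_space \<Rightarrow> real"
  assumes "\<phi> \<in> C1c"
  shows "\<phi> \<in> borel_measurable lebesgue" "grad \<phi> \<in> borel_measurable lebesgue"
  using borel_measurable_continuous_onI[OF C1c_continuous[OF assms]]
    borel_measurable_continuous_onI[OF C1c_continuous_grad[OF assms]]
  by (auto intro: measurable_completion simp: measurable_lborel1)

lemma C1c_bounded:
  fixes \<phi> :: "'a::euclidean_space \<Rightarrow> real"
  assumes "\<phi> \<in> C1c"
  obtains M where "0 \<le> M" "\<And>x. \<bar>\<phi> x\<bar> \<le> M" "\<And>x. norm (grad \<phi> x) \<le> M"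
proof -
  obtain A where A: "\<And>x. norm (\<phi> x) \<le> A"
    using bounded_compact_support[OF C1c_continuous[OF assms] C1c_compact[OF assms]] not_supp[of _ \<phi>] by blast
  obtain B where B: "\<And>x. norm (grad \<phi> x) \<le> B"
    using bounded_compact_support[OF C1c_continuous_grad[OF assms] C1c_compact[OF assms]
        C1c_grad_not_supp[OF assms]] by blast
  have "0 \<le> A" using A[of 0] norm_ge_zero[of "\<phi> 0"] by linarith
  then show ?thesis
    using A B by (intro that[of "max A B"]) (auto simp: le_max_iff_disj)
qed

lemma C1c_Lipschitz:
  fixes \<phi> :: "'a::euclidean_space \<Rightarrow> real"
  assumes "\<phi> \<in> C1c" "\<And>x. norm (grad \<phi> x) \<le> L"
  shows "\<bar>\<phi> x - \<phi> y\<bar> \<le> L * norm (x - y)"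
proof -
  have "norm (\<phi> x - \<phi> y) \<le> L * norm (x - y)"
  proof (rule differentiable_bound[where S = UNIV and f' = "\<lambda>x u. grad \<phi> x \<bullet> u"])
    show "(\<phi> has_derivative (\<lambda>u. grad \<phi> z \<bullet> u)) (at z within UNIV)" for z
      using C1c_has_derivative[OF assms(1)] by simp
    show "onorm (\<lambda>u. grad \<phi> z \<bullet> u) \<le> L" for z
    proof (rule onorm_le)
      fix u
      have "norm (grad \<phi> z \<bullet> u) \<le> norm (grad \<phi> z) * norm u"
        using Cauchy_Schwarz_ineq2 by simp
      also have "\<dots> \<le> L * norm u" by (intro mult_right_mono assms) simp
      finally show "norm (grad \<phi> z \<bullet> u) \<le> L * norm u" .
    qed
  qed auto
  then show ?thesis by simp
qed

text \<open>Both sides are continuous under uniform convergence of functions and gradients with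
  supports in a fixed compact set, because \<open>g\<close> and \<open>v\<close> are integrable
  there. The extension from smooth to \<open>C^1\<close> test functions is needed since the cutoffs
  near the boundary are built from squares of positive parts.\<close>

lemma has_distr_div_C1c:
  fixes v :: "'a::euclidean_space \<Rightarrow> 'a"
  assumes div: "has_distr_div D v g" and D: "open D"
    and v: "\<And>i. i \<in> Basis \<Longrightarrow> (\<lambda>x. v x \<bullet> i) \<in> Lp_loc 1 D"
    and \<phi>: "\<phi> \<in> C1c" "supp \<phi> \<subseteq> D"
  shows "(LINT x:D|lebesgue. g x * \<phi> x) = - (LINT x:D|lebesgue. v x \<bullet> grad \<phi> x)"
proof -
  obtain K where K: "compact K" "K \<subseteq> D" "supp \<phi> \<subseteq> K"
    and approx: "\<And>e. 0 < e \<Longrightarrow> \<exists>\<psi>\<in>test_functions D. supp \<psi> \<subseteq> K \<and>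
      (\<forall>x. \<bar>\<psi> x - \<phi> x\<bar> \<le> e \<and> (\<forall>i\<in>Basis. \<bar>grad \<psi> x \<bullet> i - grad \<phi> x \<bullet> i\<bar> \<le> e))"
    using C1c_approx_test_functions[OF \<phi>(1) D \<phi>(2)] by blast
  have g: "integrable lebesgue (\<lambda>x. indicator K x * g x)"
    using div K by (intro Lp_loc_1_integrable[of _ D]) (auto simp: has_distr_div_def)
  have vi: "integrable lebesgue (\<lambda>x. indicator K x * (v x \<bullet> i))" if "i \<in> Basis" for i
    using v[OF that] K by (intro Lp_loc_1_integrable[of _ D])
  \<comment> \<open>The defect of the identity for \<open>\<psi>\<close>, written over the fixed set
    \<open>K\<close> so that all integrals exist for every \<open>C1c\<close> function; it vanishes
    for test functions supported in \<open>K\<close>.\<close>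
  define I where "I \<psi> = (LINT x|lebesgue. indicator K x * g x * \<psi> x) +
      (\<Sum>i\<in>Basis. LINT x|lebesgue. indicator K x * (v x \<bullet> i) * (grad \<psi> x \<bullet> i))" for \<psi>
  have int: "integrable lebesgue (\<lambda>x. indicator K x * g x * \<psi> x)"
      "\<And>i. i \<in> Basis \<Longrightarrow> integrable lebesgue (\<lambda>x. indicator K x * (v x \<bullet> i) * (grad \<psi> x \<bullet> i))"
    if \<psi>: "\<psi> \<in> C1c" for \<psi>
  proof -
    obtain M where "0 \<le> M" and M: "\<And>x. \<bar>\<psi> x\<bar> \<le> M" "\<And>x. norm (grad \<psi> x) \<le> M"
      by (rule C1c_bounded[OF \<psi>]) (rule that)
    have [measurable]: "\<psi> \<in> borel_measurable lebesgue" "grad \<psi> \<in> borel_measurable lebesgue"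
      using C1c_borel[OF \<psi>] by auto
    show "integrable lebesgue (\<lambda>x. indicator K x * g x * \<psi> x)"
      by (rule integrable_mult_bounded[OF g _ M(1)]) measurable
    show "integrable lebesgue (\<lambda>x. indicator K x * (v x \<bullet> i) * (grad \<psi> x \<bullet> i))" if "i \<in> Basis" for i
    proof (rule integrable_mult_bounded[OF vi[OF that]])
      show "(\<lambda>x. grad \<psi> x \<bullet> i) \<in> borel_measurable lebesgue" by measurable
      show "\<bar>grad \<psi> x \<bullet> i\<bar> \<le> M" for x using Basis_le_norm[OF that] M(2) order_trans by blast
    qed
  qed
  have I: "(LINT x:D|lebesgue. g x * \<psi> x) + (LINT x:D|lebesgue. v x \<bullet> grad \<psi> x) = I \<psi>"
    if \<psi>: "\<psi> \<in> C1c" "supp \<psi> \<subseteq> K" for \<psi>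
  proof -
    have 0: "\<psi> x = 0" "grad \<psi> x = 0" if "x \<notin> K" for x
      using that \<psi> not_supp[of x \<psi>] C1c_grad_not_supp[OF \<psi>(1), of x] by auto
    have 1: "(\<lambda>x. indicator D x *\<^sub>R (g x * \<psi> x)) = (\<lambda>x. indicator K x * g x * \<psi> x)"
      using 0 K(2) by (intro ext) (auto simp: indicator_def)
    have 2: "(\<lambda>x. indicator D x *\<^sub>R (v x \<bullet> grad \<psi> x)) =
        (\<lambda>x. \<Sum>i\<in>Basis. indicator K x * (v x \<bullet> i) * (grad \<psi> x \<bullet> i))"
    proof
      fix x
      show "indicator D x *\<^sub>R (v x \<bullet> grad \<psi> x) = (\<Sum>i\<in>Basis. indicator K x * (v x \<bullet> i) * (grad \<psi> x \<bullet> i))"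
        using 0[of x] K(2) by (subst euclidean_inner) (auto simp: indicator_def)
    qed
    show ?thesis
      unfolding set_lebesgue_integral_def 1 2 I_def
      using int[OF \<psi>(1)] by (subst Bochner_Integration.integral_sum) auto
  qed
  \<comment> \<open>\<open>A\<close> bounds the change of \<open>I\<close> when the function and
    each partial derivative change by at most one.\<close>
  define A where "A = (LINT x|lebesgue. \<bar>indicator K x * g x\<bar>) +
      (\<Sum>i\<in>Basis. LINT x|lebesgue. \<bar>indicator K x * (v x \<bullet> i)\<bar>)"
  have A: "0 \<le> A"
    unfolding A_def by (intro add_nonneg_nonneg sum_nonneg Bochner_Integration.integral_nonneg) auto
  have bound: "\<bar>I \<phi>\<bar> \<le> e * A" if e: "0 < e" for e
  proof -
    obtain \<psi> where \<psi>: "\<psi> \<in> test_functions D" "supp \<psi> \<subseteq> K" "\<And>x. \<bar>\<psi> x - \<phi> x\<bar> \<le> e"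
      "\<And>x i. i \<in> Basis \<Longrightarrow> \<bar>grad \<psi> x \<bullet> i - grad \<phi> x \<bullet> i\<bar> \<le> e"
      using approx[OF e] by blast
    have C: "\<psi> \<in> C1c"
      using \<psi>(1) by (simp add: test_functions_def C1c_def del: One_nat_def Ck.simps)
    have "I \<psi> = 0"
      using div \<psi>(1) I[OF C \<psi>(2)] by (simp add: has_distr_div_def)
    have *: "\<bar>(LINT x|lebesgue. f x * p x) - (LINT x|lebesgue. f x * q x)\<bar> \<le> e * (LINT x|lebesgue. \<bar>f x\<bar>)"
      if "integrable lebesgue f" "integrable lebesgue (\<lambda>x. f x * p x)" "integrable lebesgue (\<lambda>x. f x * q x)"
        "\<And>x. \<bar>p x - q x\<bar> \<le> e" for f p q :: "'a \<Rightarrow> real"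
    proof -
      have "(LINT x|lebesgue. f x * p x) - (LINT x|lebesgue. f x * q x) = (LINT x|lebesgue. f x * p x - f x * q x)"
        using that by simp
      also have "norm \<dots> \<le> (LINT x|lebesgue. e * \<bar>f x\<bar>)"
      proof (rule Bochner_Integration.integral_norm_bound_integral)
        show "norm (f x * p x - f x * q x) \<le> e * \<bar>f x\<bar>" for x
          using mult_right_mono[OF that(4)[of x], of "\<bar>f x\<bar>"]
          by (simp add: abs_mult mult.commute flip: right_diff_distrib)
      qed (use that in auto)
      finally show ?thesis by simp
    qed
    have "\<bar>I \<phi>\<bar> = \<bar>I \<psi> - I \<phi>\<bar>" using \<open>I \<psi> = 0\<close> by simp
    also have "\<dots> \<le> \<bar>(LINT x|lebesgue. indicator K x * g x * \<psi> x) - (LINT x|lebesgue. indicator K x * g x * \<phi> x)\<bar>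
        + \<bar>\<Sum>i\<in>Basis. (LINT x|lebesgue. indicator K x * (v x \<bullet> i) * (grad \<psi> x \<bullet> i)) -
            (LINT x|lebesgue. indicator K x * (v x \<bullet> i) * (grad \<phi> x \<bullet> i))\<bar>"
      unfolding I_def sum_subtractf by linarith
    also have "\<dots> \<le> e * (LINT x|lebesgue. \<bar>indicator K x * g x\<bar>) +
        (\<Sum>i\<in>Basis. e * (LINT x|lebesgue. \<bar>indicator K x * (v x \<bullet> i)\<bar>))"
      by (intro add_mono order_trans[OF sum_abs] sum_mono * g vi int C \<phi>(1) \<psi>(3,4))
    also have "\<dots> = e * A"
      by (simp add: A_def distrib_left sum_distrib_left)
    finally show ?thesis .
  qed
  have "\<bar>I \<phi>\<bar> \<le> 0 + e" if e: "0 < e" for e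
  proof -
    have "\<bar>I \<phi>\<bar> \<le> e / (A + 1) * A" using e A by (intro bound) simp
    also have "\<dots> \<le> e / (A + 1) * (A + 1)" using e A by (intro mult_left_mono) auto
    finally show ?thesis using A by simp
  qed
  then have "I \<phi> = 0" using field_le_epsilon[of "\<bar>I \<phi>\<bar>" 0] by simp
  then show ?thesis using I[OF \<phi>(1) K(3)] by simp
qed

section \<open>Geometry of the half space\<close>

lemma halfspace_eq: "halfspace = {x :: (real ^ 'm) \<times> real. (0, 1) \<bullet> x > 0}"
  by (auto simp: halfspace_def inner_prod_def)

lemma frontier_halfspace: "frontier (halfspace :: ((real ^ 'm) \<times> real) set) = {x. snd x = 0}"
  unfolding halfspace_eq by (subst frontier_halfspace_gt) (auto simp: inner_prod_def zero_prod_def)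

lemma bdist_halfspace: "bdist halfspace x = \<bar>snd x\<bar>" for x :: "(real ^ 'm) \<times> real"
proof (rule antisym)
  have "dist x (fst x, 0) = \<bar>snd x\<bar>" by (simp add: dist_prod_def dist_norm)
  then show "bdist halfspace x \<le> \<bar>snd x\<bar>"
    using infdist_le[of "(fst x, 0)" "{x. snd x = 0}" x] by (simp add: bdist_def frontier_halfspace)
  have "\<bar>snd x\<bar> \<le> (INF y\<in>{y. snd y = 0}. dist x y)"
  proof (rule cINF_greatest)
    show "{y :: (real ^ 'm) \<times> real. snd y = 0} \<noteq> {}" by (auto intro: exI[of _ 0])
    fix y :: "(real ^ 'm) \<times> real" assume "y \<in> {y. snd y = 0}"
    then show "\<bar>snd x\<bar> \<le> dist x y"
      using dist_snd_le[of x y] by (simp add: dist_norm)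
  qed
  moreover have "(0, 0) \<in> {y :: (real ^ 'm) \<times> real. snd y = 0}" by simp
  ultimately show "\<bar>snd x\<bar> \<le> bdist halfspace x"
    by (auto simp: bdist_def frontier_halfspace infdist_def)
qed

lemma bnbhd_halfspace:
  "bnbhd halfspace \<delta> = {x :: (real ^ 'm) \<times> real. 0 < snd x \<and> ereal (snd x) < \<delta>}"
  unfolding bnbhd_def bdist_halfspace by (auto simp: halfspace_def)

lemma open_bnbhd_halfspace: "open (bnbhd halfspace \<delta> :: ((real ^ 'm) \<times> real) set)"
proof -
  have "open {t. ereal t < \<delta>}"
    using open_ereal_vimage[OF open_lessThan] unfolding vimage_def lessThan_def by simp
  then have "open (snd -` ({0<..} \<inter> {t. ereal t < \<delta>}) :: ((real ^ 'm) \<times> real) set)"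
    by (intro open_vimage_snd open_Int open_greaterThan)
  moreover have "(bnbhd halfspace \<delta> :: ((real ^ 'm) \<times> real) set) = snd -` ({0<..} \<inter> {t. ereal t < \<delta>})"
    by (auto simp: bnbhd_halfspace)
  ultimately show ?thesis by simp
qed

text \<open>On the open half space the distance to the boundary is the linear function
  \<open>snd\<close>. This identifies the quantity inside \<open>b_seminorm\<close> with the normal
  component of the field.\<close>

lemma grad_bdist_halfspace:
  fixes x :: "(real ^ 'm) \<times> real"
  assumes "x \<in> halfspace"
  shows "grad (bdist halfspace) x = (0, 1)"
proof (rule grad_eq)
  have "(snd has_derivative (\<lambda>u. (0, 1) \<bullet> u)) (at x)"
    using has_derivative_snd[OF has_derivative_ident] by (simp add: inner_prod_def)
  moreover have "open (halfspace :: ((real ^ 'm) \<times> real) set)"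
    unfolding halfspace_eq by (rule open_halfspace_gt)
  moreover have "(0, 1) \<bullet> y = bdist halfspace y" "snd y = bdist halfspace y"
    if "y \<in> halfspace" for y :: "(real ^ 'm) \<times> real"
    using that unfolding bdist_halfspace by (simp_all add: halfspace_def inner_prod_def)
  ultimately show "(bdist halfspace has_derivative (\<lambda>u. (0, 1) \<bullet> u)) (at x)"
    using has_derivative_transform_within_open[of snd _ x UNIV halfspace "bdist halfspace"] assms by simp
qed

section \<open>Cutting off near the boundary\<close>

text \<open>Squaring the positive part removes its corner, giving an explicit function of class
  \<open>C^1\<close>; this regularity suffices for members of \<open>C1c\<close>, so the boundary
  cutoffs are polynomial expressions.\<close>

definition pos_sq :: "real \<Rightarrow> real" where
  "pos_sq u = (max 0 u)\<^sup>2"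

lemma pos_sq_has_field_derivative: "(pos_sq has_field_derivative 2 * max 0 u) (at u)"
proof -
  consider "0 < u" | "u < 0" | "u = 0" by linarith
  then show ?thesis
  proof cases
    case 1
    have "((\<lambda>u. u\<^sup>2) has_field_derivative 2 * max 0 u) (at u)"
      using 1 by (auto intro!: derivative_eq_intros)
    then show ?thesis
      by (rule has_field_derivative_transform_within_open[where S = "{0<..}"])
        (use 1 in \<open>auto simp: pos_sq_def\<close>)
  next
    case 2
    have "((\<lambda>u. 0) has_field_derivative 2 * max 0 u) (at u)"
      using 2 by simp
    then show ?thesis
      by (rule has_field_derivative_transform_within_open[where S = "{..<0}"])
        (use 2 in \<open>auto simp: pos_sq_def\<close>)
  next
    case 3
    have "((\<lambda>h::real. max 0 h) \<longlongrightarrow> max 0 0) (at 0)"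
      by (intro tendsto_max tendsto_const tendsto_ident_at)
    moreover have "eventually (\<lambda>h. max 0 h = pos_sq h / h) (at 0)"
      by (auto simp: eventually_at_filter pos_sq_def max_def power2_eq_square)
    ultimately have "((\<lambda>h. pos_sq h / h) \<longlongrightarrow> 0) (at 0)"
      using Lim_transform_eventually by fastforce
    then show ?thesis
      using 3 by (simp add: DERIV_def pos_sq_def)
  qed
qed

lemma continuous_pos_sq: "continuous_on S f \<Longrightarrow> continuous_on S (\<lambda>x. pos_sq (f x))"
  unfolding pos_sq_def by (intro continuous_intros)

text \<open>Put \<open>q = 2 * t / s - 1\<close> at height \<open>t\<close>. For \<open>t\<close> at
  most \<open>s / 2\<close> the inner square is \<open>0\<close> and the value is \<open>1\<close>;
  for \<open>t\<close> at least \<open>s\<close> the inner square is at least \<open>1\<close> and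
  the value is \<open>0\<close>. Nesting two \<open>pos_sq\<close> makes both junctions
  \<open>C^1\<close>.\<close>

definition height_cutoff :: "real \<Rightarrow> 'a \<times> real \<Rightarrow> real" where
  "height_cutoff s x = pos_sq (1 - pos_sq (2 * snd x / s - 1))"

definition height_cutoff_deriv :: "real \<Rightarrow> 'a \<times> real \<Rightarrow> real" where
  "height_cutoff_deriv s x =
    - (2 * max 0 (1 - pos_sq (2 * snd x / s - 1))) * (2 * max 0 (2 * snd x / s - 1)) * (2 / s)"

lemma height_cutoff_has_derivative:
  fixes x :: "'a::euclidean_space \<times> real"
  assumes "0 < s"
  shows "(height_cutoff s has_derivative (\<lambda>u. (0, height_cutoff_deriv s x) \<bullet> u)) (at x)"
proof -
  let ?q = "\<lambda>t. 2 * t / s - 1"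
  have q: "(?q has_field_derivative 2 / s) (at t)" for t
    using assms by (auto intro!: derivative_eq_intros)
  have p: "((\<lambda>t. 1 - pos_sq (?q t)) has_field_derivative - (2 * max 0 (?q t) * (2 / s))) (at t)" for t
    using DERIV_diff[OF DERIV_const DERIV_chain2[OF pos_sq_has_field_derivative q]] by simp
  have "((\<lambda>t. pos_sq (1 - pos_sq (?q t))) has_field_derivative
      2 * max 0 (1 - pos_sq (?q t)) * - (2 * max 0 (?q t) * (2 / s))) (at t)" for t
    by (rule DERIV_chain2[OF pos_sq_has_field_derivative p])
  from has_derivative_compose[OF has_derivative_snd[OF has_derivative_ident]
      has_field_derivative_imp_has_derivative[OF this[of "snd x"]]]
  show ?thesis
    unfolding height_cutoff_def height_cutoff_deriv_def
    by (rule has_derivative_eq_rhs) (simp add: inner_prod_def)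
qed

lemma continuous_height_cutoff_deriv:
  "continuous_on UNIV (\<lambda>x::'a::euclidean_space \<times> real. (0::'a, height_cutoff_deriv s x))"
  unfolding height_cutoff_deriv_def divide_inverse by (intro continuous_intros continuous_pos_sq)

lemma height_cutoff_eq_1: "0 < s \<Longrightarrow> snd x \<le> s / 2 \<Longrightarrow> height_cutoff s x = 1"
  by (simp add: height_cutoff_def pos_sq_def field_simps)

lemma pos_sq_ge_1: "1 \<le> q \<Longrightarrow> 1 \<le> pos_sq q"
  by (simp add: pos_sq_def)

lemma pos_sq_nonneg: "0 \<le> pos_sq q"
  by (simp add: pos_sq_def)

lemma height_cutoff_eq_0: "0 < s \<Longrightarrow> s \<le> snd x \<Longrightarrow> height_cutoff s x = 0"
  and height_cutoff_deriv_eq_0: "0 < s \<Longrightarrow> s \<le> snd x \<Longrightarrow> height_cutoff_deriv s x = 0"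
  using pos_sq_ge_1[of "2 * snd x / s - 1"]
  by (simp_all add: height_cutoff_def height_cutoff_deriv_def pos_sq_def[of "1 - _"] field_simps)

lemma height_cutoff_bound: "\<bar>height_cutoff s x\<bar> \<le> 1"
proof -
  have "max 0 (1 - pos_sq (2 * snd x / s - 1)) ^ 2 \<le> 1 ^ 2"
    using pos_sq_nonneg[of "2 * snd x / s - 1"] by (intro power_mono) auto
  then show ?thesis by (simp add: height_cutoff_def pos_sq_def[of "1 - _"])
qed

text \<open>The two outer derivatives contribute \<open>2\<close> each and the rescaling
  \<open>2 / s\<close>; the other two factors lie between \<open>0\<close> and \<open>1\<close>
  below height \<open>s\<close>.\<close>

lemma height_cutoff_deriv_bound:
  assumes "0 < s"
  shows "\<bar>height_cutoff_deriv s x\<bar> \<le> 8 / s"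
\<comment> \<open>Above height \<open>s\<close> the factor \<open>q\<close> exceeds
  \<open>1\<close>, but the derivative is zero there.\<close>
proof (cases "snd x \<ge> s")
  case True
  then show ?thesis using assms by (simp add: height_cutoff_deriv_eq_0)
next
  case False
  define p where "p = max 0 (1 - pos_sq (2 * snd x / s - 1))"
  define q where "q = max 0 (2 * snd x / s - 1)"
  have "0 \<le> p" "p \<le> 1" using pos_sq_nonneg[of "2 * snd x / s - 1"] by (auto simp: p_def)
  moreover have "0 \<le> q" "q \<le> 1" using False assms by (auto simp: q_def field_simps)
  ultimately have "p * q \<le> 1" "0 \<le> p * q" using mult_mono[of p 1 q 1] by auto
  then have "(p * q) * (8 / s) \<le> 1 * (8 / s)" using assms by (intro mult_right_mono) auto
  moreover have "\<bar>height_cutoff_deriv s x\<bar> = (p * q) * (8 / s)"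
    using \<open>0 \<le> p * q\<close> assms unfolding height_cutoff_deriv_def p_def[symmetric] q_def[symmetric]
    by (simp add: abs_mult \<open>0 \<le> p\<close> \<open>0 \<le> q\<close>)
  ultimately show ?thesis by simp
qed

section \<open>The trace functional\<close>

text \<open>By Tonelli the left side is an integral over pairs of a point \<open>x\<close> of the
  strip and a boundary point \<open>z\<close> within \<open>s\<close> of its projection. For fixed
  \<open>z\<close> all such \<open>x\<close> lie in the ball of radius \<open>2 * s\<close> around
  \<open>(z, 0)\<close>, where \<open>b\<close> bounds the mass of \<open>f\<close>.\<close>

lemma nn_integral_strip_average:
  fixes f :: "(real ^ 'm) \<times> real \<Rightarrow> ennreal" and \<phi> :: "real ^ 'm \<Rightarrow> ennreal"
  assumes f: "f \<in> borel_measurable lebesgue" and [measurable]: "\<phi> \<in> borel_measurable borel"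
    and b: "\<And>z. (\<integral>\<^sup>+x\<in>cball (z, 0) (2 * s). f x \<partial>lebesgue) \<le> b"
  shows "(\<integral>\<^sup>+x. indicator {x. 0 < snd x \<and> snd x < s} x * f x *
      (\<integral>\<^sup>+z. indicator (cball (fst x) s) z * \<phi> z \<partial>lborel) \<partial>lebesgue) \<le> b * (\<integral>\<^sup>+z. \<phi> z \<partial>lborel)"
proof -
  \<comment> \<open>The exchange of integrals takes place for Borel product measures, while
    \<open>f\<close> is only Lebesgue measurable; a Borel version replaces it.\<close>
  obtain f' where [measurable]: "f' \<in> borel_measurable borel" and f': "AE x in lborel. f x = f' x"
    using completion_ex_borel_measurable[OF f] by (auto simp: measurable_lborel1)
  have f'_ae: "AE x in lebesgue. f x = f' x" using f' by (rule AE_completion)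
  let ?S = "{x :: (real ^ 'm) \<times> real. 0 < snd x \<and> snd x < s}"
  let ?J = "\<lambda>(x :: (real ^ 'm) \<times> real) z. if dist (fst x) z \<le> s then 1 else 0 :: ennreal"
  have "?S = snd -` {0<..<s}" by auto
  then have S [measurable]: "?S \<in> sets borel"
    by (simp add: open_vimage_snd)
  have J [measurable]: "(\<lambda>p. ?J (fst p) (snd p)) \<in> borel_measurable (lborel \<Otimes>\<^sub>M lborel)"
  proof -
    have "closed {p :: ((real ^ 'm) \<times> real) \<times> (real ^ 'm). dist (fst (fst p)) (snd p) \<le> s}"
      by (intro closed_Collect_le continuous_intros)
    then have "Measurable.pred borel (\<lambda>p :: ((real ^ 'm) \<times> real) \<times> (real ^ 'm). dist (fst (fst p)) (snd p) \<le> s)"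
      by (simp add: pred_def borel_closed)
    then show ?thesis
      unfolding lborel_prod by simp
  qed
  have J' [measurable]: "(\<lambda>x. ?J x z) \<in> borel_measurable borel" for z
  proof -
    have "closed {x :: (real ^ 'm) \<times> real. dist (fst x) z \<le> s}"
      by (intro closed_Collect_le continuous_intros)
    then have "Measurable.pred borel (\<lambda>x :: (real ^ 'm) \<times> real. dist (fst x) z \<le> s)"
      by (simp add: pred_def borel_closed)
    then show ?thesis by simp
  qed
  have cb: "indicator (cball (fst x) s) z = ?J x z" for x z
    by (simp add: indicator_def)
  have "(\<integral>\<^sup>+x. indicator ?S x * f x * (\<integral>\<^sup>+z. indicator (cball (fst x) s) z * \<phi> z \<partial>lborel) \<partial>lebesgue)
      = (\<integral>\<^sup>+x. indicator ?S x * f' x * (\<integral>\<^sup>+z. ?J x z * \<phi> z \<partial>lborel) \<partial>lebesgue)"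
    unfolding cb using f'_ae by (intro nn_integral_cong_AE) auto
  also have "\<dots> = (\<integral>\<^sup>+x. indicator ?S x * f' x * (\<integral>\<^sup>+z. ?J x z * \<phi> z \<partial>lborel) \<partial>lborel)"
    by (rule nn_integral_completion)
  also have "\<dots> = (\<integral>\<^sup>+x. (\<integral>\<^sup>+z. indicator ?S x * f' x * (?J x z * \<phi> z) \<partial>lborel) \<partial>lborel)"
    by (intro nn_integral_cong nn_integral_cmult[symmetric]) measurable
  also have "\<dots> = (\<integral>\<^sup>+z. (\<integral>\<^sup>+x. indicator ?S x * f' x * (?J x z * \<phi> z) \<partial>lborel) \<partial>lborel)"
  proof (rule lborel_pair.Fubini'[symmetric])
    have F: "(\<lambda>x. indicator ?S x * f' x) \<in> borel_measurable lborel" by measurable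
    have \<phi>: "\<phi> \<in> borel_measurable lborel" by measurable
    show "(\<lambda>(x, z). indicator ?S x * f' x * (?J x z * \<phi> z)) \<in> borel_measurable (lborel \<Otimes>\<^sub>M lborel)"
      unfolding case_prod_beta'
      by (intro borel_measurable_times_ennreal measurable_compose[OF measurable_fst F]
          measurable_compose[OF measurable_snd \<phi>]) (use J in simp)
  qed
  also have "\<dots> \<le> (\<integral>\<^sup>+z. b * \<phi> z \<partial>lborel)"
  proof (rule nn_integral_mono)
    fix z :: "real ^ 'm"
    have "(\<integral>\<^sup>+x. indicator ?S x * f' x * (?J x z * \<phi> z) \<partial>lborel)
        = (\<integral>\<^sup>+x. indicator ?S x * ?J x z * f' x \<partial>lborel) * \<phi> z"
      by (subst nn_integral_multc[symmetric]) (auto simp: mult_ac intro!: nn_integral_cong)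
    also have "(\<integral>\<^sup>+x. indicator ?S x * ?J x z * f' x \<partial>lborel) = (\<integral>\<^sup>+x. indicator ?S x * ?J x z * f' x \<partial>lebesgue)"
      by (rule nn_integral_completion[symmetric])
    also have "\<dots> = (\<integral>\<^sup>+x. indicator ?S x * ?J x z * f x \<partial>lebesgue)"
      using f'_ae by (intro nn_integral_cong_AE) auto
    also have "\<dots> \<le> (\<integral>\<^sup>+x\<in>cball (z, 0) (2 * s). f x \<partial>lebesgue)"
    proof (rule nn_integral_mono)
      fix x :: "(real ^ 'm) \<times> real"
      show "indicator ?S x * ?J x z * f x \<le> f x * indicator (cball (z, 0) (2 * s)) x"
      proof (cases "x \<in> ?S \<and> dist (fst x) z \<le> s")
        case True
        \<comment> \<open>At most \<open>s\<close> horizontally plus at most \<open>s\<close>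
          vertically.\<close>
        have "dist (z, 0) x \<le> dist z (fst x) + dist 0 (snd x)"
          unfolding dist_prod_def by (rule order_trans[OF sqrt_sum_squares_le_sum]) auto
        also have "\<dots> \<le> 2 * s" using True by (simp add: dist_commute)
        finally show ?thesis by (simp add: indicator_def)
      qed (auto simp: indicator_def)
    qed
    also have "\<dots> \<le> b" by (rule b)
    finally show "(\<integral>\<^sup>+x. indicator ?S x * f' x * (?J x z * \<phi> z) \<partial>lborel) \<le> b * \<phi> z"
      by (simp add: mult_right_mono)
  qed
  also have "\<dots> = b * (\<integral>\<^sup>+z. \<phi> z \<partial>lborel)"
    by (rule nn_integral_cmult) measurable
  finally show ?thesis .
qed

text \<open>The strips decrease to the empty set, and \<open>h\<close> itself dominates.\<close>

lemma nn_integral_strip_tendsto_0: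
  fixes h :: "'a::euclidean_space \<times> real \<Rightarrow> real"
  assumes h: "integrable lebesgue h" "\<And>x. 0 \<le> h x"
  shows "(\<lambda>k. \<integral>\<^sup>+x. ennreal (indicator {x. 0 < snd x \<and> snd x < inverse (real (Suc k))} x * h x) \<partial>lebesgue) \<longlonglongrightarrow> 0"
proof -
  let ?S = "\<lambda>k. {x :: 'a \<times> real. 0 < snd x \<and> snd x < inverse (real (Suc k))}"
  have [measurable]: "h \<in> borel_measurable lebesgue" using h(1) by (rule borel_measurable_integrable)
  have "?S k = snd -` {0<..<inverse (real (Suc k))}" for k by auto
  then have "open (?S k)" for k by (simp only: open_vimage_snd open_greaterThanLessThan)
  then have [measurable]: "?S k \<in> sets lebesgue" for k
    using borel_open by (intro sets_completionI_sets) simp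
  have "(\<lambda>k. \<integral>\<^sup>+x. ennreal (indicator (?S k) x * h x) \<partial>lebesgue) \<longlonglongrightarrow> (\<integral>\<^sup>+x. 0 \<partial>(lebesgue :: ('a \<times> real) measure))"
  proof (rule nn_integral_dominated_convergence[where w = "\<lambda>x. ennreal (h x)"])
    show "(\<integral>\<^sup>+x. ennreal (h x) \<partial>lebesgue) < \<infinity>"
      using h by (simp add: integrable_iff_bounded)
    show "AE x in lebesgue. (\<lambda>k. ennreal (indicator (?S k) x * h x)) \<longlonglongrightarrow> 0"
    proof (rule AE_I2)
      fix x :: "'a \<times> real"
      have "eventually (\<lambda>k. ennreal (indicator (?S k) x * h x) = 0) sequentially"
      proof (cases "0 < snd x")
        case True
        have "eventually (\<lambda>k. inverse (real (Suc k)) < snd x) sequentially"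
          using LIMSEQ_inverse_real_of_nat True by (rule order_tendstoD)
        then show ?thesis by eventually_elim simp
      qed simp
      then show "(\<lambda>k. ennreal (indicator (?S k) x * h x)) \<longlonglongrightarrow> 0"
        by (rule tendsto_eventually)
    qed
    show "AE x in lebesgue. ennreal (indicator (?S k) x * h x) \<le> ennreal (h x)" for k
      using h(2) by (intro AE_I2 ennreal_leI) (auto simp: indicator_def)
  qed measurable
  then show ?thesis by simp
qed

lemma C1c_outside_cball:
  fixes \<Phi> :: "'a::euclidean_space \<Rightarrow> real"
  assumes \<Phi>: "\<Phi> \<in> C1c"
  obtains R where "\<And>x. x \<notin> cball 0 R \<Longrightarrow> \<Phi> x = 0" "\<And>x. x \<notin> cball 0 R \<Longrightarrow> grad \<Phi> x = 0"
proof -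
  obtain R where R: "\<forall>x\<in>supp \<Phi>. norm x \<le> R"
    using compact_imp_bounded[OF C1c_compact[OF \<Phi>]] unfolding bounded_iff by blast
  have "x \<notin> supp \<Phi>" if "x \<notin> cball 0 R" for x
    using R that by auto
  then show ?thesis
    using not_supp[of _ \<Phi>] C1c_grad_not_supp[OF \<Phi>] by (intro that[of R]) blast+
qed

lemma C1c_boundary_borel:
  fixes \<Phi> :: "'a::euclidean_space \<times> real \<Rightarrow> real"
  assumes "\<Phi> \<in> C1c"
  shows "(\<lambda>z. \<Phi> (z, 0)) \<in> borel_measurable borel"
proof (rule borel_measurable_continuous_onI)
  have "continuous_on UNIV (\<lambda>z::'a. (z, 0::real))"
    by (intro continuous_intros)
  then show "continuous_on UNIV (\<lambda>z. \<Phi> (z, 0))"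
    by (rule continuous_on_compose2[OF C1c_continuous[OF assms]]) simp
qed

text \<open>The cutoff has slope at most \<open>8 / s\<close>; averaging divides by the volume
  \<open>s ^ m * unit_ball_vol m\<close> of a boundary ball; the seminorm is used on balls of radius
  \<open>2 * s\<close> in dimension \<open>m + 1\<close> and gives \<open>(2 * s) ^ (m + 1)\<close>.
  The powers of \<open>s\<close> cancel and this constant remains.\<close>

definition trace_const :: "nat \<Rightarrow> real" where
  "trace_const m = 8 * 2 ^ (m + 1) / unit_ball_vol (real m)"

lemma trace_const_pos: "0 < trace_const m"
  by (simp add: trace_const_def)

text \<open>
  \<open>W\<close> and \<open>G\<close> stand for the vector field and its divergence, both extended by zero outside the
  boundary layer of height \<open>\<delta>\<close>; \<open>B\<close> is the seminorm \<open>b\<^sup>\<nu>\<close> of the normal component.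
\<close>

locale boundary_layer_field =
  fixes W :: "(real ^ 'm) \<times> real \<Rightarrow> (real ^ 'm) \<times> real" and G :: "(real ^ 'm) \<times> real \<Rightarrow> real"
    and \<delta> \<nu> :: ereal and B :: real
  assumes G_integrable: "\<And>R. integrable lebesgue (\<lambda>x. indicator (cball 0 R) x * G x)"
    and W_integrable: "\<And>R. integrable lebesgue (\<lambda>x. indicator (cball 0 R) x *\<^sub>R W x)"
    and W_borel: "W \<in> borel_measurable lebesgue"
    and G_outside: "\<And>x. snd x \<le> 0 \<Longrightarrow> G x = 0"
    and W_outside: "\<And>x. snd x \<le> 0 \<Longrightarrow> W x = 0"
    and \<nu>_pos: "0 < \<nu>"
    and B_nonneg: "0 \<le> B"
    and normal_bound: "\<And>z s. 0 < s \<Longrightarrow> ereal s < \<nu> \<Longrightarrow>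
      (\<integral>\<^sup>+x\<in>cball (z, 0) s. ennreal \<bar>snd (W x)\<bar> \<partial>lebesgue) \<le> ennreal (B * s ^ (CARD('m) + 1))"
    and div_eq: "\<And>\<Phi>. \<Phi> \<in> C1c \<Longrightarrow> supp \<Phi> \<subseteq> bnbhd halfspace \<delta> \<Longrightarrow>
      (LINT x|lebesgue. G x * \<Phi> x) + (LINT x|lebesgue. W x \<bullet> grad \<Phi> x) = 0"
begin

definition T :: "((real ^ 'm) \<times> real \<Rightarrow> real) \<Rightarrow> real" where
  "T \<Phi> = (LINT x|lebesgue. G x * \<Phi> x) + (LINT x|lebesgue. W x \<bullet> grad \<Phi> x)"

lemma
  assumes \<Phi>: "\<Phi> \<in> C1c"
  shows integrable_G_mult: "integrable lebesgue (\<lambda>x. G x * \<Phi> x)"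
    and integrable_W_grad: "integrable lebesgue (\<lambda>x. W x \<bullet> grad \<Phi> x)"
proof -
  obtain R where 0: "\<And>x. x \<notin> cball 0 R \<Longrightarrow> \<Phi> x = 0" "\<And>x. x \<notin> cball 0 R \<Longrightarrow> grad \<Phi> x = 0"
    by (rule C1c_outside_cball[OF \<Phi>]) (rule that)
  obtain M where "0 \<le> M" and M: "\<And>x. \<bar>\<Phi> x\<bar> \<le> M" "\<And>x. norm (grad \<Phi> x) \<le> M"
    by (rule C1c_bounded[OF \<Phi>]) (rule that)
  note [measurable] = C1c_borel[OF \<Phi>] W_borel
  have "integrable lebesgue (\<lambda>x. (indicator (cball 0 R) x * G x) * \<Phi> x)"
    by (rule integrable_mult_bounded[OF G_integrable _ M(1)]) measurable
  also have "(\<lambda>x. (indicator (cball 0 R) x * G x) * \<Phi> x) = (\<lambda>x. G x * \<Phi> x)"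
    using 0 by (intro ext) (auto simp: indicator_def)
  finally show "integrable lebesgue (\<lambda>x. G x * \<Phi> x)" .
  show "integrable lebesgue (\<lambda>x. W x \<bullet> grad \<Phi> x)"
  proof (rule Bochner_Integration.integrable_bound)
    show "integrable lebesgue (\<lambda>x. M * norm (indicator (cball 0 R) x *\<^sub>R W x))"
      by (intro integrable_mult_right integrable_norm W_integrable)
    show "AE x in lebesgue. norm (W x \<bullet> grad \<Phi> x) \<le> norm (M * norm (indicator (cball 0 R) x *\<^sub>R W x))"
    proof (rule AE_I2)
      fix x
      have "\<bar>W x \<bullet> grad \<Phi> x\<bar> \<le> norm (W x) * norm (grad \<Phi> x)"
        by (rule Cauchy_Schwarz_ineq2)
      also have "\<dots> \<le> norm (W x) * M" by (intro mult_left_mono M) simp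
      finally show "norm (W x \<bullet> grad \<Phi> x) \<le> norm (M * norm (indicator (cball 0 R) x *\<^sub>R W x))"
        using 0[of x] \<open>0 \<le> M\<close> by (cases "x \<in> cball 0 R") (simp_all add: mult.commute)
    qed
  qed measurable
qed

lemma T_add_scale:
  assumes "\<Phi> \<in> C1c" "\<Psi> \<in> C1c"
  shows "T (\<lambda>x. a * \<Phi> x + b * \<Psi> x) = a * T \<Phi> + b * T \<Psi>"
proof -
  note I = integrable_G_mult[OF assms(1)] integrable_G_mult[OF assms(2)]
    integrable_W_grad[OF assms(1)] integrable_W_grad[OF assms(2)]
  have 1: "(\<lambda>x. G x * (a * \<Phi> x + b * \<Psi> x)) = (\<lambda>x. a * (G x * \<Phi> x) + b * (G x * \<Psi> x))"
    by (intro ext) (simp add: algebra_simps)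
  have 2: "(\<lambda>x. W x \<bullet> (a *\<^sub>R grad \<Phi> x + b *\<^sub>R grad \<Psi> x)) =
      (\<lambda>x. a * (W x \<bullet> grad \<Phi> x) + b * (W x \<bullet> grad \<Psi> x))"
    by (intro ext) (simp add: inner_add_right)
  show ?thesis
    unfolding T_def grad_add_scale[OF assms] 1 2 using I by (simp add: algebra_simps)
qed

lemma height_cutoff_C1c:
  assumes "\<Phi> \<in> C1c" "0 < s"
  shows "(\<lambda>x. \<Phi> x * height_cutoff s x) \<in> C1c"
    and "grad (\<lambda>x. \<Phi> x * height_cutoff s x) x
      = height_cutoff s x *\<^sub>R grad \<Phi> x + \<Phi> x *\<^sub>R (0, height_cutoff_deriv s x)"
  by (rule C1c_mult[OF assms(1) height_cutoff_has_derivative[OF assms(2)] continuous_height_cutoff_deriv])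
    (rule grad_mult[OF assms(1) height_cutoff_has_derivative[OF assms(2)]])

lemma T_height_cutoff:
  assumes \<Phi>: "\<Phi> \<in> C1c" and \<delta>': "ereal \<delta>' < \<delta>" "\<And>x. \<delta>' \<le> snd x \<Longrightarrow> \<Phi> x = 0" and s: "0 < s"
  shows "T (\<lambda>x. \<Phi> x * height_cutoff s x) = T \<Phi>"
proof -
  note C = height_cutoff_C1c(1)[OF \<Phi> s]
  let ?\<Psi> = "\<lambda>x. 1 * \<Phi> x + (- 1) * (\<Phi> x * height_cutoff s x)"
  \<comment> \<open>The strict inequality between \<open>\<delta>'\<close> and
    \<open>\<delta>\<close> keeps this closed slab inside the open layer, so the divergence identity
    applies to the removed part.\<close>
  have "supp ?\<Psi> \<subseteq> {x. s / 2 \<le> snd x \<and> snd x \<le> \<delta>'}"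
  proof (rule supp_subset)
    show "closed {x :: (real ^ 'm) \<times> real. s / 2 \<le> snd x \<and> snd x \<le> \<delta>'}"
      by (intro closed_Collect_conj closed_Collect_le continuous_intros)
    fix x :: "(real ^ 'm) \<times> real" assume "x \<notin> {x. s / 2 \<le> snd x \<and> snd x \<le> \<delta>'}"
    then consider "snd x \<le> s / 2" | "\<delta>' \<le> snd x" by force
    then show "?\<Psi> x = 0"
      by cases (simp_all add: height_cutoff_eq_1[OF s] \<delta>'(2))
  qed
  also have "\<dots> \<subseteq> bnbhd halfspace \<delta>"
    using s \<delta>'(1) by (auto simp: bnbhd_halfspace intro: order.strict_trans1[of _ "ereal \<delta>'"])
  finally have "T ?\<Psi> = 0"
    unfolding T_def using C1c_add_scale[OF \<Phi> C] by (intro div_eq)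
  then show ?thesis unfolding T_add_scale[OF \<Phi> C] by simp
qed

text \<open>For \<open>z\<close> within \<open>s\<close> of the projection of \<open>x\<close>, the
  point \<open>(z, 0)\<close> is within \<open>2 * s\<close> of \<open>x\<close>, so the Lipschitz
  bound compares \<open>\<Phi> x\<close> with \<open>\<Phi> (z, 0)\<close> up to
  \<open>2 * M * s\<close>. Averaging over these \<open>z\<close> gives the claim.\<close>

lemma boundary_value_average:
  fixes \<Phi> :: "(real ^ 'm) \<times> real \<Rightarrow> real"
  assumes \<Phi>: "\<Phi> \<in> C1c" and M: "\<And>x. norm (grad \<Phi> x) \<le> M" and x: "0 < snd x" "snd x < s"
  shows "ennreal \<bar>\<Phi> x\<bar> \<le> ennreal (2 * M * s) + ennreal (1 / (s ^ CARD('m) * unit_ball_vol (real CARD('m)))) *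
    (\<integral>\<^sup>+z. indicator (cball (fst x) s) z * ennreal \<bar>\<Phi> (z, 0)\<bar> \<partial>lborel)"
proof -
  define c where "c = unit_ball_vol (real CARD('m))"
  define V where "V = s ^ CARD('m) * c"
  have s: "0 < s" using x by simp
  have V: "0 < V" using unit_ball_vol_pos[of "real CARD('m)"] s by (simp add: V_def c_def)
  have M0: "0 \<le> M" using M[of 0] norm_ge_zero order_trans by blast
  have eV: "emeasure lborel (cball (fst x) s) = ennreal V"
  proof -
    have "measure lborel (cball (fst x) s) = V"
      using s by (simp add: V_def c_def content_cball)
    then show ?thesis
      using emeasure_eq_ennreal_measure[of lborel "cball (fst x) s"] emeasure_lborel_cball_finite[of "fst x" s]
      by (simp add: less_top)
  qed
  have [measurable]: "(\<lambda>z. \<Phi> (z, 0)) \<in> borel_measurable borel"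
    by (rule C1c_boundary_borel[OF \<Phi>])
  have "ennreal \<bar>\<Phi> x\<bar> * ennreal V = (\<integral>\<^sup>+z. ennreal \<bar>\<Phi> x\<bar> * indicator (cball (fst x) s) z \<partial>lborel)"
    by (subst nn_integral_cmult_indicator) (auto simp: eV)
  also have "\<dots> \<le> (\<integral>\<^sup>+z. ennreal (2 * M * s) * indicator (cball (fst x) s) z +
      indicator (cball (fst x) s) z * ennreal \<bar>\<Phi> (z, 0)\<bar> \<partial>lborel)"
  proof (rule nn_integral_mono)
    fix z
    show "ennreal \<bar>\<Phi> x\<bar> * indicator (cball (fst x) s) z \<le> ennreal (2 * M * s) * indicator (cball (fst x) s) z +
        indicator (cball (fst x) s) z * ennreal \<bar>\<Phi> (z, 0)\<bar>"
    proof (cases "z \<in> cball (fst x) s")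
      case True
      have "norm (x - (z, 0)) \<le> dist (fst x) z + \<bar>snd x\<bar>"
        using norm_Pair_le[of "fst x - z" "snd x"] by (cases x) (simp add: dist_norm)
      also have "\<dots> \<le> 2 * s" using True x by simp
      finally have "M * norm (x - (z, 0)) \<le> M * (2 * s)" using M0 by (intro mult_left_mono)
      then have "\<bar>\<Phi> x\<bar> \<le> 2 * M * s + \<bar>\<Phi> (z, 0)\<bar>"
        using C1c_Lipschitz[OF \<Phi> M, of x "(z, 0)"] by linarith
      then have "ennreal \<bar>\<Phi> x\<bar> \<le> ennreal (2 * M * s) + ennreal \<bar>\<Phi> (z, 0)\<bar>"
        using M0 s by (simp flip: ennreal_plus add: ennreal_leI)
      then show ?thesis using True by simp
    qed simp
  qed
  also have "\<dots> = ennreal (2 * M * s) * ennreal V +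
      (\<integral>\<^sup>+z. indicator (cball (fst x) s) z * ennreal \<bar>\<Phi> (z, 0)\<bar> \<partial>lborel)"
  proof -
    have [measurable]: "cball (fst x) s \<in> sets borel" by simp
    show ?thesis
      by (subst nn_integral_add) (measurable, simp add: nn_integral_cmult_indicator eV)
  qed
  finally have "ennreal \<bar>\<Phi> x\<bar> * ennreal V * ennreal (1 / V) \<le> (ennreal (2 * M * s) * ennreal V +
      (\<integral>\<^sup>+z. indicator (cball (fst x) s) z * ennreal \<bar>\<Phi> (z, 0)\<bar> \<partial>lborel)) * ennreal (1 / V)"
    by (rule mult_right_mono) simp
  moreover have "ennreal V * ennreal (1 / V) = 1"
    using V by (simp flip: ennreal_mult)
  ultimately show ?thesis
    unfolding c_def[symmetric] V_def[symmetric]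
    by (simp add: distrib_right mult.assoc) (simp add: mult.commute)
qed

lemma T_bound:
  assumes \<Phi>: "\<Phi> \<in> C1c" and \<delta>': "ereal \<delta>' < \<delta>" "\<And>x. \<delta>' \<le> snd x \<Longrightarrow> \<Phi> x = 0"
  shows "ennreal \<bar>T \<Phi>\<bar> \<le> ennreal (trace_const CARD('m) * B) * (\<integral>\<^sup>+z. ennreal \<bar>\<Phi> (z, 0)\<bar> \<partial>lborel)"
proof -
  obtain R where 0: "\<And>x. x \<notin> cball 0 R \<Longrightarrow> \<Phi> x = 0" "\<And>x. x \<notin> cball 0 R \<Longrightarrow> grad \<Phi> x = 0"
    by (rule C1c_outside_cball[OF \<Phi>]) (rule that)
  obtain M where M0: "0 \<le> M" and M: "\<And>x. \<bar>\<Phi> x\<bar> \<le> M" "\<And>x. norm (grad \<Phi> x) \<le> M"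
    by (rule C1c_bounded[OF \<Phi>]) (rule that)
  \<comment> \<open>The factor is \<open>17 = 1 + 16\<close>: once \<open>M\<close> for the terms
    with \<open>G\<close> and the gradient of \<open>\<Phi>\<close>, and \<open>16 * M\<close> from
    the slope \<open>8 / s\<close> times the averaging error \<open>2 * M * s\<close>. Restriction
    to a ball containing the support makes \<open>h\<close> integrable.\<close>
  define h where "h x = 17 * M * (\<bar>indicator (cball 0 R) x * G x\<bar> + norm (indicator (cball 0 R) x *\<^sub>R W x))"
    for x
  have h: "integrable lebesgue h"
    unfolding h_def
    by (intro integrable_mult_right Bochner_Integration.integrable_add integrable_abs integrable_norm
        G_integrable W_integrable)
  have h_nonneg: "0 \<le> h x" for x using M0 by (simp add: h_def)
  define \<Phi>0 where "\<Phi>0 z = ennreal \<bar>\<Phi> (z, 0)\<bar>" for z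
  have [measurable]: "(\<lambda>z. \<Phi> (z, 0)) \<in> borel_measurable borel"
    by (rule C1c_boundary_borel[OF \<Phi>])
  have \<Phi>0 [measurable]: "\<Phi>0 \<in> borel_measurable borel" unfolding \<Phi>0_def by measurable
  note [measurable] = W_borel borel_measurable_integrable[OF h]
  have Wn [measurable]: "(\<lambda>x. ennreal \<bar>snd (W x)\<bar>) \<in> borel_measurable lebesgue"
  proof -
    have "(\<lambda>x. ennreal \<bar>W x \<bullet> (0, 1)\<bar>) \<in> borel_measurable lebesgue" by measurable
    then show ?thesis by (simp add: inner_prod_def)
  qed
  \<comment> \<open>The restriction on \<open>2 * s\<close> comes from the balls of twice the strip
    height in \<open>nn_integral_strip_average\<close>.\<close>
  have bound: "ennreal \<bar>T \<Phi>\<bar> \<le> (\<integral>\<^sup>+x. ennreal (indicator {x. 0 < snd x \<and> snd x < s} x * h x) \<partial>lebesgue)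
      + ennreal (trace_const CARD('m) * B) * (\<integral>\<^sup>+z. \<Phi>0 z \<partial>lborel)" if s: "0 < s" "ereal (2 * s) < \<nu>" for s
  proof -
    define S where "S = {x :: (real ^ 'm) \<times> real. 0 < snd x \<and> snd x < s}"
    have "S = snd -` {0<..<s}" by (auto simp: S_def)
    then have "S \<in> sets lborel" by (simp add: open_vimage_snd)
    then have [measurable]: "S \<in> sets lebesgue" by (rule sets_completionI_sets)
    define V where "V = s ^ CARD('m) * unit_ball_vol (real CARD('m))"
    have V: "0 < V" using unit_ball_vol_pos[of "real CARD('m)"] s by (simp add: V_def)
    define A where "A x = (\<integral>\<^sup>+z. indicator (cball (fst x) s) z * \<Phi>0 z \<partial>lborel)" for x :: "(real ^ 'm) \<times> real"
    let ?\<Psi> = "\<lambda>x. \<Phi> x * height_cutoff s x"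
    note C = height_cutoff_C1c(1)[OF \<Phi> s(1)]
    let ?F = "\<lambda>x. G x * ?\<Psi> x + W x \<bullet> grad ?\<Psi> x"
    have IF: "integrable lebesgue ?F"
      by (intro Bochner_Integration.integrable_add integrable_G_mult integrable_W_grad C)
    have "T \<Phi> = (LINT x|lebesgue. ?F x)"
      using T_height_cutoff[OF \<Phi> \<delta>' s(1)] integrable_G_mult[OF C] integrable_W_grad[OF C]
      by (simp add: T_def)
    then have "ennreal \<bar>T \<Phi>\<bar> \<le> (\<integral>\<^sup>+x. ennreal \<bar>?F x\<bar> \<partial>lebesgue)"
      using integral_norm_bound_ennreal[OF IF] by simp
    also have "\<dots> \<le> (\<integral>\<^sup>+x. ennreal (indicator S x * h x) +
        ennreal (8 / s * (1 / V)) * (indicator S x * ennreal \<bar>snd (W x)\<bar> * A x) \<partial>lebesgue)"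
    proof (rule nn_integral_mono)
      fix x :: "(real ^ 'm) \<times> real"
      show "ennreal \<bar>?F x\<bar> \<le> ennreal (indicator S x * h x) +
        ennreal (8 / s * (1 / V)) * (indicator S x * ennreal \<bar>snd (W x)\<bar> * A x)"
      proof (cases "x \<in> S \<and> x \<in> cball 0 R")
        case False
        \<comment> \<open>Below the boundary the fields vanish, from height \<open>s\<close> on the
          cutoff and its derivative, and outside the ball \<open>\<Phi>\<close> and its
          gradient.\<close>
        then consider "snd x \<le> 0" | "s \<le> snd x" | "x \<notin> cball 0 R" by (force simp: S_def)
        then have "?F x = 0"
          unfolding height_cutoff_C1c(2)[OF \<Phi> s(1)]
          by cases (simp_all add: G_outside W_outside height_cutoff_eq_0 height_cutoff_deriv_eq_0 0 s
              zero_prod_def[symmetric] del: mem_cball)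
        then show ?thesis by simp
      next
        case True
        then have x: "0 < snd x" "snd x < s" "indicator (cball 0 R) x = (1::real)" "indicator S x = (1::real)"
          "indicator S x = (1::ennreal)"
          by (auto simp: S_def)
        let ?c = "height_cutoff s x" and ?d = "height_cutoff_deriv s x"
        have "\<bar>G x * ?\<Psi> x\<bar> \<le> M * \<bar>G x\<bar>"
        proof -
          have "\<bar>\<Phi> x * ?c\<bar> \<le> M * 1"
            unfolding abs_mult by (intro mult_mono M height_cutoff_bound) (auto simp: M0)
          from mult_left_mono[OF this, of "\<bar>G x\<bar>"] show ?thesis by (simp add: abs_mult mult.commute)
        qed
        moreover have "\<bar>W x \<bullet> (?c *\<^sub>R grad \<Phi> x)\<bar> \<le> M * norm (W x)"
        proof -
          have "norm (?c *\<^sub>R grad \<Phi> x) \<le> 1 * M"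
            unfolding norm_scaleR by (intro mult_mono M height_cutoff_bound) auto
          then have "norm (W x) * norm (?c *\<^sub>R grad \<Phi> x) \<le> norm (W x) * M"
            by (intro mult_left_mono) auto
          then show ?thesis
            using Cauchy_Schwarz_ineq2[of "W x" "?c *\<^sub>R grad \<Phi> x"] by (simp add: mult.commute)
        qed
        \<comment> \<open>The cutoff depends on the height alone, so its derivative meets only the
          normal component of \<open>W\<close>; this is the single term that does not disappear with
          \<open>s\<close>.\<close>
        moreover have "\<bar>W x \<bullet> (\<Phi> x *\<^sub>R (0, ?d))\<bar> \<le> (8 / s * \<bar>snd (W x)\<bar>) * \<bar>\<Phi> x\<bar>"
        proof -
          have "\<bar>?d\<bar> * (\<bar>snd (W x)\<bar> * \<bar>\<Phi> x\<bar>) \<le> 8 / s * (\<bar>snd (W x)\<bar> * \<bar>\<Phi> x\<bar>)"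
            by (intro mult_right_mono height_cutoff_deriv_bound s) auto
          then show ?thesis by (simp add: inner_prod_def abs_mult mult_ac)
        qed
        ultimately have "\<bar>?F x\<bar> \<le> M * (\<bar>G x\<bar> + norm (W x)) + (8 / s * \<bar>snd (W x)\<bar>) * \<bar>\<Phi> x\<bar>"
          unfolding height_cutoff_C1c(2)[OF \<Phi> s(1)] inner_add_right distrib_left by linarith
        then have "ennreal \<bar>?F x\<bar> \<le> ennreal (M * (\<bar>G x\<bar> + norm (W x))) + ennreal (8 / s * \<bar>snd (W x)\<bar>) * ennreal \<bar>\<Phi> x\<bar>"
          using M0 s by (simp add: ennreal_leI flip: ennreal_plus ennreal_mult)
        also have "\<dots> \<le> ennreal (M * (\<bar>G x\<bar> + norm (W x))) + ennreal (8 / s * \<bar>snd (W x)\<bar>) *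
            (ennreal (2 * M * s) + ennreal (1 / V) * A x)"
          unfolding A_def \<Phi>0_def V_def
          by (intro add_left_mono mult_left_mono boundary_value_average \<Phi> M x) simp
        also have "\<dots> = ennreal (M * (\<bar>G x\<bar> + norm (W x)) + 8 / s * \<bar>snd (W x)\<bar> * (2 * M * s))
            + ennreal (8 / s * (1 / V)) * (ennreal \<bar>snd (W x)\<bar> * A x)"
        proof -
          have eq: "ennreal p + ennreal (q * w) * (ennreal r + ennreal u * a) =
              ennreal (p + q * w * r) + ennreal (q * u) * (ennreal w * a)"
            if "0 \<le> p" "0 \<le> q" "0 \<le> w" "0 \<le> r" "0 \<le> u" for p q w r u a
            using that by (simp add: distrib_left ennreal_plus ennreal_mult mult_ac add_ac)
          show ?thesis by (rule eq) (use M0 s V in simp_all)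
        qed
        also have "\<dots> \<le> ennreal (h x) + ennreal (8 / s * (1 / V)) * (ennreal \<bar>snd (W x)\<bar> * A x)"
        proof (intro add_right_mono ennreal_leI)
          have "8 / s * \<bar>snd (W x)\<bar> * (2 * M * s) = 16 * M * \<bar>snd (W x)\<bar>" using s by simp
          also have "\<dots> \<le> 16 * M * norm (W x)"
            using norm_snd_le[of "snd (W x)" "fst (W x)"] M0 by (intro mult_left_mono) auto
          also have "\<dots> \<le> 16 * M * (\<bar>G x\<bar> + norm (W x))" using M0 by (intro mult_left_mono) auto
          finally show "M * (\<bar>G x\<bar> + norm (W x)) + 8 / s * \<bar>snd (W x)\<bar> * (2 * M * s) \<le> h x"
            unfolding h_def x(3) by simp
        qed
        finally show ?thesis unfolding x(4,5) by simp
      qed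
    qed
    also have "\<dots> = (\<integral>\<^sup>+x. ennreal (indicator S x * h x) \<partial>lebesgue) +
        ennreal (8 / s * (1 / V)) * (\<integral>\<^sup>+x. indicator S x * ennreal \<bar>snd (W x)\<bar> * A x \<partial>lebesgue)"
    proof -
      \<comment> \<open>Measurability of \<open>A\<close>: it is a partial integral of a jointly
        Borel function, the relation between \<open>x\<close> and \<open>z\<close> being
        closed.\<close>
      have "closed {p :: ((real ^ 'm) \<times> real) \<times> (real ^ 'm). dist (fst (fst p)) (snd p) \<le> s}"
        by (intro closed_Collect_le continuous_intros)
      then have "{p :: ((real ^ 'm) \<times> real) \<times> (real ^ 'm). dist (fst (fst p)) (snd p) \<le> s} \<in> sets (lborel \<Otimes>\<^sub>M lborel)"
        unfolding lborel_prod sets_lborel by (rule borel_closed)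
      moreover have "\<Phi>0 \<in> borel_measurable lborel" by measurable
      ultimately have "(\<lambda>p. indicator {p. dist (fst (fst p)) (snd p) \<le> s} p * \<Phi>0 (snd p))
          \<in> borel_measurable ((lborel :: ((real ^ 'm) \<times> real) measure) \<Otimes>\<^sub>M lborel)"
        by (intro borel_measurable_times_ennreal borel_measurable_indicator measurable_compose[OF measurable_snd])
      from lborel.borel_measurable_nn_integral_fst[OF this]
      have "A \<in> borel_measurable lborel"
        unfolding A_def by (simp add: indicator_def)
      then have [measurable]: "A \<in> borel_measurable lebesgue"
        by (rule measurable_completion)
      have m1: "(\<lambda>x. ennreal (indicator S x * h x)) \<in> borel_measurable lebesgue" by measurable
      have m2: "(\<lambda>x. indicator S x * ennreal \<bar>snd (W x)\<bar> * A x) \<in> borel_measurable lebesgue" by measurable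
      show ?thesis
        by (simp add: nn_integral_add[OF m1 borel_measurable_times_ennreal[OF borel_measurable_const m2]]
            nn_integral_cmult[OF m2])
    qed
    also have "\<dots> \<le> (\<integral>\<^sup>+x. ennreal (indicator S x * h x) \<partial>lebesgue) +
        ennreal (8 / s * (1 / V)) * (ennreal (B * (2 * s) ^ (CARD('m) + 1)) * (\<integral>\<^sup>+z. \<Phi>0 z \<partial>lborel))"
      unfolding S_def A_def using s
      by (intro add_left_mono mult_left_mono nn_integral_strip_average Wn \<Phi>0 normal_bound) auto
    also have "ennreal (8 / s * (1 / V)) * (ennreal (B * (2 * s) ^ (CARD('m) + 1)) * (\<integral>\<^sup>+z. \<Phi>0 z \<partial>lborel))
        = ennreal (trace_const CARD('m) * B) * (\<integral>\<^sup>+z. \<Phi>0 z \<partial>lborel)"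
    proof -
      have "8 / s * (1 / V) * (B * (2 * s) ^ (CARD('m) + 1)) = trace_const CARD('m) * B"
        using s unit_ball_vol_pos[of "real CARD('m)"] by (simp add: V_def trace_const_def power_mult_distrib)
      then show ?thesis
        using s V B_nonneg by (simp only: mult.assoc[symmetric] ennreal_mult[symmetric]) (simp add: ennreal_mult[symmetric])
    qed
    finally show ?thesis unfolding S_def .
  qed
  \<comment> \<open>The estimate is used along \<open>s = 1 / (k + 1)\<close>, which is admissible
    for all large \<open>k\<close>.\<close>
  have "eventually (\<lambda>k. ereal (2 * inverse (real (Suc k))) < \<nu>) sequentially"
  proof -
    have "(\<lambda>k. ereal (2 * inverse (real (Suc k)))) \<longlonglongrightarrow> ereal (2 * 0)"
      by (intro tendsto_intros LIMSEQ_inverse_real_of_nat)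
    then show ?thesis using \<nu>_pos by (intro order_tendstoD(2)[where a = \<nu>]) (auto simp: zero_ereal_def)
  qed
  then have ev: "eventually (\<lambda>k. ennreal \<bar>T \<Phi>\<bar> \<le>
      (\<integral>\<^sup>+x. ennreal (indicator {x. 0 < snd x \<and> snd x < inverse (real (Suc k))} x * h x) \<partial>lebesgue)
      + ennreal (trace_const CARD('m) * B) * (\<integral>\<^sup>+z. \<Phi>0 z \<partial>lborel)) sequentially"
    by eventually_elim (rule bound, simp)
  have "(\<lambda>k. (\<integral>\<^sup>+x. ennreal (indicator {x. 0 < snd x \<and> snd x < inverse (real (Suc k))} x * h x) \<partial>lebesgue)
      + ennreal (trace_const CARD('m) * B) * (\<integral>\<^sup>+z. \<Phi>0 z \<partial>lborel)) \<longlonglongrightarrow> 0 + ennreal (trace_const CARD('m) * B) * (\<integral>\<^sup>+z. \<Phi>0 z \<partial>lborel)"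
    by (intro tendsto_add tendsto_const nn_integral_strip_tendsto_0 h h_nonneg)
  from tendsto_lowerbound[OF this ev] show ?thesis
    by (simp add: \<Phi>0_def)
qed

end

section \<open>Essential bounds from \<open>L\<^sup>1\<close> estimates\<close>

text \<open>Almost everywhere approximation by continuous functions comes from measurability;
  truncation to \<open>[-1, 1]\<close>, multiplication by a cutoff and mollification with error
  \<open>1 / (n + 1)\<close> keep the limit. The common bound and the common ball provide the
  majorant for dominated convergence.\<close>

lemma bounded_approx_C1c:
  fixes s :: "'a::euclidean_space \<Rightarrow> real"
  assumes s: "s \<in> borel_measurable lebesgue" "\<And>x. \<bar>s x\<bar> \<le> 1" "\<And>x. R < norm x \<Longrightarrow> s x = 0"
  obtains \<psi> where "\<And>n::nat. \<psi> n \<in> C1c" "\<And>n x. \<bar>\<psi> n x\<bar> \<le> 2 * indicator (cball 0 (R + 2)) x"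
    "AE x in lebesgue. (\<lambda>n. \<psi> n x) \<longlonglongrightarrow> s x"
proof -
  have "s measurable_on UNIV"
    using s(1) by (intro lebesgue_measurable_imp_measurable_on_real) auto
  then obtain N g where N: "negligible N" and g: "\<And>n. continuous_on UNIV (g n)"
    and lim: "\<And>x. x \<notin> N \<Longrightarrow> (\<lambda>n. g n x) \<longlonglongrightarrow> s x"
    unfolding measurable_on_def by auto
  \<comment> \<open>Equal to \<open>1\<close> on the ball of radius \<open>R\<close>, where
    \<open>s\<close> may be nonzero, and to \<open>0\<close> outside radius
    \<open>R + 1\<close>.\<close>
  define \<eta> where "\<eta> x = max 0 (min 1 (R + 1 - norm x))" for x :: 'a
  define g' where "g' n x = max (- 1) (min 1 (g n x)) * \<eta> x" for n x
  have \<eta>: "0 \<le> \<eta> x" "\<eta> x \<le> 1" for x by (auto simp: \<eta>_def)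
  have g'_bound: "\<bar>g' n x\<bar> \<le> 1" for n x
    using mult_mono[of "\<bar>max (- 1) (min 1 (g n x))\<bar>" 1 "\<bar>\<eta> x\<bar>" 1] \<eta>[of x]
    by (simp add: g'_def abs_mult)
  have g'_cont: "continuous_on UNIV (g' n)" for n
    unfolding g'_def \<eta>_def by (intro continuous_intros g)
  have g'_0: "g' n x = 0" if "R + 1 < norm x" for n x
    using that by (simp add: g'_def \<eta>_def)
  have g'_lim: "(\<lambda>n. g' n x) \<longlonglongrightarrow> s x" if "x \<notin> N" for x
  proof -
    have "(\<lambda>n. g' n x) \<longlonglongrightarrow> max (- 1) (min 1 (s x)) * \<eta> x"
      unfolding g'_def by (intro tendsto_intros lim that)
    also have "max (- 1) (min 1 (s x)) * \<eta> x = s x"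
    proof (cases "R < norm x")
      case True then show ?thesis using s(3) by simp
    next
      case False then show ?thesis using s(2)[of x] by (simp add: \<eta>_def)
    qed
    finally show ?thesis .
  qed
  have "\<forall>n. \<exists>\<psi>. \<psi> \<in> C1c \<and> (\<forall>x. R + 2 < norm x \<longrightarrow> \<psi> x = 0) \<and> (\<forall>x. \<bar>\<psi> x - g' n x\<bar> \<le> inverse (real (Suc n)))"
  proof
    fix n
    obtain \<psi> where "\<psi> \<in> C1c" "\<And>x. R + 1 + 1 < norm x \<Longrightarrow> \<psi> x = 0" "\<And>x. \<bar>\<psi> x - g' n x\<bar> \<le> inverse (real (Suc n))"
      by (rule continuous_approx_C1c[OF g'_cont[of n] g'_0]) (auto intro: that)
    then show "\<exists>\<psi>. \<psi> \<in> C1c \<and> (\<forall>x. R + 2 < norm x \<longrightarrow> \<psi> x = 0) \<and> (\<forall>x. \<bar>\<psi> x - g' n x\<bar> \<le> inverse (real (Suc n)))"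
      by (intro exI[of _ \<psi>]) (simp add: add.assoc)
  qed
  from choice[OF this] obtain \<psi> where \<psi>: "\<And>n. \<psi> n \<in> C1c" "\<And>n x. R + 2 < norm x \<Longrightarrow> \<psi> n x = 0"
    "\<And>n x. \<bar>\<psi> n x - g' n x\<bar> \<le> inverse (real (Suc n))"
    by blast
  show ?thesis
  proof (rule that[of \<psi>])
    show "\<psi> n \<in> C1c" for n by (rule \<psi>(1))
    show "\<bar>\<psi> n x\<bar> \<le> 2 * indicator (cball 0 (R + 2)) x" for n x
    proof (cases "R + 2 < norm x")
      case False
      have "inverse (real (Suc n)) \<le> 1" by (simp add: field_simps)
      then have "\<bar>\<psi> n x\<bar> \<le> 2" using \<psi>(3)[of n x] g'_bound[of n x] by linarith
      then show ?thesis using False by simp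
    qed (simp add: \<psi>(2))
    have "(\<lambda>n. \<psi> n x) \<longlonglongrightarrow> s x" if "x \<notin> N" for x
    proof -
      have "(\<lambda>n. \<psi> n x - g' n x) \<longlonglongrightarrow> 0"
        by (rule tendsto_rabs_zero_cancel, rule tendsto_sandwich[OF _ _ tendsto_const LIMSEQ_inverse_real_of_nat])
          (simp_all add: \<psi>(3) eventually_sequentially del: of_nat_Suc)
      from tendsto_add[OF this g'_lim[OF that]] show ?thesis by simp
    qed
    moreover have "AE x in lebesgue. x \<notin> N"
      using N by (intro AE_not_in) (simp add: negligible_iff_null_sets)
    ultimately show "AE x in lebesgue. (\<lambda>n. \<psi> n x) \<longlonglongrightarrow> s x"
      by (auto elim: eventually_mono)
  qed
qed

text \<open>The ideal test function is the sign of \<open>w\<close> on the part of a ball where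
  \<open>\<bar>w\<bar>\<close> exceeds \<open>c\<close>. Approximating it by \<open>C1c\<close>
  functions preserves the estimate, which then says that a nonnegative function has integral at most
  zero.\<close>

lemma AE_bound_of_L1_estimate:
  fixes w :: "'a::euclidean_space \<Rightarrow> real"
  assumes w: "w \<in> Lp_loc 1 UNIV"
    and est: "\<And>\<phi>. \<phi> \<in> C1c \<Longrightarrow> \<bar>LINT y|lebesgue. w y * \<phi> y\<bar> \<le> c * (LINT y|lebesgue. \<bar>\<phi> y\<bar>)"
  shows "AE y in lebesgue. \<bar>w y\<bar> \<le> c"
proof -
  have w_ball: "integrable lebesgue (\<lambda>x. indicator (cball 0 r) x * w x)" for r
    using w by (rule Lp_loc_1_integrable) auto
  have [measurable]: "w \<in> borel_measurable lebesgue"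
    using w by (simp add: Lp_loc_def set_borel_measurable_def)
  have "AE y in lebesgue. norm y \<le> real N \<longrightarrow> \<bar>w y\<bar> \<le> c" for N :: nat
  proof -
    define E where "E = {y. c < \<bar>w y\<bar> \<and> norm y \<le> real N}"
    have "E = (\<lambda>y. \<bar>w y\<bar>) -` {c<..} \<inter> space lebesgue \<inter> cball 0 (real N)"
      by (auto simp: E_def)
    moreover have "(\<lambda>y. \<bar>w y\<bar>) -` {c<..} \<inter> space lebesgue \<in> sets lebesgue"
      by (rule measurable_sets[where A = borel]) measurable
    moreover have "cball (0::'a) (real N) \<in> sets lebesgue" by simp
    ultimately have E [measurable]: "E \<in> sets lebesgue"
      by (simp only: sets.Int)
    define s where "s y = indicator E y * sgn (w y)" for y
    have [measurable]: "s \<in> borel_measurable lebesgue" unfolding s_def by measurable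
    have "\<bar>s y\<bar> \<le> 1" for y by (simp add: s_def indicator_def sgn_if)
    moreover have "s y = 0" if "real N < norm y" for y using that by (simp add: s_def E_def)
    ultimately obtain \<psi> where \<psi>: "\<And>n::nat. \<psi> n \<in> C1c"
      "\<And>n x. \<bar>\<psi> n x\<bar> \<le> 2 * indicator (cball 0 (real N + 2)) x"
      "AE x in lebesgue. (\<lambda>n. \<psi> n x) \<longlonglongrightarrow> s x"
      using bounded_approx_C1c[OF \<open>s \<in> borel_measurable lebesgue\<close>] by blast
    note [measurable] = C1c_borel(1)[OF \<psi>(1)]
    let ?K = "cball (0::'a) (real N + 2)"
    have lim_w: "(\<lambda>n. LINT y|lebesgue. w y * \<psi> n y) \<longlonglongrightarrow> (LINT y|lebesgue. w y * s y)"
    proof (rule integral_dominated_convergence[where w = "\<lambda>y. 2 * \<bar>indicator ?K y * w y\<bar>"])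
      show "integrable lebesgue (\<lambda>y. 2 * \<bar>indicator ?K y * w y\<bar>)"
        by (intro integrable_mult_right integrable_abs w_ball)
      show "AE y in lebesgue. (\<lambda>n. w y * \<psi> n y) \<longlonglongrightarrow> w y * s y"
        using \<psi>(3) by eventually_elim (intro tendsto_intros)
      show "AE y in lebesgue. norm (w y * \<psi> n y) \<le> 2 * \<bar>indicator ?K y * w y\<bar>" for n
        using mult_left_mono[OF \<psi>(2)[of n], of "\<bar>w _\<bar>"] by (intro AE_I2) (simp add: abs_mult mult_ac)
    qed measurable
    have "integrable lebesgue (indicator ?K :: 'a \<Rightarrow> real)"
      using emeasure_lborel_cball_finite[of "0::'a" "real N + 2"]
      by (intro integrable_real_indicator) simp_all
    then have K: "integrable lebesgue (\<lambda>y. 2 * indicator ?K y :: real)" by (rule integrable_mult_right)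
    have lim_s: "(\<lambda>n. LINT y|lebesgue. \<bar>\<psi> n y\<bar>) \<longlonglongrightarrow> (LINT y|lebesgue. \<bar>s y\<bar>)"
    proof (rule integral_dominated_convergence[OF _ _ K])
      show "AE y in lebesgue. (\<lambda>n. \<bar>\<psi> n y\<bar>) \<longlonglongrightarrow> \<bar>s y\<bar>"
        using \<psi>(3) by eventually_elim (intro tendsto_intros)
      show "AE y in lebesgue. norm \<bar>\<psi> n y\<bar> \<le> 2 * indicator ?K y" for n
        using \<psi>(2) by simp
    qed measurable
    have "(LINT y|lebesgue. w y * s y) \<le> c * (LINT y|lebesgue. \<bar>s y\<bar>)"
    proof (rule LIMSEQ_le[OF lim_w tendsto_mult_left[OF lim_s]])
      show "\<exists>k. \<forall>n\<ge>k. (LINT y|lebesgue. w y * \<psi> n y) \<le> c * (LINT y|lebesgue. \<bar>\<psi> n y\<bar>)"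
        using est[OF \<psi>(1)] abs_le_D1 by blast
    qed
    moreover have Is: "integrable lebesgue (\<lambda>y. \<bar>s y\<bar>)"
    proof (rule Bochner_Integration.integrable_bound[OF K])
      show "AE y in lebesgue. norm \<bar>s y\<bar> \<le> norm (2 * indicator ?K y :: real)"
        by (auto simp: s_def E_def indicator_def sgn_if)
    qed measurable
    moreover have Iw: "integrable lebesgue (\<lambda>y. w y * s y)"
    proof (rule Bochner_Integration.integrable_bound[OF w_ball[of "real N"]])
      show "AE y in lebesgue. norm (w y * s y) \<le> norm (indicator (cball 0 (real N)) y * w y)"
        by (auto simp: s_def E_def indicator_def sgn_if)
    qed measurable
    ultimately have le: "(LINT y|lebesgue. w y * s y - c * \<bar>s y\<bar>) \<le> 0"
      by simp
    \<comment> \<open>The expression is \<open>\<bar>w y\<bar> - c\<close> at points of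
      \<open>E\<close> with \<open>w y\<close> nonzero, and \<open>0\<close> elsewhere. For negative
      \<open>c\<close> the set \<open>E\<close> may contain zeros of \<open>w\<close>, hence the
      extra premise in the second claim.\<close>
    have nonneg: "0 \<le> w y * s y - c * \<bar>s y\<bar>" and pos: "y \<in> E \<Longrightarrow> w y \<noteq> 0 \<Longrightarrow> w y * s y - c * \<bar>s y\<bar> \<noteq> 0" for y
      by (auto simp: s_def E_def indicator_def sgn_if)
    have "(LINT y|lebesgue. w y * s y - c * \<bar>s y\<bar>) = 0"
      using le by (intro antisym Bochner_Integration.integral_nonneg nonneg)
    then have "AE y in lebesgue. w y * s y - c * \<bar>s y\<bar> = 0"
      using Is Iw nonneg by (subst (asm) integral_nonneg_eq_0_iff_AE) auto
    then have *: "AE y in lebesgue. y \<in> E \<longrightarrow> w y = 0"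
      by eventually_elim (use pos in blast)
    show ?thesis
    proof (cases "0 \<le> c")
      case True
      from * show ?thesis by eventually_elim (use True in \<open>auto simp: E_def not_le\<close>)
    next
      case False
      \<comment> \<open>A negative \<open>c\<close> contradicts the estimate for any test function
        of positive \<open>L^1\<close> norm, such as a bump.\<close>
      obtain \<phi> :: "'a \<Rightarrow> real" where "\<phi> \<in> C1c" "0 < (LINT y|lebesgue. \<bar>\<phi> y\<bar>)"
      proof (rule that[of "bump 1"])
        show "(bump 1 :: 'a \<Rightarrow> real) \<in> C1c"
          using compact_supp[OF compact_cball[of "0::'a" 1], of "bump 1"]
          by (simp add: C1c_def Ck_bump bump_eq_0 del: One_nat_def)
        have "(LINT y|lebesgue. \<bar>bump 1 (y::'a)\<bar>) = (LINT y|lborel. bump 1 (y::'a))"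
          using borel_measurable_integrable[OF integrable_bump[of 1, where 'a='a]]
          by (simp add: bump_nonneg integral_completion)
        then show "0 < (LINT y|lebesgue. \<bar>bump 1 (y::'a)\<bar>)"
          using integral_bump_pos[of 1, where 'a='a] by simp
      qed
      then have "c * (LINT y|lebesgue. \<bar>\<phi> y\<bar>) < 0" using False by (simp add: mult_neg_pos)
      then have False using est[OF \<open>\<phi> \<in> C1c\<close>] by linarith
      then show ?thesis ..
    qed
  qed
  then have "AE y in lebesgue. \<forall>N::nat. norm y \<le> real N \<longrightarrow> \<bar>w y\<bar> \<le> c"
    by (subst AE_all_countable) blast
  then show ?thesis
    by eventually_elim (use real_arch_simple in blast)
qed

section \<open>Riesz representation by minimization\<close>

lemma AM_GM_abs:
  fixes a b t :: real
  assumes "0 < t"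
  shows "\<bar>a * b\<bar> \<le> (t * a\<^sup>2 + b\<^sup>2 / t) / 2"
proof -
  have "0 \<le> (t * \<bar>a\<bar> - \<bar>b\<bar>)\<^sup>2" by simp
  then have "2 * t * \<bar>a * b\<bar> \<le> t\<^sup>2 * a\<^sup>2 + b\<^sup>2"
    by (simp add: power2_diff abs_mult power_mult_distrib)
  then show ?thesis using assms by (simp add: field_simps power2_eq_square)
qed

lemma integrable_mult_of_squares:
  fixes f h :: "'a \<Rightarrow> real"
  assumes [measurable]: "f \<in> borel_measurable M" "h \<in> borel_measurable M"
    and "integrable M (\<lambda>x. (f x)\<^sup>2)" "integrable M (\<lambda>x. (h x)\<^sup>2)"
  shows "integrable M (\<lambda>x. f x * h x)"
proof (rule Bochner_Integration.integrable_bound)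
  show "integrable M (\<lambda>x. (f x)\<^sup>2 + (h x)\<^sup>2)" using assms by simp
  have "\<bar>f x * h x\<bar> \<le> (f x)\<^sup>2 + (h x)\<^sup>2" for x
  proof -
    have "\<bar>f x * h x\<bar> \<le> ((f x)\<^sup>2 + (h x)\<^sup>2) / 2" using AM_GM_abs[of 1 "f x" "h x"] by simp
    also have "\<dots> \<le> (f x)\<^sup>2 + (h x)\<^sup>2" by simp
    finally show ?thesis .
  qed
  then show "AE x in M. norm (f x * h x) \<le> norm ((f x)\<^sup>2 + (h x)\<^sup>2)" by simp
qed measurable

text \<open>Finiteness of the weighted sum bounds the \<open>k\<close>-th step by a constant times
  \<open>2 ^ (- k)\<close>. Integrated over a measure space, such sums turn fast convergence in
  \<open>L^2\<close> into convergence almost everywhere.\<close>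

lemma convergent_of_geometric_steps:
  fixes a :: "nat \<Rightarrow> real"
  assumes "(\<Sum>k. ennreal (4 ^ k * (a (Suc k) - a k)\<^sup>2)) < \<infinity>"
  shows "convergent a"
proof -
  define r where "r = enn2real (\<Sum>k. ennreal (4 ^ k * (a (Suc k) - a k)\<^sup>2))"
  have r: "0 \<le> r" "(\<Sum>k. ennreal (4 ^ k * (a (Suc k) - a k)\<^sup>2)) = ennreal r"
    unfolding r_def using assms by (simp_all only: enn2real_nonneg ennreal_enn2real infinity_ennreal_def)
  have step: "norm (a (Suc k) - a k) \<le> sqrt r * (1 / 2) ^ k" for k
  proof -
    have "ennreal (4 ^ k * (a (Suc k) - a k)\<^sup>2) \<le> ennreal r"
      using sum_le_suminf[of "\<lambda>k. ennreal (4 ^ k * (a (Suc k) - a k)\<^sup>2)" "{k}"] r(2) by simp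
    then have "4 ^ k * (a (Suc k) - a k)\<^sup>2 \<le> r" using r(1) by simp
    moreover have "4 ^ k = ((2::real) ^ k)\<^sup>2" by (simp add: power2_eq_square flip: power_mult_distrib)
    ultimately have "(2 ^ k * (a (Suc k) - a k))\<^sup>2 \<le> r" by (simp add: power_mult_distrib)
    then have "\<bar>2 ^ k * (a (Suc k) - a k)\<bar> \<le> sqrt r" by (metis real_sqrt_abs real_sqrt_le_iff)
    then have "2 ^ k * \<bar>a (Suc k) - a k\<bar> \<le> sqrt r" unfolding abs_mult by simp
    then show ?thesis by (simp add: power_one_over field_simps)
  qed
  have "summable (\<lambda>k. sqrt r * (1 / 2) ^ k)"
    by (intro summable_mult summable_geometric) simp
  then have "summable (\<lambda>k. a (Suc k) - a k)"
    by (rule summable_comparison_test'[where N = 0]) (rule step)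
  then have "convergent (\<lambda>n. \<Sum>k<n. a (Suc k) - a k)"
    by (simp add: summable_iff_convergent)
  then have "convergent (\<lambda>n. a n - a 0)" by (simp add: sum_lessThan_telescope)
  then show ?thesis by (simp add: convergent_diff_const_right_iff)
qed

text \<open>The space \<open>S\<close> need not be complete. A minimizing sequence of the quadratic
  functional is Cauchy by the parallelogram identity, its limit is formed in \<open>L^2\<close> and
  may leave \<open>S\<close>, and the Euler equation holds approximately along the sequence and
  exactly in the limit.\<close>

lemma riesz_L2:
  fixes M :: "'a measure" and S :: "('a \<Rightarrow> real) set" and U :: "('a \<Rightarrow> real) \<Rightarrow> real"
  assumes ne: "S \<noteq> {}"
    and S_lin: "\<And>a b \<phi> \<psi>. \<phi> \<in> S \<Longrightarrow> \<psi> \<in> S \<Longrightarrow> (\<lambda>x. a * \<phi> x + b * \<psi> x) \<in> S"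
    and U_lin: "\<And>a b \<phi> \<psi>. \<phi> \<in> S \<Longrightarrow> \<psi> \<in> S \<Longrightarrow> U (\<lambda>x. a * \<phi> x + b * \<psi> x) = a * U \<phi> + b * U \<psi>"
    and meas: "\<And>\<phi>. \<phi> \<in> S \<Longrightarrow> \<phi> \<in> borel_measurable M"
    and sq: "\<And>\<phi>. \<phi> \<in> S \<Longrightarrow> integrable M (\<lambda>x. (\<phi> x)\<^sup>2)"
    and lower: "\<And>\<phi>. \<phi> \<in> S \<Longrightarrow> c \<le> (LINT x|M. (\<phi> x)\<^sup>2) / 2 - U \<phi>"
  shows "\<exists>u\<in>borel_measurable M. integrable M (\<lambda>x. (u x)\<^sup>2) \<and> (\<forall>\<phi>\<in>S. U \<phi> = (LINT x|M. u x * \<phi> x))"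
proof -
  define Q where "Q \<phi> = (LINT x|M. (\<phi> x)\<^sup>2)" for \<phi> :: "'a \<Rightarrow> real"
  define J where "J \<phi> = Q \<phi> / 2 - U \<phi>" for \<phi>
  define j where "j = Inf (J ` S)"
  have bdd: "bdd_below (J ` S)"
    using lower by (intro bdd_belowI[of _ c]) (auto simp: J_def Q_def)
  have j: "j \<le> J \<phi>" if "\<phi> \<in> S" for \<phi>
    unfolding j_def using that by (intro cInf_lower bdd) auto
  have prod: "integrable M (\<lambda>x. \<phi> x * \<psi> x)" if "\<phi> \<in> S" "\<psi> \<in> S" for \<phi> \<psi>
    by (intro integrable_mult_of_squares meas sq that)
  have Q_lin: "Q (\<lambda>x. a * \<phi> x + b * \<psi> x) = a\<^sup>2 * Q \<phi> + 2 * a * b * (LINT x|M. \<phi> x * \<psi> x) + b\<^sup>2 * Q \<psi>"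
    if "\<phi> \<in> S" "\<psi> \<in> S" for a b \<phi> \<psi>
  proof -
    have "(a * \<phi> x + b * \<psi> x)\<^sup>2 = a\<^sup>2 * (\<phi> x)\<^sup>2 + (2 * a * b) * (\<phi> x * \<psi> x) + b\<^sup>2 * (\<psi> x)\<^sup>2" for x
      by (simp add: power2_eq_square algebra_simps)
    then show ?thesis unfolding Q_def using prod[OF that] sq[OF that(1)] sq[OF that(2)] by simp
  qed
  \<comment> \<open>With \<open>16 ^ (- k)\<close> the squared steps stay summable after
    multiplication by \<open>4 ^ k\<close>; it is also the fourth power of the step
    \<open>2 ^ (- k)\<close> used for the variation below.\<close>
  define e where "e k = (1 / 16 :: real) ^ k" for k :: nat
  have e: "0 < e k" for k by (simp add: e_def)
  have e_anti: "e l \<le> e k" if "k \<le> l" for k l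
    unfolding e_def using that by (intro power_decreasing) auto
  have "\<exists>\<phi>\<in>S. J \<phi> < j + e k" for k
    using cInf_lessD[of "J ` S" "j + e k"] ne e[of k] by (auto simp: j_def)
  then obtain u where uS: "\<And>k. u k \<in> S" and uJ: "\<And>k. J (u k) < j + e k"
    by metis
  note [measurable] = meas[OF uS]
  have steps: "integrable M (\<lambda>x. (u l x - u k x)\<^sup>2)" "(LINT x|M. (u l x - u k x)\<^sup>2) \<le> 8 * e k"
    if kl: "k \<le> l" for k l
  proof -
    have D: "(\<lambda>x. u l x - u k x) = (\<lambda>x. 1 * u l x + (- 1) * u k x)" by simp
    show "integrable M (\<lambda>x. (u l x - u k x)\<^sup>2)"
      using sq[OF S_lin[OF uS uS], of 1 l "- 1" k] by simp
    have "j \<le> J (\<lambda>x. (1/2) * u l x + (1/2) * u k x)" by (intro j S_lin uS)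
    \<comment> \<open>Parallelogram identity; the linear parts cancel. The midpoint value is at
      least \<open>j\<close>, so two almost minimal values force the points to be close.\<close>
    moreover have "Q (\<lambda>x. 1 * u l x + (- 1) * u k x) / 8
        = J (u l) / 2 + J (u k) / 2 - J (\<lambda>x. (1/2) * u l x + (1/2) * u k x)"
      unfolding J_def Q_lin[OF uS uS] U_lin[OF uS uS] by (simp add: field_simps power2_eq_square)
    ultimately have "Q (\<lambda>x. 1 * u l x + (- 1) * u k x) \<le> 8 * e k"
      using uJ[of l] uJ[of k] e_anti[OF kl] by linarith
    then show "(LINT x|M. (u l x - u k x)\<^sup>2) \<le> 8 * e k" by (simp add: Q_def)
  qed
  have nn_steps: "(\<integral>\<^sup>+x. ennreal ((u l x - u k x)\<^sup>2) \<partial>M) \<le> ennreal (8 * e k)" if "k \<le> l" for k l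
    using nn_integral_eq_integral[OF steps(1)[OF that]] steps(2)[OF that] by (simp add: ennreal_leI)
  have "(\<integral>\<^sup>+x. (\<Sum>k. ennreal (4 ^ k * (u (Suc k) x - u k x)\<^sup>2)) \<partial>M)
      = (\<Sum>k. \<integral>\<^sup>+x. ennreal (4 ^ k * (u (Suc k) x - u k x)\<^sup>2) \<partial>M)"
    by (rule nn_integral_suminf) measurable
  also have "\<dots> \<le> (\<Sum>k. ennreal (8 * (1 / 4) ^ k))"
  proof (rule suminf_le)
    fix k
    have "(\<integral>\<^sup>+x. ennreal (4 ^ k * (u (Suc k) x - u k x)\<^sup>2) \<partial>M)
        = ennreal (4 ^ k) * (\<integral>\<^sup>+x. ennreal ((u (Suc k) x - u k x)\<^sup>2) \<partial>M)"
      by (subst nn_integral_cmult[symmetric]) (auto simp: ennreal_mult)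
    also have "\<dots> \<le> ennreal (4 ^ k) * ennreal (8 * e k)"
      by (intro mult_left_mono nn_steps) auto
    also have "\<dots> = ennreal (8 * (1 / 4) ^ k)"
    proof -
      have "4 ^ k * (8 * e k) = 8 * (4 * (1 / 16)) ^ k"
        unfolding e_def power_mult_distrib by simp
      then show ?thesis using e[of k] by (simp flip: ennreal_mult)
    qed
    finally show "(\<integral>\<^sup>+x. ennreal (4 ^ k * (u (Suc k) x - u k x)\<^sup>2) \<partial>M) \<le> ennreal (8 * (1 / 4) ^ k)" .
  qed auto
  also have "\<dots> = ennreal (\<Sum>k. 8 * (1 / 4) ^ k)"
    by (intro suminf_ennreal2 summable_mult summable_geometric) auto
  also have "\<dots> < \<infinity>" by simp
  finally have fin: "(\<integral>\<^sup>+x. (\<Sum>k. ennreal (4 ^ k * (u (Suc k) x - u k x)\<^sup>2)) \<partial>M) < \<infinity>" .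
  have "AE x in M. (\<Sum>k. ennreal (4 ^ k * (u (Suc k) x - u k x)\<^sup>2)) \<noteq> \<infinity>"
    by (rule nn_integral_PInf_AE) (measurable, use fin in simp)
  then have conv: "AE x in M. (\<lambda>k. u k x) \<longlonglongrightarrow> lim (\<lambda>k. u k x)"
    by eventually_elim (simp add: convergent_of_geometric_steps less_top flip: convergent_LIMSEQ_iff)
  define w where "w x = lim (\<lambda>k. u k x)" for x
  have [measurable]: "w \<in> borel_measurable M"
    unfolding w_def by (rule borel_measurable_lim_metric) measurable
  have nn_w: "(\<integral>\<^sup>+x. ennreal ((w x - u k x)\<^sup>2) \<partial>M) \<le> ennreal (8 * e k)" for k
  proof -
    have "(\<integral>\<^sup>+x. ennreal ((w x - u k x)\<^sup>2) \<partial>M) = (\<integral>\<^sup>+x. liminf (\<lambda>l. ennreal ((u l x - u k x)\<^sup>2)) \<partial>M)"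
    proof (rule nn_integral_cong_AE)
      show "AE x in M. ennreal ((w x - u k x)\<^sup>2) = liminf (\<lambda>l. ennreal ((u l x - u k x)\<^sup>2))"
        using conv
      proof eventually_elim
        case (elim x)
        then have "(\<lambda>l. ennreal ((u l x - u k x)\<^sup>2)) \<longlonglongrightarrow> ennreal ((w x - u k x)\<^sup>2)"
          unfolding w_def by (intro tendsto_ennrealI tendsto_intros)
        then show ?case
          using lim_imp_Liminf[OF sequentially_bot] by metis
      qed
    qed
    \<comment> \<open>Fatou's lemma lets \<open>l\<close> tend to infinity in the Cauchy
      estimate.\<close>
    also have "\<dots> \<le> liminf (\<lambda>l. \<integral>\<^sup>+x. ennreal ((u l x - u k x)\<^sup>2) \<partial>M)"
      by (rule nn_integral_liminf) measurable
    also have "\<dots> \<le> limsup (\<lambda>l. \<integral>\<^sup>+x. ennreal ((u l x - u k x)\<^sup>2) \<partial>M)"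
      by (rule Liminf_le_Limsup) simp
    also have "\<dots> \<le> ennreal (8 * e k)"
      by (rule Limsup_bounded) (use nn_steps in \<open>auto simp: eventually_sequentially\<close>)
    finally show ?thesis .
  qed
  have w_int: "integrable M (\<lambda>x. (w x - u k x)\<^sup>2)" for k
    using order_le_less_trans[OF nn_w[of k] ennreal_less_top] by (intro integrableI_bounded) auto
  have w_le: "(LINT x|M. (w x - u k x)\<^sup>2) \<le> 8 * e k" for k
    using nn_w[of k] e[of k] unfolding nn_integral_eq_integral[OF w_int, simplified]
    by (simp add: nn_integral_eq_integral[OF w_int])
  have w_sq: "integrable M (\<lambda>x. (w x)\<^sup>2)"
  proof (rule Bochner_Integration.integrable_bound)
    show "integrable M (\<lambda>x. 2 * (w x - u 0 x)\<^sup>2 + 2 * (u 0 x)\<^sup>2)"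
      using w_int sq[OF uS] by simp
    have "(w x)\<^sup>2 \<le> 2 * (w x - u 0 x)\<^sup>2 + 2 * (u 0 x)\<^sup>2" for x
      using zero_le_power2[of "w x - 2 * u 0 x"] by (simp add: power2_eq_square algebra_simps)
    then show "AE x in M. norm ((w x)\<^sup>2) \<le> norm (2 * (w x - u 0 x)\<^sup>2 + 2 * (u 0 x)\<^sup>2)"
      by (simp add: order_trans[OF _ abs_ge_self])
  qed measurable
  have "U \<phi> = (LINT x|M. w x * \<phi> x)" if \<phi>: "\<phi> \<in> S" for \<phi>
  proof -
    note [measurable] = meas[OF \<phi>]
    have Q0: "0 \<le> Q \<phi>" by (simp add: Q_def)
    have bound: "\<bar>(LINT x|M. w x * \<phi> x) - U \<phi>\<bar> \<le> (5 + Q \<phi>) * (1 / 2) ^ k" for k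
    proof -
      \<comment> \<open>One parameter serves as variation step and as weight in the product
        estimate: since \<open>e k = t ^ 4\<close>, the quotient \<open>e k / t\<close> still tends
        to zero.\<close>
      define t where "t = (1 / 2 :: real) ^ k"
      have t: "0 < t" "t \<le> 1" by (simp_all add: t_def power_le_one)
      have "t ^ 4 = ((1 / 2) ^ 4) ^ k"
        unfolding t_def power_mult[symmetric] mult.commute[of k] ..
      then have "e k = t ^ 4" by (simp add: e_def power_divide)
      have ek: "e k / t \<le> t"
      proof -
        have "t ^ 4 \<le> t ^ 2" using t by (intro power_decreasing) auto
        then show ?thesis using t \<open>e k = t ^ 4\<close> by (simp add: field_simps power2_eq_square)
      qed
      let ?P = "LINT x|M. u k x * \<phi> x"
      have "J (\<lambda>x. 1 * u k x + r * \<phi> x) = J (u k) + r * (?P - U \<phi>) + r\<^sup>2 * Q \<phi> / 2" for r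
        unfolding J_def Q_lin[OF uS \<phi>] U_lin[OF uS \<phi>] by (simp add: field_simps)
      \<comment> \<open>Almost minimality of \<open>u k\<close> along the line in direction
        \<open>\<phi>\<close>; taking \<open>r = t\<close> and \<open>r = - t\<close> bounds the
        absolute value of the linear coefficient.\<close>
      then have var: "- e k \<le> r * (?P - U \<phi>) + r\<^sup>2 * Q \<phi> / 2" for r
        using j[OF S_lin[OF uS[of k] \<phi>, of 1 r]] uJ[of k] by simp
      have "t * \<bar>?P - U \<phi>\<bar> \<le> e k + t\<^sup>2 * Q \<phi> / 2"
        using var[of t] var[of "- t"] t by (simp add: abs_mult_pos' abs_le_iff algebra_simps flip: abs_mult_pos)
      then have 1: "\<bar>?P - U \<phi>\<bar> \<le> e k / t + t * Q \<phi> / 2"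
        using t by (simp add: field_simps power2_eq_square)
      have Iw: "integrable M (\<lambda>x. w x * \<phi> x)"
        by (intro integrable_mult_of_squares w_sq sq \<phi>) measurable
      have "(LINT x|M. w x * \<phi> x) - ?P = (LINT x|M. (w x - u k x) * \<phi> x)"
        unfolding left_diff_distrib using Iw prod[OF uS \<phi>] by simp
      also have "norm \<dots> \<le> (LINT x|M. norm ((w x - u k x) * \<phi> x))"
        by (rule integral_norm_bound)
      \<comment> \<open>The weight \<open>1 / t\<close> goes to the small factor
        \<open>w - u k\<close>, whose squared norm is at most \<open>8 * e k\<close>, so both
        resulting terms vanish in the limit.\<close>
      also have "\<dots> \<le> (LINT x|M. ((1 / t) * (w x - u k x)\<^sup>2 + (\<phi> x)\<^sup>2 / (1 / t)) / 2)"
      proof (rule integral_mono)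
        show "integrable M (\<lambda>x. norm ((w x - u k x) * \<phi> x))"
          by (intro integrable_norm integrable_mult_of_squares w_int sq \<phi>) measurable
        show "integrable M (\<lambda>x. ((1 / t) * (w x - u k x)\<^sup>2 + (\<phi> x)\<^sup>2 / (1 / t)) / 2)"
          using w_int sq[OF \<phi>] by simp
        show "norm ((w x - u k x) * \<phi> x) \<le> ((1 / t) * (w x - u k x)\<^sup>2 + (\<phi> x)\<^sup>2 / (1 / t)) / 2" for x
          using AM_GM_abs[of "1 / t" "w x - u k x" "\<phi> x"] t by simp
      qed
      also have "\<dots> = ((LINT x|M. (w x - u k x)\<^sup>2) / t + t * Q \<phi>) / 2"
        using w_int sq[OF \<phi>] by (simp add: Q_def mult.commute)
      also have "\<dots> \<le> (8 * e k / t + t * Q \<phi>) / 2"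
        using w_le[of k] t by (simp add: divide_right_mono)
      finally have 2: "\<bar>(LINT x|M. w x * \<phi> x) - ?P\<bar> \<le> 4 * (e k / t) + t * Q \<phi> / 2"
        by (simp add: field_simps)
      have "\<bar>(LINT x|M. w x * \<phi> x) - U \<phi>\<bar> \<le> 5 * (e k / t) + t * Q \<phi>"
        using 1 2 by linarith
      also have "\<dots> \<le> 5 * t + t * Q \<phi>" using ek by simp
      finally show ?thesis by (simp add: t_def algebra_simps)
    qed
    have "(\<lambda>k. (5 + Q \<phi>) * (1 / 2) ^ k) \<longlonglongrightarrow> (5 + Q \<phi>) * 0"
      by (intro tendsto_mult_left LIMSEQ_realpow_zero) auto
    then have "\<bar>(LINT x|M. w x * \<phi> x) - U \<phi>\<bar> \<le> (5 + Q \<phi>) * 0"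
      by (rule LIMSEQ_le_const) (use bound in blast)
    then show ?thesis by simp
  qed
  then show ?thesis using w_sq by (intro bexI[of _ w]) auto
qed

section \<open>From a weighted \<open>L^2\<close> space to functionals bounded in
  \<open>L^1\<close>\<close>

lemma C1c_integrable:
  fixes f :: "'a::euclidean_space \<Rightarrow> real"
  assumes "f \<in> C1c"
  shows "integrable lborel f"
  by (rule integrable_compact_support[OF C1c_continuous[OF assms] C1c_compact[OF assms]]) (rule not_supp)

lemma Lp_loc_1I:
  fixes f :: "'a::euclidean_space \<Rightarrow> real"
  assumes f: "f \<in> borel_measurable lebesgue"
    and int: "\<And>K. compact K \<Longrightarrow> integrable lebesgue (\<lambda>x. indicator K x * f x)"
  shows "f \<in> Lp_loc 1 UNIV"
proof -
  have "Lp_norm 1 K f < \<infinity>" if "compact K" for K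
  proof -
    have "(\<integral>\<^sup>+x\<in>K. ennreal (\<bar>f x\<bar> powr 1) \<partial>lebesgue) = (\<integral>\<^sup>+x. ennreal (norm (indicator K x * f x)) \<partial>lebesgue)"
      by (intro nn_integral_cong) (auto simp: indicator_def)
    also have "\<dots> < \<infinity>" using int[OF that] by (simp add: integrable_iff_bounded)
    finally show ?thesis by (auto simp: Lp_norm_def enn_powr_def)
  qed
  then show ?thesis using f by (simp add: Lp_loc_def set_borel_measurable_def)
qed

text \<open>Since \<open>1 / q\<close> is integrable, \<open>L\<^sup>2\<close> with weight \<open>q\<close> embeds into \<open>L\<^sup>1\<close>.\<close>

lemma ex_weight:
  obtains q :: "'a::euclidean_space \<Rightarrow> real" where "q \<in> borel_measurable borel" "\<And>x. 0 < q x"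
    "integrable lborel (\<lambda>x. 1 / q x)" "\<And>R. \<exists>C. \<forall>x\<in>cball 0 R. q x \<le> C"
proof -
  define V where "V k = measure lborel (cball (0::'a) (real k))" for k
  \<comment> \<open>The ball of radius \<open>k\<close> has volume \<open>V k\<close>, so its
    contribution with factor \<open>1 / c k\<close> is at most \<open>2 ^ (- k)\<close>; the
    \<open>1\<close> keeps \<open>c k\<close> positive when \<open>V k = 0\<close>.\<close>
  define c where "c k = 2 ^ k * (1 + V k)" for k
  define q where "q x = c (nat \<lceil>norm x\<rceil>)" for x :: 'a
  have V: "0 \<le> V k" for k by (simp add: V_def)
  have V_mono: "V k \<le> V l" if "k \<le> l" for k l
    unfolding V_def using that emeasure_lborel_cball_finite[of "0::'a" "real l"]
    by (intro measure_mono_fmeasurable fmeasurableI) auto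
  have c_pos: "0 < c k" for k using V[of k] by (simp add: c_def add_pos_nonneg)
  have c_mono: "c k \<le> c l" if "k \<le> l" for k l
    unfolding c_def using that V[of k] V_mono[OF that] by (intro mult_mono power_increasing) auto
  have N: "(\<lambda>x::'a. nat \<lceil>norm x\<rceil>) \<in> measurable borel (count_space UNIV)" by measurable
  have q [measurable]: "q \<in> borel_measurable borel"
    unfolding q_def by (rule measurable_compose[OF N]) simp
  have q_pos: "0 < q x" for x by (simp add: q_def c_pos)
  have [measurable]: "cball (0::'a) r \<in> sets borel" for r by simp
  have "(\<integral>\<^sup>+x. ennreal (1 / q x) \<partial>lborel) \<le> (\<integral>\<^sup>+x. (\<Sum>k. ennreal (1 / c k) * indicator (cball (0::'a) (real k)) x) \<partial>lborel)"
  proof (rule nn_integral_mono)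
    fix x :: 'a
    \<comment> \<open>The single term whose index is the ceiling of \<open>norm x\<close> already
      equals \<open>1 / q x\<close>.\<close>
    have "x \<in> cball 0 (real (nat \<lceil>norm x\<rceil>))" by (simp add: real_nat_ceiling_ge)
    then have "ennreal (1 / q x) = (\<Sum>k\<in>{nat \<lceil>norm x\<rceil>}. ennreal (1 / c k) * indicator (cball (0::'a) (real k)) x)"
      by (simp add: q_def)
    also have "\<dots> \<le> (\<Sum>k. ennreal (1 / c k) * indicator (cball (0::'a) (real k)) x)"
      by (rule sum_le_suminf) auto
    finally show "ennreal (1 / q x) \<le> \<dots>" .
  qed
  also have "\<dots> = (\<Sum>k. \<integral>\<^sup>+x. ennreal (1 / c k) * indicator (cball (0::'a) (real k)) x \<partial>lborel)"
    by (rule nn_integral_suminf) measurable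
  also have "\<dots> \<le> (\<Sum>k. ennreal ((1 / 2) ^ k))"
  proof (rule suminf_le)
    fix k
    have "(\<integral>\<^sup>+x. ennreal (1 / c k) * indicator (cball (0::'a) (real k)) x \<partial>lborel)
        = ennreal (1 / c k) * emeasure lborel (cball (0::'a) (real k))"
      by (rule nn_integral_cmult_indicator) simp
    also have "emeasure lborel (cball (0::'a) (real k)) = ennreal (V k)"
      unfolding V_def using emeasure_lborel_cball_finite[of "0::'a" "real k"]
      by (intro emeasure_eq_ennreal_measure) simp
    also have "ennreal (1 / c k) * ennreal (V k) \<le> ennreal ((1 / 2) ^ k)"
    proof -
      have "1 / c k * V k = (1 / 2) ^ k * (V k / (1 + V k))" by (simp add: c_def power_one_over)
      also have "\<dots> \<le> (1 / 2) ^ k * 1" using V[of k] by (intro mult_left_mono) auto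
      finally show ?thesis using c_pos[of k] V[of k] by (simp add: ennreal_leI flip: ennreal_mult)
    qed
    finally show "(\<integral>\<^sup>+x. ennreal (1 / c k) * indicator (cball (0::'a) (real k)) x \<partial>lborel) \<le> ennreal ((1 / 2) ^ k)" .
  qed auto
  also have "\<dots> = ennreal (\<Sum>k. (1 / 2) ^ k)"
    by (intro suminf_ennreal2 summable_geometric) auto
  also have "\<dots> < \<infinity>" by simp
  finally have "(\<integral>\<^sup>+x. ennreal (1 / q x) \<partial>lborel) < \<infinity>" .
  then have "integrable lborel (\<lambda>x. 1 / q x)"
    using q_pos by (intro integrableI_nonneg) (auto simp: less_imp_le)
  moreover have "\<exists>C. \<forall>x\<in>cball 0 R. q x \<le> C" for R
  proof (intro exI ballI)
    fix x :: 'a assume "x \<in> cball 0 R"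
    then show "q x \<le> c (nat \<lceil>R\<rceil>)"
      unfolding q_def by (intro c_mono nat_mono ceiling_mono) simp
  qed
  ultimately show ?thesis using that q q_pos by blast
qed

text \<open>On the measure with density \<open>q\<close> the quadratic functional is bounded below,
  so \<open>riesz_L2\<close> yields \<open>u\<close>, and \<open>w\<close> is \<open>q\<close> times
  \<open>u\<close>. Local integrability of \<open>w\<close> follows from
  \<open>\<bar>u\<bar>\<close> being at most \<open>1 + u ^ 2\<close> and from \<open>q\<close>
  being locally bounded.\<close>

lemma L1_bounded_functional_representation:
  fixes U :: "('a::euclidean_space \<Rightarrow> real) \<Rightarrow> real"
  assumes lin: "\<And>a b \<phi> \<psi>. \<phi> \<in> C1c \<Longrightarrow> \<psi> \<in> C1c \<Longrightarrow> U (\<lambda>x. a * \<phi> x + b * \<psi> x) = a * U \<phi> + b * U \<psi>"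
    and bound: "\<And>\<phi>. \<phi> \<in> C1c \<Longrightarrow> \<bar>U \<phi>\<bar> \<le> c * (LINT x|lebesgue. \<bar>\<phi> x\<bar>)"
  shows "\<exists>w\<in>Lp_loc 1 UNIV. \<forall>\<phi>\<in>C1c. U \<phi> = (LINT x|lebesgue. w x * \<phi> x)"
proof -
  obtain q :: "'a \<Rightarrow> real" where q [measurable]: "q \<in> borel_measurable borel" and q_pos: "\<And>x. 0 < q x"
    and q_int: "integrable lborel (\<lambda>x. 1 / q x)" and q_loc: "\<And>R. \<exists>C. \<forall>x\<in>cball 0 R. q x \<le> C"
    by (rule ex_weight) (rule that)
  have [measurable]: "cball (0::'a) r \<in> sets borel" for r by simp
  have q_mult: "integrable lborel (\<lambda>x. q x * f x)"
    if f: "integrable lborel f" "\<And>x. x \<notin> cball 0 R \<Longrightarrow> f x = 0" for f :: "'a \<Rightarrow> real" and R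
  proof -
    obtain C where C: "\<And>x. x \<in> cball 0 R \<Longrightarrow> q x \<le> C" using q_loc[of R] by blast
    have "\<bar>indicator (cball 0 R) x * q x\<bar> \<le> max 0 C" for x
      using C[of x] q_pos[of x] by (auto simp: indicator_def le_max_iff_disj)
    moreover have "(\<lambda>x. indicator (cball 0 R) x * q x) \<in> borel_measurable lborel"
      unfolding measurable_lborel1 by measurable
    ultimately have "integrable lborel (\<lambda>x. f x * (indicator (cball 0 R) x * q x))"
      by (intro integrable_mult_bounded[OF f(1)])
    also have "(\<lambda>x. f x * (indicator (cball 0 R) x * q x)) = (\<lambda>x. q x * f x)"
      using f(2) by (intro ext) (auto simp: indicator_def)
    finally show ?thesis .
  qed
  define M where "M = density lborel (\<lambda>x. ennreal (q x))"
  have M_int: "integrable M f \<longleftrightarrow> integrable lborel (\<lambda>x. q x * f x)"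
    and M_integral: "(LINT x|M. f x) = (LINT x|lborel. q x * f x)"
    if "f \<in> borel_measurable borel" for f :: "'a \<Rightarrow> real"
    using that q_pos by (simp_all add: M_def integrable_density integral_density less_imp_le)
  have C1c_borel': "\<phi> \<in> borel_measurable borel" if "\<phi> \<in> C1c" for \<phi> :: "'a \<Rightarrow> real"
    using C1c_continuous[OF that] by (rule borel_measurable_continuous_onI)
  have C1c_int: "integrable lborel \<phi>" "integrable lborel (\<lambda>x. (\<phi> x)\<^sup>2)" if "\<phi> \<in> C1c" for \<phi> :: "'a \<Rightarrow> real"
  proof -
    show "integrable lborel \<phi>" by (rule C1c_integrable[OF that])
    show "integrable lborel (\<lambda>x. (\<phi> x)\<^sup>2)"
      by (rule integrable_compact_support[OF continuous_on_power[OF C1c_continuous[OF that]] C1c_compact[OF that]])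
        (simp add: not_supp)
  qed
  have sq: "integrable lborel (\<lambda>x. q x * (\<phi> x)\<^sup>2)" if \<phi>: "\<phi> \<in> C1c" for \<phi> :: "'a \<Rightarrow> real"
  proof -
    obtain R where "\<And>x. x \<notin> cball 0 R \<Longrightarrow> \<phi> x = 0" "\<And>x. x \<notin> cball 0 R \<Longrightarrow> grad \<phi> x = 0"
      by (rule C1c_outside_cball[OF \<phi>]) (rule that)
    then show ?thesis by (intro q_mult[of _ R] C1c_int \<phi>) simp
  qed
  have "\<exists>u\<in>borel_measurable M. integrable M (\<lambda>x. (u x)\<^sup>2) \<and> (\<forall>\<phi>\<in>C1c. U \<phi> = (LINT x|M. u x * \<phi> x))"
  proof (rule riesz_L2)
    have "(\<lambda>x::'a. 0) \<in> C1c"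
      by (rule C1cI[where G = "\<lambda>x. 0" and K = "{}"]) auto
    then show "(C1c :: ('a \<Rightarrow> real) set) \<noteq> {}" by blast
    show "(\<lambda>x. a * \<phi> x + b * \<psi> x) \<in> C1c" if "\<phi> \<in> C1c" "\<psi> \<in> C1c" for a b and \<phi> \<psi> :: "'a \<Rightarrow> real"
      by (rule C1c_add_scale[OF that])
    show "\<phi> \<in> borel_measurable M" if "\<phi> \<in> C1c" for \<phi>
      using C1c_borel'[OF that] by (simp add: M_def)
    show "integrable M (\<lambda>x. (\<phi> x)\<^sup>2)" if "\<phi> \<in> C1c" for \<phi>
      using C1c_borel'[OF that] sq[OF that] by (subst M_int) auto
    show "- (c\<^sup>2 / 2 * (LINT x|lborel. 1 / q x)) \<le> (LINT x|M. (\<phi> x)\<^sup>2) / 2 - U \<phi>" if \<phi>: "\<phi> \<in> C1c" for \<phi>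
    proof -
      note [measurable] = C1c_borel'[OF \<phi>]
      have "U \<phi> \<le> c * (LINT x|lborel. \<bar>\<phi> x\<bar>)"
        using bound[OF \<phi>] by (simp add: integral_completion abs_le_iff)
      also have "\<dots> = (LINT x|lborel. c * \<bar>\<phi> x\<bar>)" by simp
      also have "\<dots> \<le> (LINT x|lborel. 1 / 2 * (q x * (\<phi> x)\<^sup>2) + c\<^sup>2 / 2 * (1 / q x))"
      proof (rule integral_mono)
        show "integrable lborel (\<lambda>x. c * \<bar>\<phi> x\<bar>)" using C1c_int(1)[OF \<phi>] by simp
        show "integrable lborel (\<lambda>x. 1 / 2 * (q x * (\<phi> x)\<^sup>2) + c\<^sup>2 / 2 * (1 / q x))"
          by (intro Bochner_Integration.integrable_add integrable_mult_right sq \<phi> q_int)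
        fix x
        \<comment> \<open>Weighted arithmetic-geometric mean with weight \<open>q x\<close>: the
          first part is absorbed by the quadratic term, the second is integrable and gives the lower
          bound.\<close>
        have "\<bar>\<phi> x * c\<bar> \<le> (q x * (\<phi> x)\<^sup>2 + c\<^sup>2 / q x) / 2" by (rule AM_GM_abs[OF q_pos])
        moreover have "c * \<bar>\<phi> x\<bar> \<le> \<bar>\<phi> x * c\<bar>" by (simp add: abs_mult mult.commute mult_right_mono)
        ultimately show "c * \<bar>\<phi> x\<bar> \<le> 1 / 2 * (q x * (\<phi> x)\<^sup>2) + c\<^sup>2 / 2 * (1 / q x)" by simp
      qed
      also have "\<dots> = 1 / 2 * (LINT x|lborel. q x * (\<phi> x)\<^sup>2) + c\<^sup>2 / 2 * (LINT x|lborel. 1 / q x)"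
        by (simp only: integral_mult_right_zero
            Bochner_Integration.integral_add[OF integrable_mult_right[OF sq[OF \<phi>]] integrable_mult_right[OF q_int]])
      also have "\<dots> = (LINT x|M. (\<phi> x)\<^sup>2) / 2 + c\<^sup>2 / 2 * (LINT x|lborel. 1 / q x)"
        by (simp add: M_integral)
      finally show ?thesis by simp
    qed
  qed (rule lin)
  then obtain u where "u \<in> borel_measurable M" and uM: "integrable M (\<lambda>x. (u x)\<^sup>2)"
    and U: "\<And>\<phi>. \<phi> \<in> C1c \<Longrightarrow> U \<phi> = (LINT x|M. u x * \<phi> x)" by blast
  then have [measurable]: "u \<in> borel_measurable borel" by (simp add: M_def)
  have u_sq: "integrable lborel (\<lambda>x. q x * (u x)\<^sup>2)"
    using uM by (subst (asm) M_int) auto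
  \<comment> \<open>The functional is represented against \<open>q\<close> times Lebesgue measure;
    absorbing the density passes to Lebesgue measure.\<close>
  define w where "w x = q x * u x" for x
  have w [measurable]: "w \<in> borel_measurable borel" unfolding w_def by measurable
  have "w \<in> Lp_loc 1 UNIV"
  proof (rule Lp_loc_1I)
    show "w \<in> borel_measurable lebesgue" by (intro measurable_completion) simp
    fix K :: "'a set" assume K: "compact K"
    then have [measurable]: "K \<in> sets borel" by (simp add: borel_compact)
    obtain R where R: "\<And>x. x \<in> K \<Longrightarrow> norm x \<le> R" using compact_imp_bounded[OF K] by (auto simp: bounded_iff)
    have "integrable lborel (indicator K :: 'a \<Rightarrow> real)"
      using emeasure_compact_finite[OF K] by (intro integrable_real_indicator) auto
    then have qK: "integrable lborel (\<lambda>x. q x * indicator K x)"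
      by (rule q_mult[where R = R]) (use R in \<open>auto simp: indicator_def\<close>)
    have "integrable lborel (\<lambda>x. indicator K x * w x)"
    proof (rule Bochner_Integration.integrable_bound)
      show "integrable lborel (\<lambda>x. q x * indicator K x + q x * (u x)\<^sup>2)"
        by (intro Bochner_Integration.integrable_add qK u_sq)
      have "\<bar>indicator K x * w x\<bar> \<le> q x * indicator K x + q x * (u x)\<^sup>2" for x
      proof (cases "x \<in> K")
        case True
        have "\<bar>1 * u x\<bar> \<le> (1 * 1\<^sup>2 + (u x)\<^sup>2 / 1) / 2" by (rule AM_GM_abs) simp
        also have "\<dots> \<le> 1 + (u x)\<^sup>2" by simp
        finally have "q x * \<bar>u x\<bar> \<le> q x * (1 + (u x)\<^sup>2)"
          using q_pos[of x] by (intro mult_left_mono) auto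
        then show ?thesis using True q_pos[of x] by (simp add: w_def abs_mult distrib_left)
      qed (use q_pos[of x] in simp)
      then show "AE x in lborel. norm (indicator K x * w x) \<le> norm (q x * indicator K x + q x * (u x)\<^sup>2)"
        by (simp add: order_trans[OF _ abs_ge_self])
    qed measurable
    then show "integrable lebesgue (\<lambda>x. indicator K x * w x)"
      by (subst integrable_completion) auto
  qed
  moreover have "U \<phi> = (LINT x|lebesgue. w x * \<phi> x)" if "\<phi> \<in> C1c" for \<phi>
  proof -
    note [measurable] = C1c_borel'[OF that]
    show ?thesis
      by (simp add: U that M_integral integral_completion w_def mult.assoc)
  qed
  ultimately show ?thesis by blast
qed

section \<open>Extension and restriction\<close>

text \<open>The profile in the last coordinate is \<open>1\<close> at height \<open>0\<close>,
  vanishes from distance \<open>d\<close> on and is \<open>C^1\<close> through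
  \<open>pos_sq\<close>. It decays on both sides of the boundary because members of
  \<open>C1c\<close> have compact support in the whole space.\<close>

definition extend_boundary :: "real \<Rightarrow> ('a::euclidean_space \<Rightarrow> real) \<Rightarrow> 'a \<times> real \<Rightarrow> real" where
  "extend_boundary d \<phi> x = \<phi> (fst x) * pos_sq (1 - (snd x / d)\<^sup>2)"

lemma extend_boundary_0 [simp]: "extend_boundary d \<phi> (z, 0) = \<phi> z"
  by (simp add: extend_boundary_def pos_sq_def)

lemma extend_boundary_eq_0:
  assumes "0 < d" "d \<le> \<bar>snd x\<bar>"
  shows "extend_boundary d \<phi> x = 0"
proof -
  have "1\<^sup>2 \<le> \<bar>snd x / d\<bar>\<^sup>2" using assms by (intro power_mono) (auto simp: abs_divide field_simps)
  then have "1 - (snd x / d)\<^sup>2 \<le> 0" unfolding power2_abs by simp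
  then show ?thesis by (simp add: extend_boundary_def pos_sq_def max_absorb1 del: diff_le_0_iff_le)
qed

lemma extend_boundary_C1c:
  fixes \<phi> :: "'a::euclidean_space \<Rightarrow> real"
  assumes \<phi>: "\<phi> \<in> C1c" and d: "0 < d"
  shows "extend_boundary d \<phi> \<in> C1c"
proof -
  define k where "k t = pos_sq (1 - (t / d)\<^sup>2)" for t
  define k' where "k' t = 2 * max 0 (1 - (t / d)\<^sup>2) * - (2 * t / d\<^sup>2)" for t
  have "((\<lambda>t. 1 - (t / d)\<^sup>2) has_field_derivative - (2 * t / d\<^sup>2)) (at t)" for t
    using d by (auto intro!: derivative_eq_intros simp: field_simps power2_eq_square)
  from DERIV_chain2[OF pos_sq_has_field_derivative this]
  have k: "(k has_field_derivative k' t) (at t)" for t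
    unfolding k_def k'_def .
  have k_cont: "continuous_on UNIV (\<lambda>x::'a \<times> real. k (snd x))" "continuous_on UNIV (\<lambda>x::'a \<times> real. k' (snd x))"
    unfolding k_def k'_def divide_inverse by (intro continuous_intros continuous_pos_sq)+
  have fst: "continuous_on UNIV (fst :: 'a \<times> real \<Rightarrow> 'a)" by (intro continuous_intros)
  have \<phi>_cont: "continuous_on UNIV (\<lambda>x::'a \<times> real. \<phi> (fst x))" "continuous_on UNIV (\<lambda>x::'a \<times> real. grad \<phi> (fst x))"
    by (rule continuous_on_compose2[OF C1c_continuous[OF \<phi>] fst]; simp)
      (rule continuous_on_compose2[OF C1c_continuous_grad[OF \<phi>] fst]; simp)
  show ?thesis
  proof (rule C1cI[where G = "\<lambda>x. (k (snd x) *\<^sub>R grad \<phi> (fst x), \<phi> (fst x) * k' (snd x))"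
      and K = "supp \<phi> \<times> {- d..d}"])
    fix x :: "'a \<times> real"
    have 1: "((\<lambda>x. \<phi> (fst x)) has_derivative (\<lambda>u. grad \<phi> (fst x) \<bullet> fst u)) (at x)"
      by (rule has_derivative_compose[OF has_derivative_fst[OF has_derivative_ident] C1c_has_derivative[OF \<phi>]])
    have 2: "((\<lambda>x. k (snd x)) has_derivative (\<lambda>u. k' (snd x) * snd u)) (at x)"
      by (rule has_derivative_compose[OF has_derivative_snd[OF has_derivative_ident]
            has_field_derivative_imp_has_derivative[OF k]])
    show "(extend_boundary d \<phi> has_derivative
        (\<lambda>u. (k (snd x) *\<^sub>R grad \<phi> (fst x), \<phi> (fst x) * k' (snd x)) \<bullet> u)) (at x)"
      unfolding extend_boundary_def k_def[symmetric]
      by (rule has_derivative_eq_rhs[OF has_derivative_mult[OF 1 2]])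
        (simp add: inner_prod_def fun_eq_iff algebra_simps)
    show "compact (supp \<phi> \<times> {- d..d})"
      by (intro compact_Times C1c_compact \<phi> compact_Icc)
    show "extend_boundary d \<phi> y = 0" if "y \<notin> supp \<phi> \<times> {- d..d}" for y
    proof (cases "fst y \<in> supp \<phi>")
      case True
      then have "d \<le> \<bar>snd y\<bar>" using that by (cases y) auto
      then show ?thesis by (rule extend_boundary_eq_0[OF d])
    qed (simp add: extend_boundary_def not_supp)
  qed (intro continuous_on_Pair continuous_on_scaleR continuous_on_mult k_cont \<phi>_cont)
qed

lemma boundary_restriction_C1c:
  fixes \<Phi> :: "'a::euclidean_space \<times> real \<Rightarrow> real"
  assumes \<Phi>: "\<Phi> \<in> C1c"
  shows "(\<lambda>z. \<Phi> (z, 0)) \<in> C1c"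
proof (rule C1cI[where G = "\<lambda>z. fst (grad \<Phi> (z, 0))" and K = "fst ` supp \<Phi>"])
  have E: "continuous_on UNIV (\<lambda>z::'a. (z, 0::real))" by (intro continuous_intros)
  show "continuous_on UNIV (\<lambda>z. fst (grad \<Phi> (z, 0)))"
    by (intro continuous_on_fst continuous_on_compose2[OF C1c_continuous_grad[OF \<Phi>] E]) simp
  show "compact (fst ` supp \<Phi>)"
    by (intro compact_continuous_image continuous_intros C1c_compact \<Phi>)
  show "\<Phi> (z, 0) = 0" if "z \<notin> fst ` supp \<Phi>" for z
    using that not_supp[of "(z, 0)" \<Phi>] by force
  fix z
  have "((\<lambda>z::'a. (z, 0::real)) has_derivative (\<lambda>u. (u, 0))) (at z)"
    by (intro has_derivative_Pair has_derivative_ident has_derivative_const)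
  from has_derivative_compose[OF this C1c_has_derivative[OF \<Phi>]]
  show "((\<lambda>z. \<Phi> (z, 0)) has_derivative (\<lambda>u. fst (grad \<Phi> (z, 0)) \<bullet> u)) (at z)"
    by (simp add: inner_prod_def)
qed

section \<open>Existence and size of the trace of a boundary layer field\<close>

context boundary_layer_field
begin

text \<open>With the height \<open>\<delta>'\<close> existentially quantified, the test functions
  form a linear space: for two of them the larger height serves.\<close>

definition admissible :: "((real ^ 'm) \<times> real \<Rightarrow> real) \<Rightarrow> bool" where
  "admissible \<Phi> \<longleftrightarrow> \<Phi> \<in> C1c \<and> (\<exists>\<delta>'. ereal \<delta>' < \<delta> \<and> (\<forall>x. \<delta>' \<le> snd x \<longrightarrow> \<Phi> x = 0))"

lemma admissible_C1c: "admissible \<Phi> \<Longrightarrow> \<Phi> \<in> C1c"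
  by (simp add: admissible_def)

lemma admissible_add_scale:
  assumes "admissible \<Phi>" "admissible \<Psi>"
  shows "admissible (\<lambda>x. a * \<Phi> x + b * \<Psi> x)"
proof -
  obtain d1 d2 where d: "ereal d1 < \<delta>" "\<And>x. d1 \<le> snd x \<Longrightarrow> \<Phi> x = 0" "ereal d2 < \<delta>" "\<And>x. d2 \<le> snd x \<Longrightarrow> \<Psi> x = 0"
    using assms unfolding admissible_def by blast
  show ?thesis
    unfolding admissible_def
    using C1c_add_scale[OF assms[THEN admissible_C1c]] d
    by (intro conjI exI[of _ "max d1 d2"]) (auto simp: max_def)
qed

lemma admissible_extend_boundary:
  assumes "\<phi> \<in> C1c" "0 < d" "ereal d < \<delta>"
  shows "admissible (extend_boundary d \<phi>)"
  unfolding admissible_def using assms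
  by (intro conjI exI[of _ d] extend_boundary_C1c) (auto simp: extend_boundary_eq_0)

lemma T_bound_real:
  assumes \<Phi>: "admissible \<Phi>"
  shows "\<bar>T \<Phi>\<bar> \<le> trace_const CARD('m) * B * (LINT z|lebesgue. \<bar>\<Phi> (z, 0)\<bar>)"
proof -
  obtain \<delta>' where \<delta>': "ereal \<delta>' < \<delta>" "\<And>x. \<delta>' \<le> snd x \<Longrightarrow> \<Phi> x = 0"
    using \<Phi> unfolding admissible_def by blast
  note C = boundary_restriction_C1c[OF admissible_C1c[OF \<Phi>]]
  have [measurable]: "(\<lambda>z. \<Phi> (z, 0)) \<in> borel_measurable borel"
    by (rule C1c_boundary_borel[OF admissible_C1c[OF \<Phi>]])
  have "integrable lborel (\<lambda>z. \<bar>\<Phi> (z, 0)\<bar>)"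
    by (intro integrable_abs C1c_integrable C)
  from nn_integral_eq_integral[OF this]
  have eq: "(\<integral>\<^sup>+z. ennreal \<bar>\<Phi> (z, 0)\<bar> \<partial>lborel) = ennreal (LINT z|lebesgue. \<bar>\<Phi> (z, 0)\<bar>)"
    by (simp add: integral_completion)
  have nn: "0 \<le> trace_const CARD('m) * B"
    using trace_const_pos[of "CARD('m)"] B_nonneg by simp
  have I: "0 \<le> (LINT z|lebesgue. \<bar>\<Phi> (z, 0)\<bar>)" by simp
  have "ennreal \<bar>T \<Phi>\<bar> \<le> ennreal (trace_const CARD('m) * B * (LINT z|lebesgue. \<bar>\<Phi> (z, 0)\<bar>))"
    using T_bound[OF admissible_C1c[OF \<Phi>] \<delta>'] unfolding eq ennreal_mult[OF nn I] .
  then show ?thesis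
    using nn I by (simp add: ennreal_le_iff)
qed

text \<open>The difference has zero boundary values, so the bound on \<open>T\<close> leaves
  nothing.\<close>

lemma T_eq_of_boundary_eq:
  assumes "admissible \<Phi>" "admissible \<Psi>" and eq: "\<And>z. \<Phi> (z, 0) = \<Psi> (z, 0)"
  shows "T \<Phi> = T \<Psi>"
proof -
  have "\<bar>T (\<lambda>x. 1 * \<Phi> x + (- 1) * \<Psi> x)\<bar> \<le> 0"
    using T_bound_real[OF admissible_add_scale[OF assms(1,2), of 1 "- 1"]] by (simp add: eq)
  then show ?thesis
    unfolding T_add_scale[OF assms(1,2)[THEN admissible_C1c]] by simp
qed

text \<open>One fixed extension height \<open>d\<close> defines a functional of boundary data; every
  other admissible extension of the same data gives the same value of \<open>T\<close>.\<close>

lemma ex_trace: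
  assumes \<delta>: "0 < \<delta>"
  shows "\<exists>w\<in>Lp_loc 1 UNIV. \<forall>\<Phi>. admissible \<Phi> \<longrightarrow> (LINT z|lebesgue. w z * \<Phi> (z, 0)) = T \<Phi>"
proof -
  obtain d where d: "0 < d" "ereal d < \<delta>"
    using ereal_dense2[OF \<delta>] by (auto simp: zero_ereal_def)
  define U where "U \<phi> = T (extend_boundary d \<phi>)" for \<phi>
  have "\<exists>w\<in>Lp_loc 1 UNIV. \<forall>\<phi>\<in>C1c. U \<phi> = (LINT x|lebesgue. w x * \<phi> x)"
  proof (rule L1_bounded_functional_representation)
    fix a b :: real and \<phi> \<psi> :: "real ^ 'm \<Rightarrow> real" assume *: "\<phi> \<in> C1c" "\<psi> \<in> C1c"
    have "extend_boundary d (\<lambda>x. a * \<phi> x + b * \<psi> x) = (\<lambda>x. a * extend_boundary d \<phi> x + b * extend_boundary d \<psi> x)"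
      by (intro ext) (simp add: extend_boundary_def algebra_simps)
    then show "U (\<lambda>x. a * \<phi> x + b * \<psi> x) = a * U \<phi> + b * U \<psi>"
      unfolding U_def using T_add_scale[OF * [THEN extend_boundary_C1c, OF d(1)]] by simp
  next
    fix \<phi> :: "real ^ 'm \<Rightarrow> real" assume "\<phi> \<in> C1c"
    then show "\<bar>U \<phi>\<bar> \<le> trace_const CARD('m) * B * (LINT x|lebesgue. \<bar>\<phi> x\<bar>)"
      using T_bound_real[OF admissible_extend_boundary[OF _ d]] by (simp add: U_def)
  qed
  then obtain w where w: "w \<in> Lp_loc 1 UNIV" "\<And>\<phi>. \<phi> \<in> C1c \<Longrightarrow> U \<phi> = (LINT x|lebesgue. w x * \<phi> x)" by blast
  have "(LINT z|lebesgue. w z * \<Phi> (z, 0)) = T \<Phi>" if \<Phi>: "admissible \<Phi>" for \<Phi>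
  proof -
    note C = boundary_restriction_C1c[OF admissible_C1c[OF \<Phi>]]
    have "T \<Phi> = U (\<lambda>z. \<Phi> (z, 0))"
      unfolding U_def by (rule T_eq_of_boundary_eq[OF \<Phi> admissible_extend_boundary[OF C d]]) simp
    then show ?thesis using w(2)[OF C] by simp
  qed
  then show ?thesis using w(1) by blast
qed

text \<open>Every boundary function in \<open>C1c\<close> has an admissible extension, so any
  \<open>w\<close> representing \<open>T\<close> inherits its \<open>L^1\<close> estimate, and with
  it an essential bound.\<close>

lemma trace_bound:
  assumes \<delta>: "0 < \<delta>" and w: "w \<in> Lp_loc 1 UNIV"
    and trace: "\<And>\<Phi>. admissible \<Phi> \<Longrightarrow> (LINT z|lebesgue. w z * \<Phi> (z, 0)) = T \<Phi>"
  shows "Linf_norm w \<le> ennreal (trace_const CARD('m) * B)"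
proof -
  obtain d where d: "0 < d" "ereal d < \<delta>"
    using ereal_dense2[OF \<delta>] by (auto simp: zero_ereal_def)
  have "AE z in lebesgue. \<bar>w z\<bar> \<le> trace_const CARD('m) * B"
  proof (rule AE_bound_of_L1_estimate[OF w])
    fix \<phi> :: "real ^ 'm \<Rightarrow> real" assume "\<phi> \<in> C1c"
    from admissible_extend_boundary[OF this d]
    show "\<bar>LINT z|lebesgue. w z * \<phi> z\<bar> \<le> trace_const CARD('m) * B * (LINT z|lebesgue. \<bar>\<phi> z\<bar>)"
      using trace T_bound_real by fastforce
  qed
  then have "AE z in lebesgue. ennreal \<bar>w z\<bar> \<le> ennreal (trace_const CARD('m) * B)"
    by eventually_elim (rule ennreal_leI)
  moreover have "w \<in> borel_measurable lebesgue"
    using w by (simp add: Lp_loc_def set_borel_measurable_def)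
  ultimately show ?thesis
    unfolding Linf_norm_def by (intro esssup_I) auto
qed

end

section \<open>The trace theorem\<close>

lemma Lp_norm_finiteD:
  assumes "Lp_norm p E f < \<infinity>"
  shows "(\<integral>\<^sup>+x\<in>E. ennreal (\<bar>f x\<bar> powr p) \<partial>lebesgue) < \<infinity>"
  using assms by (auto simp: Lp_norm_def enn_powr_def less_top split: if_splits)

text \<open>A bounded set is covered by finitely many balls of radius \<open>r\<^sub>0\<close>, and
  \<open>\<bar>f\<bar>\<close> is at most \<open>1 + \<bar>f\<bar> powr p\<close>. As the balls may
  cross the boundary of \<open>D\<close>, this is integrability up to the boundary, which local
  integrability in \<open>D\<close> would not give.\<close>

lemma Lp_ul_norm_integrable:
  fixes f :: "'a::euclidean_space \<Rightarrow> real"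
  assumes r: "0 < r\<^sub>0" and p: "1 \<le> p" and D: "D \<in> sets borel"
    and f: "(\<lambda>x. indicator D x * f x) \<in> borel_measurable lebesgue" and fin: "Lp_ul_norm r\<^sub>0 p D f < \<infinity>"
  shows "integrable lebesgue (\<lambda>x. indicator (cball 0 R) x * (indicator D x * f x))"
proof -
  define F where "F x = indicator D x * f x" for x
  have [measurable]: "F \<in> borel_measurable lebesgue" using f unfolding F_def[abs_def] .
  have b [measurable]: "cball (a::'a) s \<in> sets lebesgue" for a s by simp
  have "D \<in> sets lborel" using D by simp
  then have [measurable]: "D \<in> sets lebesgue" by (rule sets_completionI_sets)
  have ball: "(\<integral>\<^sup>+x. indicator (cball y r\<^sub>0) x * ennreal (\<bar>F x\<bar>) \<partial>lebesgue) < \<infinity>" for y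
  proof -
    have "Lp_norm p (cball y r\<^sub>0 \<inter> D) f < \<infinity>"
      using fin unfolding Lp_ul_norm_def by (rule order_le_less_trans[rotated]) (rule SUP_upper, simp)
    from Lp_norm_finiteD[OF this]
    have 1: "(\<integral>\<^sup>+x\<in>cball y r\<^sub>0 \<inter> D. ennreal (\<bar>f x\<bar> powr p) \<partial>lebesgue) < \<infinity>" .
    have 2: "(\<integral>\<^sup>+x\<in>cball y r\<^sub>0 \<inter> D. ennreal (\<bar>f x\<bar> powr p) \<partial>lebesgue)
        = (\<integral>\<^sup>+x. indicator (cball y r\<^sub>0) x * (indicator D x * ennreal (\<bar>F x\<bar> powr p)) \<partial>lebesgue)"
      by (intro nn_integral_cong) (auto simp: F_def indicator_def)
    have "(\<integral>\<^sup>+x. indicator (cball y r\<^sub>0) x * ennreal (\<bar>F x\<bar>) \<partial>lebesgue)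
        \<le> (\<integral>\<^sup>+x. indicator (cball y r\<^sub>0) x + indicator (cball y r\<^sub>0) x * (indicator D x * ennreal (\<bar>F x\<bar> powr p)) \<partial>lebesgue)"
    proof (rule nn_integral_mono)
      fix x
      have "\<bar>F x\<bar> \<le> 1 + indicator D x * \<bar>F x\<bar> powr p"
      proof (cases "x \<in> D \<and> 1 \<le> \<bar>F x\<bar>")
        case True
        then have "\<bar>F x\<bar> powr 1 \<le> \<bar>F x\<bar> powr p" using p by (intro powr_mono) auto
        then show ?thesis using True by simp
      next
        case False
        then have "\<bar>F x\<bar> \<le> 1" by (auto simp: F_def indicator_def)
        moreover have "0 \<le> indicator D x * \<bar>F x\<bar> powr p" by simp
        ultimately show ?thesis by linarith
      qed
      then have "ennreal \<bar>F x\<bar> \<le> ennreal (1 + indicator D x * \<bar>F x\<bar> powr p)" by (rule ennreal_leI)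
      also have "\<dots> = 1 + indicator D x * ennreal (\<bar>F x\<bar> powr p)"
        by (auto simp: indicator_def)
      finally show "indicator (cball y r\<^sub>0) x * ennreal (\<bar>F x\<bar>) \<le>
          indicator (cball y r\<^sub>0) x + indicator (cball y r\<^sub>0) x * (indicator D x * ennreal (\<bar>F x\<bar> powr p))"
        by (auto simp: indicator_def)
    qed
    also have "\<dots> = emeasure lebesgue (cball y r\<^sub>0) +
        (\<integral>\<^sup>+x. indicator (cball y r\<^sub>0) x * (indicator D x * ennreal (\<bar>F x\<bar> powr p)) \<partial>lebesgue)"
    proof -
      have 1: "(\<lambda>x. indicator (cball y r\<^sub>0) x :: ennreal) \<in> borel_measurable lebesgue" by measurable
      have 2: "(\<lambda>x. indicator (cball y r\<^sub>0) x * (indicator D x * ennreal (\<bar>F x\<bar> powr p))) \<in> borel_measurable lebesgue"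
        by measurable
      show ?thesis
        by (subst nn_integral_add[OF 1 2]) (simp del: emeasure_completion)
    qed
    also have "\<dots> < \<infinity>"
      using 1 emeasure_lborel_cball_finite[of y r\<^sub>0] unfolding 2 by simp
    finally show ?thesis .
  qed
  \<comment> \<open>Total boundedness of the compact ball.\<close>
  obtain X where X: "finite X" "cball (0::'a) R \<subseteq> (\<Union>x\<in>X. ball x r\<^sub>0)"
    using compact_cball[of "0::'a" R] r unfolding compact_eq_totally_bounded by meson
  have "(\<integral>\<^sup>+x. ennreal (norm (indicator (cball 0 R) x * F x)) \<partial>lebesgue)
      \<le> (\<integral>\<^sup>+x. (\<Sum>y\<in>X. indicator (cball y r\<^sub>0) x * ennreal \<bar>F x\<bar>) \<partial>lebesgue)"
  proof (rule nn_integral_mono)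
    fix x :: 'a
    show "ennreal (norm (indicator (cball 0 R) x * F x)) \<le> (\<Sum>y\<in>X. indicator (cball y r\<^sub>0) x * ennreal \<bar>F x\<bar>)"
    proof (cases "x \<in> cball 0 R")
      case True
      then obtain y where y: "y \<in> X" "x \<in> ball y r\<^sub>0" using X(2) by blast
      then have "ennreal \<bar>F x\<bar> = indicator (cball y r\<^sub>0) x * ennreal \<bar>F x\<bar>" by simp
      also have "\<dots> \<le> (\<Sum>y\<in>X. indicator (cball y r\<^sub>0) x * ennreal \<bar>F x\<bar>)"
        by (rule member_le_sum[OF y(1) _ X(1)]) simp
      finally show ?thesis using True by simp
    qed simp
  qed
  also have "\<dots> = (\<Sum>y\<in>X. \<integral>\<^sup>+x. indicator (cball y r\<^sub>0) x * ennreal \<bar>F x\<bar> \<partial>lebesgue)"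
    by (rule nn_integral_sum) measurable
  also have "\<dots> < \<infinity>"
    using ball X(1) by (simp add: less_top)
  finally have "(\<integral>\<^sup>+x. ennreal (norm (indicator (cball 0 R) x * F x)) \<partial>lebesgue) < \<infinity>" .
  moreover have "(\<lambda>x. indicator (cball 0 R) x * F x) \<in> borel_measurable lebesgue" by measurable
  ultimately show ?thesis by (simp add: integrable_iff_bounded F_def)
qed

lemma Lp_loc_borel:
  assumes "f \<in> Lp_loc p D"
  shows "(\<lambda>x. indicator D x * f x) \<in> borel_measurable lebesgue"
  using assms by (simp add: Lp_loc_def set_borel_measurable_def)

lemma Lp_loc_mono:
  assumes "f \<in> Lp_loc p \<Omega>" "D \<subseteq> \<Omega>" "D \<in> sets lebesgue"
  shows "f \<in> Lp_loc p D"
  using assms unfolding Lp_loc_def by (auto intro: set_borel_measurable_subset)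

lemma b_seminorm_bound:
  fixes v :: "'a::euclidean_space \<Rightarrow> real"
  assumes "z \<in> frontier \<Omega>" "0 < s" "ereal s < \<nu>"
  shows "(\<integral>\<^sup>+y\<in>\<Omega> \<inter> cball z s. ennreal \<bar>v y\<bar> \<partial>lebesgue) \<le> b_seminorm \<Omega> \<nu> v * ennreal (s ^ DIM('a))"
proof -
  let ?I = "\<integral>\<^sup>+y\<in>\<Omega> \<inter> cball z s. ennreal \<bar>v y\<bar> \<partial>lebesgue" and ?c = "ennreal (s ^ DIM('a))"
  have "?I / ?c \<le> b_seminorm \<Omega> \<nu> v"
    unfolding b_seminorm_def using assms by (intro SUP_upper2[of "(z, s)"]) auto
  then have "?I / ?c * ?c \<le> b_seminorm \<Omega> \<nu> v * ?c" by (rule mult_right_mono) simp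
  moreover have "?I / ?c * ?c = ?I"
    using assms(2) by (simp add: ennreal_divide_times ennreal_divide_self)
  ultimately show ?thesis by simp
qed

text \<open>The uniformly local norms give integrability on balls, the seminorm of the normal
  component gives the mass bound, and the distributional identity, already extended to
  \<open>C^1\<close> test functions, gives \<open>div_eq\<close>. Finiteness of the seminorm makes
  \<open>enn2real\<close> faithful.\<close>

lemma boundary_layer_field_vbmo:
  fixes v :: "(real ^ 'm) \<times> real \<Rightarrow> (real ^ 'm) \<times> real"
  assumes \<nu>: "0 < \<nu>" and r: "0 < r\<^sub>0"
    and v: "v \<in> vbmo r\<^sub>0 halfspace \<mu> \<nu> \<delta>"
    and div: "has_distr_div (bnbhd halfspace \<delta>) v g"
    and g: "g \<in> Lp_ul r\<^sub>0 (real DIM((real ^ 'm) \<times> real)) (bnbhd halfspace \<delta>)"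
  shows "boundary_layer_field (\<lambda>x. indicator (bnbhd halfspace \<delta>) x *\<^sub>R v x)
    (\<lambda>x. indicator (bnbhd halfspace \<delta>) x * g x) \<delta> \<nu>
    (enn2real (b_seminorm halfspace \<nu> (\<lambda>x. grad (bdist halfspace) x \<bullet> v x)))"
proof -
  define D where "D = (bnbhd halfspace \<delta> :: ((real ^ 'm) \<times> real) set)"
  define b where "b = b_seminorm halfspace \<nu> (\<lambda>x. grad (bdist halfspace) x \<bullet> v x)"
  have D: "open D" "D \<in> sets borel"
    unfolding D_def by (intro borel_open open_bnbhd_halfspace)+
  then have D_leb: "D \<in> sets lebesgue" by (intro sets_completionI_sets) simp
  have D_sub: "D \<subseteq> halfspace" by (auto simp: D_def bnbhd_def)
  have fin: "vbmo_norm r\<^sub>0 halfspace \<mu> \<nu> \<delta> v < \<infinity>"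
    and v_loc: "\<And>i. i \<in> Basis \<Longrightarrow> (\<lambda>x. v x \<bullet> i) \<in> Lp_loc 1 halfspace"
    using v by (auto simp: vbmo_def)
  have b: "b < \<infinity>" and "(\<Sum>i\<in>Basis. Lp_ul_norm r\<^sub>0 1 D (\<lambda>x. v x \<bullet> i)) < \<infinity>"
    using fin unfolding vbmo_norm_def b_def D_def by (simp_all add: less_top)
  then have ul: "Lp_ul_norm r\<^sub>0 1 D (\<lambda>x. v x \<bullet> i) < \<infinity>" if "i \<in> Basis" for i
    using that by (simp add: less_top)
  have v_D: "(\<lambda>x. v x \<bullet> i) \<in> Lp_loc 1 D" if "i \<in> Basis" for i
    by (rule Lp_loc_mono[OF v_loc[OF that] D_sub D_leb])
  note v_borel = Lp_loc_borel[OF v_D]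
  show ?thesis
    unfolding D_def[symmetric] b_def[symmetric]
  proof
    show "integrable lebesgue (\<lambda>x. indicator (cball 0 R) x * (indicator D x * g x))" for R
    proof (rule Lp_ul_norm_integrable[OF r _ D(2)])
      show "Lp_ul_norm r\<^sub>0 (real DIM((real ^ 'm) \<times> real)) D g < \<infinity>"
        using g by (simp add: Lp_ul_def D_def)
      show "1 \<le> real DIM((real ^ 'm) \<times> real)" by simp
      show "(\<lambda>x. indicator D x * g x) \<in> borel_measurable lebesgue"
        using div by (intro Lp_loc_borel[of _ 1]) (simp add: has_distr_div_def D_def)
    qed
    show "(\<lambda>x. indicator D x *\<^sub>R v x) \<in> borel_measurable lebesgue"
      using v_borel by (subst borel_measurable_euclidean_space) simp
    show "integrable lebesgue (\<lambda>x. indicator (cball 0 R) x *\<^sub>R (indicator D x *\<^sub>R v x))" for R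
    proof -
      have "integrable lebesgue (\<lambda>x. \<Sum>i\<in>Basis. (indicator (cball 0 R) x * (indicator D x * (v x \<bullet> i))) *\<^sub>R i)"
        by (intro Bochner_Integration.integrable_sum integrable_scaleR_left
            Lp_ul_norm_integrable[OF r _ D(2) v_borel ul]) auto
      also have "(\<lambda>x. \<Sum>i\<in>Basis. (indicator (cball 0 R) x * (indicator D x * (v x \<bullet> i))) *\<^sub>R i)
          = (\<lambda>x. indicator (cball 0 R) x *\<^sub>R (indicator D x *\<^sub>R v x))"
      proof
        fix x
        have "(\<Sum>i\<in>Basis. (indicator (cball 0 R) x * (indicator D x * (v x \<bullet> i))) *\<^sub>R i)
            = (\<Sum>i\<in>Basis. ((indicator (cball 0 R) x *\<^sub>R (indicator D x *\<^sub>R v x)) \<bullet> i) *\<^sub>R i)"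
          by (simp add: mult.assoc)
        also have "\<dots> = indicator (cball 0 R) x *\<^sub>R (indicator D x *\<^sub>R v x)"
          by (rule euclidean_representation)
        finally show "(\<Sum>i\<in>Basis. (indicator (cball 0 R) x * (indicator D x * (v x \<bullet> i))) *\<^sub>R i)
            = indicator (cball 0 R) x *\<^sub>R (indicator D x *\<^sub>R v x)" .
      qed
      finally show ?thesis .
    qed
    show "indicator D x * g x = 0" "indicator D x *\<^sub>R v x = 0" if "snd x \<le> 0" for x
      using that by (auto simp: D_def bnbhd_halfspace)
    show "0 < \<nu>" by (rule \<nu>)
    show "0 \<le> enn2real b" by simp
    show "(\<integral>\<^sup>+x\<in>cball (z, 0) s. ennreal \<bar>snd (indicator D x *\<^sub>R v x)\<bar> \<partial>lebesgue)
        \<le> ennreal (enn2real b * s ^ (CARD('m) + 1))" if s: "0 < s" "ereal s < \<nu>" for z s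
    proof -
      have "(\<integral>\<^sup>+x\<in>cball (z, 0) s. ennreal \<bar>snd (indicator D x *\<^sub>R v x)\<bar> \<partial>lebesgue)
          \<le> (\<integral>\<^sup>+x\<in>halfspace \<inter> cball (z, 0) s. ennreal \<bar>grad (bdist halfspace) x \<bullet> v x\<bar> \<partial>lebesgue)"
      \<comment> \<open>On \<open>D\<close> the gradient of the distance is \<open>(0, 1)\<close>
        and both integrands agree; off \<open>D\<close> the left one is zero.\<close>
      proof (rule nn_integral_mono)
        fix x :: "(real ^ 'm) \<times> real"
        show "ennreal \<bar>snd (indicator D x *\<^sub>R v x)\<bar> * indicator (cball (z, 0) s) x
            \<le> ennreal \<bar>grad (bdist halfspace) x \<bullet> v x\<bar> * indicator (halfspace \<inter> cball (z, 0) s) x"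
          using D_sub grad_bdist_halfspace[of x]
          by (cases "x \<in> D") (auto simp: indicator_def inner_prod_def)
      qed
      also have "\<dots> \<le> b * ennreal (s ^ DIM((real ^ 'm) \<times> real))"
        unfolding b_def using s by (intro b_seminorm_bound) (simp add: frontier_halfspace)
      also have "\<dots> = ennreal (enn2real b) * ennreal (s ^ (CARD('m) + 1))"
        using b by simp
      also have "\<dots> = ennreal (enn2real b * s ^ (CARD('m) + 1))"
        using s by (intro ennreal_mult[symmetric]) auto
      finally show ?thesis .
    qed
    show "(LINT x|lebesgue. indicator D x * g x * \<Phi> x) + (LINT x|lebesgue. (indicator D x *\<^sub>R v x) \<bullet> grad \<Phi> x) = 0"
      if "\<Phi> \<in> C1c" "supp \<Phi> \<subseteq> bnbhd halfspace \<delta>" for \<Phi>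
      using has_distr_div_C1c[OF div[folded D_def] D(1) v_D that[folded D_def]]
      by (simp add: set_lebesgue_integral_def mult.assoc)
  qed
qed

theorem theorem21:
  fixes \<mu> \<nu> \<delta> :: ereal and r\<^sub>0 :: real
  assumes "0 < \<mu>" and "0 < \<nu>" and "0 < \<delta>" and "0 < r\<^sub>0"
  shows "\<exists>C::real. C > 0 \<and>
    (\<forall>(v :: (real ^ 'm) \<times> real \<Rightarrow> (real ^ 'm) \<times> real) (g :: (real ^ 'm) \<times> real \<Rightarrow> real).
       v \<in> vbmo r\<^sub>0 halfspace \<mu> \<nu> \<delta> \<and>
       has_distr_div (bnbhd halfspace \<delta>) v g \<and>
       g \<in> Lp_ul r\<^sub>0 (real DIM((real ^ 'm) \<times> real)) (bnbhd halfspace \<delta>) \<longrightarrow>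
       (\<exists>w. is_normal_trace \<delta> v g w) \<and>
       (\<forall>w. is_normal_trace \<delta> v g w \<longrightarrow>
          Linf_norm w \<le> ennreal C *
            (vbmo_norm r\<^sub>0 halfspace \<mu> \<nu> \<delta> v
             + Lp_ul_norm r\<^sub>0 (real DIM((real ^ 'm) \<times> real)) (bnbhd halfspace \<delta>) g)))"
\<comment> \<open>The witness is the constant in the bound of \<open>T\<close>; the estimate is
  first proved with the seminorm \<open>b\<close> alone, which is one summand of
  \<open>vbmo_norm\<close>.\<close>
proof (intro exI[of _ "trace_const CARD('m)"] conjI trace_const_pos allI impI; (elim conjE)?)
  fix v :: "(real ^ 'm) \<times> real \<Rightarrow> (real ^ 'm) \<times> real" and g :: "(real ^ 'm) \<times> real \<Rightarrow> real"
  assume v: "v \<in> vbmo r\<^sub>0 halfspace \<mu> \<nu> \<delta>" and div: "has_distr_div (bnbhd halfspace \<delta>) v g"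
    and g: "g \<in> Lp_ul r\<^sub>0 (real DIM((real ^ 'm) \<times> real)) (bnbhd halfspace \<delta>)"
  let ?D = "bnbhd halfspace \<delta> :: ((real ^ 'm) \<times> real) set"
  define b where "b = b_seminorm halfspace \<nu> (\<lambda>x. grad (bdist halfspace) x \<bullet> v x)"
  interpret boundary_layer_field "\<lambda>x. indicator ?D x *\<^sub>R v x" "\<lambda>x. indicator ?D x * g x" \<delta> \<nu> "enn2real b"
    unfolding b_def by (rule boundary_layer_field_vbmo[OF assms(2,4) v div g])
  have b: "b < \<infinity>" and b_le: "b \<le> vbmo_norm r\<^sub>0 halfspace \<mu> \<nu> \<delta> v"
    using v by (simp_all add: vbmo_def vbmo_norm_def b_def less_top)
  have T_eq: "(LINT x:?D|lebesgue. g x * \<Phi> x) + (LINT x:halfspace|lebesgue. v x \<bullet> grad \<Phi> x) = T \<Phi>"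
    if \<Phi>: "admissible \<Phi>" for \<Phi>
  proof -
    obtain \<delta>' where \<delta>': "ereal \<delta>' < \<delta>" "\<And>x. \<delta>' \<le> snd x \<Longrightarrow> \<Phi> x = 0"
      using \<Phi> unfolding admissible_def by blast
    have "supp \<Phi> \<subseteq> {x. snd x \<le> \<delta>'}"
      by (intro supp_subset closed_Collect_le continuous_intros) (auto simp: \<delta>'(2))
    then have 0: "grad \<Phi> x = 0" if "\<delta>' < snd x" for x
      using that C1c_grad_not_supp[OF admissible_C1c[OF \<Phi>], of x] by force
    \<comment> \<open>Points of the half space outside the layer have height at least
      \<open>\<delta>\<close>, hence strictly above \<open>\<delta>'\<close>, where the gradient is
      known to vanish. So the integral over the half space reduces to the layer.\<close>
    have 1: "\<delta>' < snd x" if "x \<in> halfspace" "x \<notin> ?D" for x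
    proof -
      have "\<delta> \<le> ereal (snd x)" using that unfolding bnbhd_halfspace by (auto simp: halfspace_def)
      with \<delta>'(1) have "ereal \<delta>' < ereal (snd x)" by (rule less_le_trans)
      then show ?thesis by simp
    qed
    have "?D \<subseteq> halfspace" by (auto simp: bnbhd_def)
    then have eq: "indicator halfspace x *\<^sub>R (v x \<bullet> grad \<Phi> x) = (indicator ?D x *\<^sub>R v x) \<bullet> grad \<Phi> x" for x
      using 0[OF 1, of x] by (cases "x \<in> ?D"; cases "x \<in> halfspace") auto
    show ?thesis
      unfolding T_def set_lebesgue_integral_def eq by (simp add: mult.assoc)
  qed
  have admissible: "admissible \<Phi>" if "\<Phi> \<in> C1c" "0 < \<delta>'" "ereal \<delta>' < \<delta>"
    "\<forall>x\<in>halfspace - bnbhd halfspace (ereal \<delta>'). \<Phi> x = 0" for \<Phi> \<delta>'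
    unfolding admissible_def
  proof (intro conjI exI[of _ \<delta>'] allI impI that)
    fix x :: "(real ^ 'm) \<times> real" assume "\<delta>' \<le> snd x"
    then have "x \<in> halfspace - bnbhd halfspace (ereal \<delta>')"
      using that(2) unfolding bnbhd_halfspace by (auto simp: halfspace_def)
    then show "\<Phi> x = 0" using that(4) by blast
  qed
  show "\<exists>w. is_normal_trace \<delta> v g w"
  proof -
    obtain w where "w \<in> Lp_loc 1 UNIV" "\<And>\<Phi>. admissible \<Phi> \<Longrightarrow> (LINT z|lebesgue. w z * \<Phi> (z, 0)) = T \<Phi>"
      using ex_trace[OF assms(3)] by blast
    then have "is_normal_trace \<delta> v g w"
      unfolding is_normal_trace_def using T_eq admissible by (intro conjI ballI allI impI) simp_all
    then show ?thesis by blast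
  qed
  fix w assume w: "is_normal_trace \<delta> v g w"
  have "Linf_norm w \<le> ennreal (trace_const CARD('m) * enn2real b)"
  proof (rule trace_bound[OF assms(3)])
    show "w \<in> Lp_loc 1 UNIV" using w by (simp add: is_normal_trace_def)
    fix \<Phi> :: "(real ^ 'm) \<times> real \<Rightarrow> real" assume \<Phi>: "admissible \<Phi>"
    then obtain d where d: "ereal d < \<delta>" "\<And>x. d \<le> snd x \<Longrightarrow> \<Phi> x = 0"
      unfolding admissible_def by blast
    obtain d0 where d0: "0 < d0" "ereal d0 < \<delta>"
      using ereal_dense2[OF assms(3)] by (auto simp: zero_ereal_def)
    \<comment> \<open>The height in \<open>admissible\<close> may be any real number, whereas the
      definition of the trace asks for a positive one; hence the maximum with
      \<open>d0\<close>.\<close>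
    define \<delta>' where "\<delta>' = max d d0"
    have "0 < \<delta>'" "ereal \<delta>' < \<delta>" "d \<le> \<delta>'" using d(1) d0 by (auto simp: \<delta>'_def max_def)
    have \<Phi>_0: "\<Phi> x = 0" if "\<delta>' \<le> snd x" for x
      by (rule d(2)[OF order_trans[OF \<open>d \<le> \<delta>'\<close> that]])
    have "\<forall>x\<in>halfspace - bnbhd halfspace (ereal \<delta>'). \<Phi> x = 0"
    proof
      fix x :: "(real ^ 'm) \<times> real" assume "x \<in> halfspace - bnbhd halfspace (ereal \<delta>')"
      then have "\<delta>' \<le> snd x" unfolding bnbhd_halfspace by (auto simp: halfspace_def)
      then show "\<Phi> x = 0" by (rule \<Phi>_0)
    qed
    then have "(LINT z|lebesgue. w z * \<Phi> (z, 0)) =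
        (LINT x:?D|lebesgue. g x * \<Phi> x) + (LINT x:halfspace|lebesgue. v x \<bullet> grad \<Phi> x)"
      using w admissible_C1c[OF \<Phi>] \<open>0 < \<delta>'\<close> \<open>ereal \<delta>' < \<delta>\<close> unfolding is_normal_trace_def by blast
    then show "(LINT z|lebesgue. w z * \<Phi> (z, 0)) = T \<Phi>" using T_eq[OF \<Phi>] by simp
  qed
  also have "\<dots> = ennreal (trace_const CARD('m)) * b"
    using b trace_const_pos[of "CARD('m)"] by (simp add: ennreal_mult less_imp_le)
  also have "\<dots> \<le> ennreal (trace_const CARD('m)) * (vbmo_norm r\<^sub>0 halfspace \<mu> \<nu> \<delta> v
      + Lp_ul_norm r\<^sub>0 (real DIM((real ^ 'm) \<times> real)) (bnbhd halfspace \<delta>) g)"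
    using b_le by (intro mult_left_mono) (auto intro: add_increasing2)
  finally show "Linf_norm w \<le> ennreal (trace_const CARD('m)) * (vbmo_norm r\<^sub>0 halfspace \<mu> \<nu> \<delta> v
      + Lp_ul_norm r\<^sub>0 (real DIM((real ^ 'm) \<times> real)) (bnbhd halfspace \<delta>) g)" .
qed

end
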